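(* Let $d, \mathbf{d}, \mathbf{L}, M, K, N \in \mathbb{N}$, $A \in (0,\infty)$, $L, a, u \in \mathbb{R}$, $b \in (a, \infty)$, $v \in (u, \infty)$, $c \in [\max\{1, L, |a|, |b|, 2|u|, 2|v|\}, \infty)$, $B \in [c, \infty)$, $\mathbf{l} = (\mathbf{l}_0, \mathbf{l}_1, \ldots, \mathbf{l}_{\mathbf{L}}) \in \mathbb{N}^{\mathbf{L}+1}$, $\mathbf{N} \subseteq \{0, 1, \ldots, N\}$, assume $0 \in \mathbf{N}$, $\mathbf{L} \geq \frac{A \mathbbm{1}_{(6^d,\infty)}(A)}{2d} + 1$, $\mathbf{l}_0 = d$, $\mathbf{l}_1 \geq A \mathbbm{1}_{(6^d,\infty)}(A)$, $\mathbf{l}_{\mathbf{L}} = 1$, and $\mathbf{d} \geq \sum_{i=1}^{\mathbf{L}} \mathbf{l}_i(\mathbf{l}_{i-1}+1)$, and assume for all $i \in \{2, 3, \ldots\} \cap [0, \mathbf{L})$ that $\mathbf{l}_i \geq \mathbbm{1}_{(6^d,\infty)}(A) \max\{A/d - 2i + 3, 2\}$. Let $(\Omega, \mathcal{F}, \mathbb{P})$ be a probability space, let $X_j \colon \Omega \to [a,b]^d$, $j \in \mathbb{N}$, and $Y_j \colon \Omega \to [u,v]$, $j \in \mathbb{N}$, be functions, assume that $(X_j, Y_j)$, $j \in \{1, 2, \ldots, M\}$, are i.i.d. random variables, let $\mathcal{E} \colon [a,b]^d \to [u,v]$ satisfy $\mathbb{P}$-a.s. that $\mathcal{E}(X_1)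 = \mathbb{E}[Y_1 \mid X_1]$, and assume for all $x, y \in [a,b]^d$ that $|\mathcal{E}(x) - \mathcal{E}(y)| \leq L \|x-y\|_1$. Let $\Theta_{k,n} \colon \Omega \to \mathbb{R}^{\mathbf{d}}$, $k, n \in \mathbb{N}_0$, and $\mathbf{k} \colon \Omega \to (\mathbb{N}_0)^2$ be random variables, assume $\bigl(\bigcup_{k=1}^\infty \Theta_{k,0}(\Omega)\bigr) \subseteq [-B, B]^{\mathbf{d}}$, assume that $\Theta_{k,0}$, $k \in \{1, 2, \ldots, K\}$, are i.i.d., assume that $\Theta_{1,0}$ is continuous uniformly distributed on $[-c, c]^{\mathbf{d}}$, and let $\mathcal{R} \colon \mathbb{R}^{\mathbf{d}} \times \Omega \to [0,\infty)$ satisfy for all $\theta \in \mathbb{R}^{\mathbf{d}}$, $\omega \in \Omega$ that $$\mathcal{R}(\theta, \omega) = \frac{1}{M} \biggl[ \sum_{j=1}^M |\mathcal{N}^{\theta,\mathbf{l}}_{u,v}(X_j(\omega)) - Y_j(\omega)|^2 \biggr] \quad\text{and}\quad \mathbf{k}(\omega) \in \operatorname{arg\,min}_{(k,n) \in \{1,2,\ldots,K\} \times \mathbf{N},\ \|\Theta_{k,n}(\omega)\|_\infty \leq B} \mathcal{R}(\Theta_{k,n}(\omega), \omega).$$ Then it holds for all $p \in (0,\infty)$ that $$\begin{aligned} &\Bigl( \mathbb{E}\Bigl[ \Bigl( \int_{[a,b]^d} |\mathcal{N}^{\Theta_{\mathbf{k}},\mathbf{l}}_{u,v}(x) - \mathcal{E}(x)|^2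 \, \mathbb{P}_{X_1}(\mathrm{d}x) \Bigr)^p \Bigr] \Bigr)^{1/p} \\ &\leq \frac{9 d^2 L^2 (b-a)^2}{A^{2/d}} + \frac{4(v-u) \mathbf{L} (\|\mathbf{l}\|_\infty + 1)^{\mathbf{L}} c^{\mathbf{L}+1} \max\{1,p\}}{K^{[\mathbf{L}^{-1} (\|\mathbf{l}\|_\infty+1)^{-2}]}} + \frac{18 \max\{1, (v-u)^2\} \mathbf{L} (\|\mathbf{l}\|_\infty+1)^2 \max\{p, \ln(3MBc)\}}{\sqrt{M}} \\ &\leq \frac{36 d^2 c^4}{A^{2/d}} + \frac{4 \mathbf{L} (\|\mathbf{l}\|_\infty + 1)^{\mathbf{L}} c^{\mathbf{L}+2} \max\{1,p\}}{K^{[\mathbf{L}^{-1} (\|\mathbf{l}\|_\infty+1)^{-2}]}} + \frac{23 B^3 \mathbf{L} (\|\mathbf{l}\|_\infty+1)^2 \max\{p, \ln(eM)\}}{\sqrt{M}}. \end{aligned}$$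
   Context: $\mathbb{N} = \{1,2,\ldots\}$, $\mathbb{N}_0 = \{0,1,2,\ldots\}$; $\mathbbm{1}_S$ is the indicator function of $S$; $\|x\|_p = (\sum_i |x_i|^p)^{1/p}$ for $p \in [1,\infty)$ and $\|x\|_\infty = \max_i |x_i|$. $\mathbb{P}_{X}$ denotes the law of $X$. Affine maps: for $\mathbf{d}, m, n \in \mathbb{N}$, $s \in \mathbb{N}_0$, $\theta \in \mathbb{R}^{\mathbf{d}}$ with $\mathbf{d} \geq s + mn + m$, $\mathcal{A}^{\theta,s}_{m,n} \colon \mathbb{R}^n \to \mathbb{R}^m$ is $\mathcal{A}^{\theta,s}_{m,n}(x) = Wx + \beta$ with $W_{i,j} = \theta_{s+(i-1)n+j}$ and $\beta_i = \theta_{s+mn+i}$ ($1 \le i \le m$, $1 \le j \le n$). Rectified clipped DNN: for $\mathbf{d}, \mathbf{L} \in \mathbb{N}$, $u \in [-\infty,\infty)$, $v \in (u,\infty]$, $\mathbf{l} = (\mathbf{l}_0,\ldots,\mathbf{l}_{\mathbf{L}}) \in \mathbb{N}^{\mathbf{L}+1}$, $\theta \in \mathbb{R}^{\mathbf{d}}$ with $\mathbf{d} \geq \sum_{i=1}^{\mathbf{L}} \mathbf{l}_i(\mathbf{l}_{i-1}+1)$, let $s_k = \sum_{i=1}^{k-1} \mathbf{l}_i(\mathbf{l}_{i-1}+1)$ (so $s_1 = 0$). Let $R_n \colon \mathbb{R}^n \to \mathbb{R}^n$ apply $x \mapsto \max\{x,0\}$ componentwise and let $C_{u,v,n} \colon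 \mathbb{R}^n \to \mathbb{R}^n$ apply $x \mapsto \max\{u,\min\{x,v\}\}$ componentwise. Then $\mathcal{N}^{\theta,\mathbf{l}}_{u,v} \colon \mathbb{R}^{\mathbf{l}_0} \to \mathbb{R}^{\mathbf{l}_{\mathbf{L}}}$ is $\mathcal{N}^{\theta,\mathbf{l}}_{u,v} = C_{u,v,\mathbf{l}_{\mathbf{L}}} \circ \mathcal{A}^{\theta,s_{\mathbf{L}}}_{\mathbf{l}_{\mathbf{L}},\mathbf{l}_{\mathbf{L}-1}} \circ R_{\mathbf{l}_{\mathbf{L}-1}} \circ \mathcal{A}^{\theta,s_{\mathbf{L}-1}}_{\mathbf{l}_{\mathbf{L}-1},\mathbf{l}_{\mathbf{L}-2}} \circ \cdots \circ R_{\mathbf{l}_1} \circ \mathcal{A}^{\theta,0}_{\mathbf{l}_1,\mathbf{l}_0}$ (for $\mathbf{L}=1$: $C_{u,v,\mathbf{l}_1} \circ \mathcal{A}^{\theta,0}_{\mathbf{l}_1,\mathbf{l}_0}$). $\Theta_{\mathbf{k}}$ denotes $\omega \mapsto \Theta_{\mathbf{k}(\omega)}(\omega)$, i.e. $\Theta_{k,n}(\omega)$ when $\mathbf{k}(\omega)=(k,n)$. The arg min denotes the set of minimisers over the indicated finite index set. *)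

theory Defs
  imports "HOL-Probability.Probability"
begin

text \<open>
  The dimensions of the layers of a network vary inside the statement, so
  a vector in the Euclidean space of dimension n is a function
  \<open>nat \<Rightarrow> real\<close> that is extensional on the index set \<open>{1..n}\<close>, as in
  \<^const>\<open>PiM\<close>, and its components are numbered from 1.
\<close>

definition vec_space :: "nat \<Rightarrow> (nat \<Rightarrow> real) measure" where
  "vec_space n = PiM {1..n} (\<lambda>_. borel)"

definition cube :: "nat \<Rightarrow> real \<Rightarrow> real \<Rightarrow> (nat \<Rightarrow> real) set" where
  "cube n a b = {1..n} \<rightarrow>\<^sub>E {a..b}"

definition pnorm :: "nat set \<Rightarrow> real \<Rightarrow> (nat \<Rightarrow> real) \<Rightarrow> real" where
  "pnorm I p x = (\<Sum>i\<in>I. \<bar>x i\<bar> powr p) powr (1 / p)"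

definition maxnorm :: "nat set \<Rightarrow> (nat \<Rightarrow> real) \<Rightarrow> real" where
  "maxnorm I x = Max ((\<lambda>i. \<bar>x i\<bar>) ` I)"

definition affine_map ::
  "(nat \<Rightarrow> real) \<Rightarrow> nat \<Rightarrow> nat \<Rightarrow> nat \<Rightarrow> (nat \<Rightarrow> real) \<Rightarrow> nat \<Rightarrow> real" where
  "affine_map \<theta> s m n x =
     (\<lambda>i\<in>{1..m}. (\<Sum>j\<in>{1..n}. \<theta> (s + (i - 1) * n + j) * x j) + \<theta> (s + m * n + i))"

definition rectify :: "nat \<Rightarrow> (nat \<Rightarrow> real) \<Rightarrow> nat \<Rightarrow> real" where
  "rectify n x = (\<lambda>i\<in>{1..n}. max (x i) 0)"

text \<open>The clipping bounds may be infinite; for \<open>u < \<infinity>\<close> and \<open>u < v\<close> the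
  clipped value of a real number is finite.\<close>

definition clip :: "ereal \<Rightarrow> ereal \<Rightarrow> nat \<Rightarrow> (nat \<Rightarrow> real) \<Rightarrow> nat \<Rightarrow> real" where
  "clip u v n x = (\<lambda>i\<in>{1..n}. real_of_ereal (max u (min (ereal (x i)) v)))"

definition param_offset :: "(nat \<Rightarrow> nat) \<Rightarrow> nat \<Rightarrow> nat" where
  "param_offset l k = (\<Sum>i\<in>{1..<k}. l i * (l (i - 1) + 1))"

primrec hidden_layers ::
  "(nat \<Rightarrow> real) \<Rightarrow> (nat \<Rightarrow> nat) \<Rightarrow> nat \<Rightarrow> (nat \<Rightarrow> real) \<Rightarrow> nat \<Rightarrow> real" where
  "hidden_layers \<theta> l 0 = (\<lambda>x. x)"
| "hidden_layers \<theta> l (Suc k) =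
     rectify (l (Suc k)) \<circ> affine_map \<theta> (param_offset l (Suc k)) (l (Suc k)) (l k)
       \<circ> hidden_layers \<theta> l k"

text \<open>The architecture \<open>(l 0, \<dots>, l D)\<close> is given by \<open>l\<close> together with its depth
  \<open>D \<ge> 1\<close>.\<close>

definition clipped_dnn ::
  "ereal \<Rightarrow> ereal \<Rightarrow> (nat \<Rightarrow> real) \<Rightarrow> nat \<Rightarrow> (nat \<Rightarrow> nat) \<Rightarrow> (nat \<Rightarrow> real) \<Rightarrow> nat \<Rightarrow> real" where
  "clipped_dnn u v \<theta> D l =
     clip u v (l D) \<circ> affine_map \<theta> (param_offset l D) (l D) (l (D - 1))
       \<circ> hidden_layers \<theta> l (D - 1)"

definition iid ::
  "'w measure \<Rightarrow> 'b measure \<Rightarrow> ('i \<Rightarrow> 'w \<Rightarrow> 'b) \<Rightarrow> 'i set \<Rightarrow> bool" where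
  "iid P S Z I \<longleftrightarrow> prob_space.indep_vars P (\<lambda>_. S) Z I \<and>
     (\<forall>i\<in>I. \<forall>j\<in>I. distr P S (Z i) = distr P S (Z j))"

definition sigma_gen :: "'w measure \<Rightarrow> 'b measure \<Rightarrow> ('w \<Rightarrow> 'b) \<Rightarrow> 'w measure" where
  "sigma_gen P S Z = vimage_algebra (space P) Z S"

definition uniform_cube :: "nat \<Rightarrow> real \<Rightarrow> (nat \<Rightarrow> real) measure" where
  "uniform_cube n c = uniform_measure (PiM {1..n} (\<lambda>_. lborel)) (cube n (- c) c)"

end

theory Submission
  imports Defs "HOL-Real_Asymp.Real_Asymp"
begin

text \<open>
  Let \<open>condY\<close> be the conditional expectation of \<open>Y 1\<close> given \<open>X 1\<close>. The mean square distance
  of a network to it is the excess of its true risk over the noise. As the chosen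
  parameter minimizes the empirical risk, comparison with the starting point \<open>\<Theta> k 0\<close>
  nearest to some \<open>\<eta>\<close> in the cube of radius \<open>c\<close> bounds the error by three terms:
  the squared distance of the network of \<open>\<eta>\<close> to \<open>\<E>\<close>, the Lipschitz constant of the
  networks in their parameters times the distance to that starting point, and twice the
  uniform deviation of the empirical from the true risk.

  For the first term, \<open>\<eta>\<close> realizes the maximum of cones with apexes at the points of a grid.
  For the second, the suitably scaled \<open>n\<close>-th power of the distance has an exponential tail.
  For the third, the parameter cube is replaced by a finite grid, and Hoeffding's lemma
  bounds the moment of an order \<open>q\<close> so large that the size of the grid is at most \<open>exp q / 2\<close>.
\<close>

section \<open>Networks and their parameters\<close>

text \<open>The selected index depends on the data, so the empirical risk at the selected parameter
  is not an average of independent terms, and only a bound uniform over the cube of radius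
  \<open>B\<close> applies to it. With \<open>w\<close> the maximal width plus one, the maximum over
  the grid is estimated in its moment of order \<open>q = (LL * w\<^sup>2 * g)\<^sup>2\<close>:
  Hoeffding moments grow like \<open>sqrt q\<close>, which gives the factor
  \<open>LL * w\<^sup>2 * g\<close> of the third term. A network reads only the first
  \<open>n \<le> LL * w\<^sup>2\<close> parameters, so the random search takes place in dimension
  \<open>n\<close>, whence the exponent \<open>1 / (LL * w\<^sup>2)\<close> of \<open>K\<close>. All
  admissible parameters lie in the cube of radius \<open>B\<close>, but \<eta> and, almost surely,
  the starting points lie in the cube of radius \<open>c\<close>; therefore the second term involves
  \<open>c\<close> only. The error itself is never shown to be measurable: it is compared almost
  everywhere with a measurable majorant, and its moments are nonnegative integrals, which are
  monotone without measurability.\<close>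

lemma clipped_dnn_real:
  assumes "l D = 1"
  shows "clipped_dnn (ereal u) (ereal v) \<theta> D l x 1 =
    max u (min (affine_map \<theta> (param_offset l D) (l D) (l (D - 1)) (hidden_layers \<theta> l (D - 1) x) 1) v)"
proof -
  have "real_of_ereal (max (ereal u) (min (ereal t) (ereal v))) = max u (min t v)" for t
    by (simp add: max_def min_def)
  then show ?thesis using assms by (simp add: clipped_dnn_def clip_def)
qed

lemma param_offset_Suc:
  "k \<ge> 1 \<Longrightarrow> param_offset l (Suc k) = param_offset l k + l k * (l (k - 1) + 1)"
  by (simp add: param_offset_def)

lemma param_offset_mono: "j \<le> k \<Longrightarrow> param_offset l j \<le> param_offset l k"
  unfolding param_offset_def by (rule sum_mono2) auto

section \<open>Lipschitz dependence of a network on its parameters\<close>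

lemma affine_map_bound:
  assumes "i \<in> {1..m}" "real n \<le> w" "0 \<le> b" "0 \<le> h"
    and \<theta>: "\<And>t. t \<in> {s + 1..s + m * n + m} \<Longrightarrow> \<bar>\<theta> t\<bar> \<le> b"
    and x: "\<And>j. j \<in> {1..n} \<Longrightarrow> \<bar>x j\<bar> \<le> h"
  shows "\<bar>affine_map \<theta> s m n x i\<bar> \<le> w * b * h + b"
proof -
  have idx: "s + (i - 1) * n + j \<in> {s + 1..s + m * n + m}" if "j \<in> {1..n}" for j
  proof -
    have "(i - 1) * n + j \<le> (i - 1) * n + n" using that by simp
    also have "\<dots> = i * n" using assms(1) by (cases i) auto
    also have "\<dots> \<le> m * n" using assms(1) by simp
    finally show ?thesis using that by simp
  qed
  have "\<bar>\<Sum>j\<in>{1..n}. \<theta> (s + (i - 1) * n + j) * x j\<bar>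
      \<le> (\<Sum>j\<in>{1..n}. \<bar>\<theta> (s + (i - 1) * n + j) * x j\<bar>)" by (rule sum_abs)
  also have "\<dots> \<le> (\<Sum>j\<in>{1..n}. b * h)"
    unfolding abs_mult using idx \<theta> x \<open>0 \<le> b\<close> by (intro sum_mono mult_mono) auto
  also have "\<dots> = real n * (b * h)" by simp
  also have "\<dots> \<le> w * (b * h)" using assms by (intro mult_right_mono) auto
  finally have "\<bar>\<Sum>j\<in>{1..n}. \<theta> (s + (i - 1) * n + j) * x j\<bar> \<le> w * b * h" by (simp add: mult.assoc)
  moreover have "\<bar>\<theta> (s + m * n + i)\<bar> \<le> b" using assms(1) by (intro \<theta>) auto
  ultimately show ?thesis using assms(1) by (simp add: affine_map_def)
qed

text \<open>The difference splits as \<open>\<theta> * (x - y) + (\<theta> - \<eta>) * y\<close>, so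
  bounds are needed only on \<open>\<theta>\<close> and on \<open>y\<close>.\<close>

lemma affine_map_lipschitz:
  assumes "i \<in> {1..m}" "real n \<le> w" "0 \<le> b" "0 \<le> h" "0 \<le> e" "0 \<le> \<delta>"
    and \<theta>: "\<And>t. t \<in> {s + 1..s + m * n + m} \<Longrightarrow> \<bar>\<theta> t\<bar> \<le> b \<and> \<bar>\<theta> t - \<eta> t\<bar> \<le> \<delta>"
    and x: "\<And>j. j \<in> {1..n} \<Longrightarrow> \<bar>y j\<bar> \<le> h \<and> \<bar>x j - y j\<bar> \<le> e"
  shows "\<bar>affine_map \<theta> s m n x i - affine_map \<eta> s m n y i\<bar> \<le> w * b * e + w * \<delta> * h + \<delta>"
proof -
  have idx: "s + (i - 1) * n + j \<in> {s + 1..s + m * n + m}" if "j \<in> {1..n}" for j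
  proof -
    have "(i - 1) * n + j \<le> (i - 1) * n + n" using that by simp
    also have "\<dots> = i * n" using assms(1) by (cases i) auto
    also have "\<dots> \<le> m * n" using assms(1) by simp
    finally show ?thesis using that by simp
  qed
  let ?a = "\<lambda>j. \<theta> (s + (i - 1) * n + j)" and ?c = "\<lambda>j. \<eta> (s + (i - 1) * n + j)"
  have "\<bar>(\<Sum>j\<in>{1..n}. ?a j * x j) - (\<Sum>j\<in>{1..n}. ?c j * y j)\<bar>
      = \<bar>\<Sum>j\<in>{1..n}. ?a j * (x j - y j) + (?a j - ?c j) * y j\<bar>"
    unfolding sum_subtractf[symmetric] by (intro arg_cong[of _ _ abs] sum.cong) (auto simp: algebra_simps)
  also have "\<dots> \<le> (\<Sum>j\<in>{1..n}. \<bar>?a j * (x j - y j) + (?a j - ?c j) * y j\<bar>)" by (rule sum_abs)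
  also have "\<dots> \<le> (\<Sum>j\<in>{1..n}. b * e + \<delta> * h)"
  proof (rule sum_mono)
    fix j assume j: "j \<in> {1..n}"
    have "\<bar>?a j * (x j - y j)\<bar> \<le> b * e" "\<bar>(?a j - ?c j) * y j\<bar> \<le> \<delta> * h"
      unfolding abs_mult using \<theta>[OF idx[OF j]] x[OF j] assms by (auto intro!: mult_mono)
    then show "\<bar>?a j * (x j - y j) + (?a j - ?c j) * y j\<bar> \<le> b * e + \<delta> * h" by linarith
  qed
  also have "\<dots> = real n * (b * e + \<delta> * h)" by simp
  also have "\<dots> \<le> w * (b * e + \<delta> * h)" using assms by (intro mult_right_mono) auto
  finally have "\<bar>(\<Sum>j\<in>{1..n}. ?a j * x j) - (\<Sum>j\<in>{1..n}. ?c j * y j)\<bar> \<le> w * b * e + w * \<delta> * h"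
    by (simp add: algebra_simps)
  moreover have "\<bar>\<theta> (s + m * n + i) - \<eta> (s + m * n + i)\<bar> \<le> \<delta>" using assms(1) \<theta> by auto
  ultimately show ?thesis using assms(1) by (simp add: affine_map_def)
qed

lemma layer_params_subset:
  assumes "1 \<le> k" "k \<le> D"
  shows "{param_offset l k + 1..param_offset l k + l k * l (k - 1) + l k} \<subseteq> {1..param_offset l (Suc D)}"
  using param_offset_Suc[of k l] param_offset_mono[of "Suc k" "Suc D" l] assms by auto

text \<open>\<open>w\<close> exceeds every width by one: a layer sums at most \<open>w - 1\<close>
  products, and the spare unit of \<open>w\<close> absorbs the bias because the bound
  \<open>w ^ k * b ^ (k + 1)\<close> on the neurons is at least 1. In the second estimate every
  layer adds one further unit \<open>w ^ k * b ^ k * \<delta>\<close>, whence the factor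
  \<open>k\<close>.\<close>

lemma hidden_layers_lipschitz:
  assumes "k \<le> D" and w: "\<And>i. i \<le> D \<Longrightarrow> real (l i) + 1 \<le> w" and "1 \<le> b" "0 \<le> \<delta>"
    and \<theta>: "\<And>t. t \<in> {1..param_offset l (Suc D)} \<Longrightarrow> \<bar>\<theta> t\<bar> \<le> b \<and> \<bar>\<eta> t\<bar> \<le> b \<and> \<bar>\<theta> t - \<eta> t\<bar> \<le> \<delta>"
    and x: "\<And>j. j \<in> {1..l 0} \<Longrightarrow> \<bar>x j\<bar> \<le> b"
    and "i \<in> {1..l k}"
  shows "\<bar>hidden_layers \<eta> l k x i\<bar> \<le> w ^ k * b ^ (k + 1) \<and>
    \<bar>hidden_layers \<theta> l k x i - hidden_layers \<eta> l k x i\<bar> \<le> real k * w ^ k * b ^ k * \<delta>"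
  using assms(1,7)
proof (induction k arbitrary: i)
  case 0
  then show ?case using x by auto
next
  case (Suc k)
  let ?s = "param_offset l (Suc k)" and ?m = "l (Suc k)" and ?n = "l k"
  let ?h = "w ^ k * b ^ (k + 1)" and ?e = "real k * w ^ k * b ^ k * \<delta>"
  have w1: "w \<ge> 1" using w[of 0] by simp
  have sub: "{?s + 1..?s + ?m * ?n + ?m} \<subseteq> {1..param_offset l (Suc D)}"
    using layer_params_subset[of "Suc k" D l] Suc.prems by simp
  have n: "real ?n \<le> w - 1" using w[of k] Suc.prems by simp
  have h1: "1 \<le> w ^ k" "1 \<le> b ^ (k + 1)" using w1 assms(3) by (simp_all add: one_le_power del: power_Suc)
  then have h: "1 \<le> ?h" using mult_mono[of 1 "w ^ k" 1 "b ^ (k+1)"] by linarith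
  have "\<bar>affine_map \<eta> ?s ?m ?n (hidden_layers \<eta> l k x) i\<bar> \<le> (w - 1) * b * ?h + b"
    using sub \<theta> Suc h n assms(3) by (intro affine_map_bound) auto
  also have "\<dots> \<le> w * b * ?h - b * (?h - 1)" by (simp add: algebra_simps)
  also have "\<dots> \<le> w * b * ?h" using h assms(3) by simp
  also have "\<dots> = w ^ Suc k * b ^ (Suc k + 1)" by simp
  finally have 1: "\<bar>affine_map \<eta> ?s ?m ?n (hidden_layers \<eta> l k x) i\<bar> \<le> w ^ Suc k * b ^ (Suc k + 1)" .
  have e0: "0 \<le> ?e" using w1 assms(3,4) by simp
  have "\<bar>affine_map \<theta> ?s ?m ?n (hidden_layers \<theta> l k x) i - affine_map \<eta> ?s ?m ?n (hidden_layers \<eta> l k x) i\<bar>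
     \<le> (w - 1) * b * ?e + (w - 1) * \<delta> * ?h + \<delta>"
    using sub \<theta> Suc h n assms(3,4) e0 by (intro affine_map_lipschitz) auto
  also have "\<dots> \<le> w * b * ?e + w * \<delta> * ?h - \<delta> * (?h - 1) - b * ?e" by (simp add: algebra_simps)
  also have "\<dots> \<le> w * b * ?e + w * \<delta> * ?h"
    using mult_nonneg_nonneg[of \<delta> "?h - 1"] mult_nonneg_nonneg[of b ?e] h e0 assms(3,4) by linarith
  also have "\<dots> = real (Suc k) * w ^ Suc k * b ^ Suc k * \<delta>" by (simp add: algebra_simps)
  finally have 2: "\<bar>affine_map \<theta> ?s ?m ?n (hidden_layers \<theta> l k x) i
     - affine_map \<eta> ?s ?m ?n (hidden_layers \<eta> l k x) i\<bar> \<le> real (Suc k) * w ^ Suc k * b ^ Suc k * \<delta>" .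
  show ?case using 1 2 Suc.prems by (simp add: rectify_def del: power_Suc) linarith
qed

text \<open>The last layer is estimated like a hidden one, with clipping in place of rectification;
  both are 1-Lipschitz.\<close>

lemma clipped_dnn_lipschitz:
  assumes "1 \<le> D" "l D = 1" and w: "\<And>i. i \<le> D \<Longrightarrow> real (l i) + 1 \<le> w" and "1 \<le> b" "0 \<le> \<delta>"
    and \<theta>: "\<And>t. t \<in> {1..param_offset l (Suc D)} \<Longrightarrow> \<bar>\<theta> t\<bar> \<le> b \<and> \<bar>\<eta> t\<bar> \<le> b \<and> \<bar>\<theta> t - \<eta> t\<bar> \<le> \<delta>"
    and x: "\<And>j. j \<in> {1..l 0} \<Longrightarrow> \<bar>x j\<bar> \<le> b"
  shows "\<bar>clipped_dnn (ereal u) (ereal v) \<theta> D l x 1 - clipped_dnn (ereal u) (ereal v) \<eta> D l x 1\<bar>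
    \<le> real D * w ^ D * b ^ D * \<delta>"
proof -
  obtain k where D: "D = Suc k" using assms(1) by (cases D) auto
  let ?s = "param_offset l D" and ?m = "l D" and ?n = "l k"
  let ?h = "w ^ k * b ^ (k + 1)" and ?e = "real k * w ^ k * b ^ k * \<delta>"
  let ?a = "affine_map \<theta> ?s ?m ?n (hidden_layers \<theta> l k x) 1"
  let ?c = "affine_map \<eta> ?s ?m ?n (hidden_layers \<eta> l k x) 1"
  have w1: "w \<ge> 1" using w[of 0] by simp
  have sub: "{?s + 1..?s + ?m * ?n + ?m} \<subseteq> {1..param_offset l (Suc D)}"
    using layer_params_subset[of D D l] D by simp
  have n: "real ?n \<le> w - 1" using w[of k] D by simp
  have h1: "1 \<le> w ^ k" "1 \<le> b ^ (k + 1)" using w1 assms(4) by (simp_all add: one_le_power del: power_Suc)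
  then have h: "1 \<le> ?h" using mult_mono[of 1 "w ^ k" 1 "b ^ (k+1)"] by linarith
  have e0: "0 \<le> ?e" using w1 assms(4,5) by simp
  have hid: "\<bar>hidden_layers \<eta> l k x i\<bar> \<le> ?h \<and> \<bar>hidden_layers \<theta> l k x i - hidden_layers \<eta> l k x i\<bar> \<le> ?e"
    if "i \<in> {1..l k}" for i
    by (rule hidden_layers_lipschitz[of k D]) (use D w assms(4,5) \<theta> x that in auto)
  have "\<bar>?a - ?c\<bar> \<le> (w - 1) * b * ?e + (w - 1) * \<delta> * ?h + \<delta>"
    using sub \<theta> hid h n assms(2,4,5) e0 by (intro affine_map_lipschitz) auto
  also have "\<dots> \<le> w * b * ?e + w * \<delta> * ?h - \<delta> * (?h - 1) - b * ?e" by (simp add: algebra_simps)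
  also have "\<dots> \<le> w * b * ?e + w * \<delta> * ?h"
    using mult_nonneg_nonneg[of \<delta> "?h - 1"] mult_nonneg_nonneg[of b ?e] h e0 assms(4,5) by linarith
  also have "\<dots> = real D * w ^ D * b ^ D * \<delta>" by (simp add: D algebra_simps)
  finally have "\<bar>?a - ?c\<bar> \<le> real D * w ^ D * b ^ D * \<delta>" .
  moreover have "\<bar>max u (min ?a v) - max u (min ?c v)\<bar> \<le> \<bar>?a - ?c\<bar>" by linarith
  ultimately show ?thesis using D unfolding clipped_dnn_real[of l D, OF assms(2)] by simp
qed

section \<open>Measurability in the input\<close>

lemma affine_map_measurable:
  assumes "\<And>j. j \<in> {1..n} \<Longrightarrow> (\<lambda>x. f x j) \<in> borel_measurable S"
  shows "(\<lambda>x. affine_map \<theta> s m n (f x) i) \<in> borel_measurable S"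
  using assms by (cases "i \<in> {1..m}") (auto simp: affine_map_def intro!: borel_measurable_add borel_measurable_sum borel_measurable_times)

lemma hidden_layers_measurable:
  "i \<in> {1..l k} \<Longrightarrow> (\<lambda>x. hidden_layers \<theta> l k x i) \<in> borel_measurable (vec_space (l 0))"
proof (induction k arbitrary: i)
  case 0
  then show ?case by (auto simp: vec_space_def)
next
  case (Suc k)
  have "(\<lambda>x. affine_map \<theta> (param_offset l (Suc k)) (l (Suc k)) (l k) (hidden_layers \<theta> l k x) i)
      \<in> borel_measurable (vec_space (l 0))" by (intro affine_map_measurable Suc.IH)
  then show ?case using Suc.prems by (simp add: rectify_def)
qed

lemma clipped_dnn_measurable:
  assumes "l D = 1"
  shows "(\<lambda>x. clipped_dnn (ereal u) (ereal v) \<theta> D l x 1) \<in> borel_measurable (vec_space (l 0))"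
proof -
  have "(\<lambda>x. affine_map \<theta> (param_offset l D) (l D) (l (D - 1)) (hidden_layers \<theta> l (D - 1) x) 1)
      \<in> borel_measurable (vec_space (l 0))"
    by (intro affine_map_measurable hidden_layers_measurable)
  then show ?thesis unfolding clipped_dnn_real[of l D, OF assms] by measurable
qed

text \<open>The parameter vector with prescribed weight matrices \<open>W k\<close> and biases \<open>\<beta> k\<close>: the index
  \<open>t\<close> belongs to the first layer \<open>k\<close> whose block ends at or after \<open>t\<close>.\<close>

definition encode_params ::
  "(nat \<Rightarrow> nat) \<Rightarrow> (nat \<Rightarrow> nat \<Rightarrow> nat \<Rightarrow> real) \<Rightarrow> (nat \<Rightarrow> nat \<Rightarrow> real) \<Rightarrow> nat \<Rightarrow> real" where
  "encode_params l W \<beta> t =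
    (let k = (LEAST k. t \<le> param_offset l (Suc k)); r = t - param_offset l k - 1; n = l (k - 1)
     in if r < l k * n then W k (r div n + 1) (r mod n + 1) else \<beta> k (r - l k * n + 1))"

lemma encode_params_layer:
  assumes "1 \<le> k" "r < l k * (l (k - 1) + 1)"
  shows "encode_params l W \<beta> (param_offset l k + r + 1) =
    (if r < l k * l (k - 1) then W k (r div l (k - 1) + 1) (r mod l (k - 1) + 1)
     else \<beta> k (r - l k * l (k - 1) + 1))"
proof -
  \<comment> \<open>Every earlier block ends at \<open>param_offset l k\<close> at the latest, hence
    before the index: parameters are numbered from 1, while \<open>r\<close> starts at 0.\<close>
  have "(LEAST j. param_offset l k + r + 1 \<le> param_offset l (Suc j)) = k"
  proof (rule Least_equality)
    show "param_offset l k + r + 1 \<le> param_offset l (Suc k)"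
      using assms param_offset_Suc[of k l] by simp
    fix j assume *: "param_offset l k + r + 1 \<le> param_offset l (Suc j)"
    show "k \<le> j"
    proof (rule ccontr)
      assume "\<not> k \<le> j"
      then have "param_offset l (Suc j) \<le> param_offset l k" by (intro param_offset_mono) auto
      with * show False by simp
    qed
  qed
  then show ?thesis by (simp add: encode_params_def Let_def)
qed

lemma affine_map_encode_params:
  assumes "1 \<le> k" "i \<in> {1..l k}"
  shows "affine_map (encode_params l W \<beta>) (param_offset l k) (l k) (l (k - 1)) x i =
    (\<Sum>j\<in>{1..l (k - 1)}. W k i j * x j) + \<beta> k i"
proof -
  let ?n = "l (k - 1)" and ?m = "l k"
  have "encode_params l W \<beta> (param_offset l k + (i - 1) * ?n + j) = W k i j" if j: "j \<in> {1..?n}" for j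
  proof -
    \<comment> \<open>Zero-based row-major position of the weight; division by the row length
      recovers row \<open>i - 1\<close> and column \<open>j - 1\<close>.\<close>
    let ?r = "(i - 1) * ?n + (j - 1)"
    have "?r < (i - 1) * ?n + ?n" using j by auto
    also have "\<dots> = i * ?n" using assms by (cases i) auto
    also have "\<dots> \<le> ?m * ?n" using assms by simp
    finally have "?r < ?m * ?n" .
    moreover have "j - 1 < ?n" "?n \<noteq> 0" using j by auto
    then have "?r div ?n = i - 1" "?r mod ?n = j - 1"
      by (metis add.right_neutral div_less div_mult_self3, metis mod_less mod_mult_self3)
    ultimately show ?thesis
      using encode_params_layer[OF assms(1), of ?r l W \<beta>] j assms by (simp add: add.assoc)
  qed
  moreover have "encode_params l W \<beta> (param_offset l k + ?m * ?n + i) = \<beta> k i"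
    using encode_params_layer[OF assms(1), of "?m * ?n + (i - 1)" l W \<beta>] assms by (auto simp: add.assoc)
  ultimately show ?thesis using assms by (simp add: affine_map_def)
qed

lemma encode_params_bound:
  assumes "\<And>k i j. \<bar>W k i j\<bar> \<le> b" "\<And>k i. \<bar>\<beta> k i\<bar> \<le> b"
  shows "\<bar>encode_params l W \<beta> t\<bar> \<le> b"
  using assms by (simp add: encode_params_def Let_def)

lemma hidden_layers_encode_params:
  assumes "i \<in> {1..l (Suc k)}"
  shows "hidden_layers (encode_params l W \<beta>) l (Suc k) x i =
    max ((\<Sum>j\<in>{1..l k}. W (Suc k) i j * hidden_layers (encode_params l W \<beta>) l k x j) + \<beta> (Suc k) i) 0"
  using affine_map_encode_params[of "Suc k" i l W \<beta>] assms by (simp add: rectify_def)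

lemma clipped_dnn_encode_params:
  assumes "1 \<le> D" "l D = 1"
  shows "clipped_dnn (ereal u) (ereal v) (encode_params l W \<beta>) D l x 1 =
    max u (min ((\<Sum>j\<in>{1..l (D - 1)}. W D 1 j * hidden_layers (encode_params l W \<beta>) l (D - 1) x j) + \<beta> D 1) v)"
  using affine_map_encode_params[of D 1 l W \<beta>] assms unfolding clipped_dnn_real[of l D, OF assms(2)] by simp

section \<open>Approximation of Lipschitz functions\<close>

definition kron :: "nat \<Rightarrow> nat \<Rightarrow> real" where
  "kron a j = (if j = a then 1 else 0)"

text \<open>The value 0 outside the range matters: a row of \<open>W\<close> may select a neuron
  beyond the end of the preceding layer.\<close>

lemma sum_kron: "(\<Sum>j\<in>{1..n}. kron a j * h j) = (if a \<in> {1..n} then h a else 0)"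
proof -
  have "kron a j * h j = (if a = j then h j else 0)" for j by (simp add: kron_def)
  then show ?thesis by simp
qed

text \<open>The network computes \<open>max u (MAX k<K. f k - \<Lambda> * \<parallel>x - pt k\<parallel>)\<close> (1-norm). Layer 1 holds the
  positive and negative parts of \<open>x j - pt k j\<close>. From layer 3 on, layer \<open>i\<close> holds the maximum
  over the first \<open>i\<close> points, shifted by \<open>u\<close>, as the sum of its neurons 1 and 2, while neuron
  \<open>t \<ge> 2\<close> carries the shifted and rectified value of point \<open>t + i - 3\<close>. The shift by
  \<open>u\<close> lets one neuron carry one value; only point 1 needs both signs in layer 2
  (neurons 2 and \<open>K + 1\<close>).\<close>

locale max_net =
  fixes d D K :: nat and l :: "nat \<Rightarrow> nat" and pt :: "nat \<Rightarrow> nat \<Rightarrow> real"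
    and f :: "nat \<Rightarrow> real" and \<Lambda> u :: real
  assumes d: "1 \<le> d" and K: "3 \<le> K" and D: "K + 1 \<le> D"
    and l0: "l 0 = d" and l1: "2 * d * K \<le> l 1" and lD: "l D = 1"
    and width: "\<And>i. 2 \<le> i \<Longrightarrow> i < D \<Longrightarrow> 2 \<le> l i \<and> 2 * K + 3 \<le> l i + 2 * i"
begin

text \<open>Layer 1 consists of blocks of \<open>2 * d\<close> neurons, one block for each point;
  this row reads block \<open>q\<close> only.\<close>

definition coef :: "nat \<Rightarrow> nat \<Rightarrow> real" where
  "coef q j = (if (j - 1) div (2 * d) = q then - \<Lambda> else 0)"

text \<open>From layer 3 on the rows rest on \<open>max m s = max (m - s) 0 + s\<close>: row 1
  subtracts neuron 3, the next value, and row 2 copies it. In layer 3, row 1 also subtracts neuron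
  \<open>K + 1\<close>, the negative part of point 1, and the rows from \<open>K\<close> on vanish
  so that this negative part is not copied like the value of a point. The output row only adds
  neurons 1 and 2.\<close>

definition W :: "nat \<Rightarrow> nat \<Rightarrow> nat \<Rightarrow> real" where
  "W k i j =
    (if k = 1 then
       let r = (i - 1) mod (2 * d) in if r < d then kron (r + 1) j else - kron (r - d + 1) j
     else if k = 2 then
       (if i = 1 then coef 0 j - coef 1 j
        else if i \<le> K then coef (i - 1) j
        else if i = K + 1 then - coef 1 j else 0)
     else if k = D \<or> i = 1 then
       kron 1 j + kron 2 j - (if k = D then 0 else kron 3 j) - (if k = 3 then kron (K + 1) j else 0)
     else if k = 3 \<and> i \<ge> K then 0 else kron (i + 1) j)"

text \<open>Surplus neurons of layer 1 belong to no point; their bias 0 lets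
  \<open>params_bound\<close> rely on the points below \<open>K\<close> alone. The last bias undoes
  the shift by \<open>u\<close>.\<close>

definition \<beta> :: "nat \<Rightarrow> nat \<Rightarrow> real" where
  "\<beta> k i =
    (if k = 1 then
       let q = (i - 1) div (2 * d); r = (i - 1) mod (2 * d)
       in if q < K then (if r < d then - pt q (r + 1) else pt q (r - d + 1)) else 0
     else if k = 2 then
       (if i = 1 then f 0 - f 1
        else if i \<le> K then f (i - 1) - u
        else if i = K + 1 then u - f 1 else 0)
     else if k = D then u else 0)"

definition params :: "nat \<Rightarrow> real" where
  "params = encode_params l W \<beta>"

lemma params_bound:
  assumes "1 \<le> c" "\<bar>\<Lambda>\<bar> \<le> c" "\<bar>u\<bar> \<le> c"
    and "\<And>k j. k < K \<Longrightarrow> j \<in> {1..d} \<Longrightarrow> \<bar>pt k j\<bar> \<le> c"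
    and "\<And>k. k < K \<Longrightarrow> \<bar>f k - u\<bar> \<le> c" "\<bar>f 0 - f 1\<bar> \<le> c"
  shows "\<bar>params t\<bar> \<le> c"
  unfolding params_def
proof (rule encode_params_bound)
  fix k i j :: nat
  \<comment> \<open>Blocks 0 and 1 are disjoint, so no entry of the difference reaches
    \<open>2 * \<Lambda>\<close>.\<close>
  have "\<bar>coef 0 j - coef 1 j\<bar> \<le> c" "\<bar>coef q j\<bar> \<le> c" for q
    using assms(1,2) by (auto simp: coef_def)
  note c = this
  have kr: "\<bar>kron a j\<bar> \<le> c" for a using assms(1) by (simp add: kron_def)
  have "0 \<le> c" using assms(1) by simp
  consider "k = 1" | "k = 2" | "k \<noteq> 1" "k \<noteq> 2" "k = D \<or> i = 1" | "k \<noteq> 1" "k \<noteq> 2" "\<not> (k = D \<or> i = 1)"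
    by blast
  then show "\<bar>W k i j\<bar> \<le> c"
  proof cases
    case 1
    then show ?thesis by (simp add: W_def Let_def kr)
  next
    case 2
    then show ?thesis using c \<open>0 \<le> c\<close> by (simp add: W_def)
  next
    case 3
    \<comment> \<open>\<open>K \<ge> 3\<close> keeps the indices 1, 2, 3 and \<open>K + 1\<close>
      distinct, so no two unit weights add up.\<close>
    have "kron 1 j + kron 2 j \<in> {0, 1} \<and> kron 3 j + kron (K + 1) j \<in> {0, 1} \<and>
        kron 3 j \<in> {0, 1} \<and> kron (K + 1) j \<in> {0, 1}"
      using K by (simp add: kron_def)
    then have "\<bar>kron 1 j + kron 2 j - (if k = D then 0 else kron 3 j) - (if k = 3 then kron (K + 1) j else 0)\<bar> \<le> 1"
      by (cases "k = D"; cases "k = 3") auto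
    then show ?thesis using 3 assms(1) by (simp add: W_def)
  next
    case 4
    then show ?thesis using kr \<open>0 \<le> c\<close> by (simp add: W_def)
  qed
  let ?q = "(i - 1) div (2 * d)" and ?r = "(i - 1) mod (2 * d)"
  have r: "?r < 2 * d" using d by simp
  consider "k = 1" "?q < K" "?r < d" | "k = 1" "?q < K" "\<not> ?r < d" | "k = 1" "\<not> ?q < K"
    | "k = 2" | "k \<noteq> 1" "k \<noteq> 2" by blast
  then show "\<bar>\<beta> k i\<bar> \<le> c"
  proof cases
    case 1
    then show ?thesis using assms(4)[of ?q "?r + 1"] by (simp add: \<beta>_def Let_def)
  next
    case 2
    then have "?r - d + 1 \<in> {1..d}" using r by auto
    then show ?thesis using 2 assms(4)[of ?q "?r - d + 1"] by (simp add: \<beta>_def Let_def)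
  next
    case 3
    then show ?thesis using assms(1) by (simp add: \<beta>_def Let_def)
  next
    case 4
    have "\<bar>f (i - 1) - u\<bar> \<le> c" if "i \<le> K" using that K by (intro assms(5)) auto
    moreover have "\<bar>u - f 1\<bar> \<le> c" using assms(5)[of 1] K by (simp add: abs_minus_commute)
    ultimately show ?thesis using 4 assms(1,6) by (simp add: \<beta>_def)
  next
    case 5
    then show ?thesis using assms(1,3) by (simp add: \<beta>_def)
  qed
qed

context
  fixes x :: "nat \<Rightarrow> real"
begin

abbreviation "h k \<equiv> hidden_layers params l k x"

definition val :: "nat \<Rightarrow> real" where
  "val k = f k - \<Lambda> * (\<Sum>j\<in>{1..d}. \<bar>x j - pt k j\<bar>)"

text \<open>Being 0 from \<open>K\<close> on, it makes the layers that remain after the last point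
  take a maximum with 0, which changes nothing and needs no separate case.\<close>

definition w :: "nat \<Rightarrow> real" where
  "w k = (if k < K then max (val k - u) 0 else 0)"

lemma h_Suc:
  "i \<in> {1..l (Suc k)} \<Longrightarrow> h (Suc k) i = max ((\<Sum>j\<in>{1..l k}. W (Suc k) i j * h k j) + \<beta> (Suc k) i) 0"
  unfolding params_def by (rule hidden_layers_encode_params)

lemma h_1:
  assumes "q < K" "r < d"
  shows "h 1 (2 * d * q + r + 1) = max (x (r + 1) - pt q (r + 1)) 0"
    and "h 1 (2 * d * q + (d + r) + 1) = max (pt q (r + 1) - x (r + 1)) 0"
proof -
  have le: "2 * d * q + s + 1 \<le> l 1" if "s < 2 * d" for s
  proof -
    have "2 * d * q + s + 1 \<le> 2 * d * Suc q" using that by simp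
    also have "\<dots> \<le> 2 * d * K" using assms(1) by (intro mult_le_mono2) auto
    finally show ?thesis using l1 by linarith
  qed
  have *: "(2 * d * q + s) div (2 * d) = q" "(2 * d * q + s) mod (2 * d) = s" if "s < 2 * d" for s
    using that by auto
  have **: "h 1 (2 * d * q + s + 1) = max ((\<Sum>j\<in>{1..d}. W 1 (2 * d * q + s + 1) j * x j) + \<beta> 1 (2 * d * q + s + 1)) 0"
    if "s < 2 * d" for s
    using h_Suc[of "2 * d * q + s + 1" 0] le[OF that] l0 by simp
  show "h 1 (2 * d * q + r + 1) = max (x (r + 1) - pt q (r + 1)) 0"
    using **[of r] assms *[of r] sum_kron[of "r + 1" x d] by (simp add: W_def \<beta>_def Let_def)
  show "h 1 (2 * d * q + (d + r) + 1) = max (pt q (r + 1) - x (r + 1)) 0"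
    using **[of "d + r"] assms *[of "d + r"] sum_kron[of "r + 1" x d]
    by (simp add: W_def \<beta>_def Let_def sum_negf)
qed

text \<open>Each absolute value is the sum of the positive and the negative part held in block
  \<open>q\<close>.\<close>

lemma sum_coef:
  assumes "q < K"
  shows "(\<Sum>j\<in>{1..l 1}. coef q j * h 1 j) = - \<Lambda> * (\<Sum>j\<in>{1..d}. \<bar>x j - pt q j\<bar>)"
proof -
  have "2 * d * q + 2 * d = 2 * d * Suc q" by simp
  also have "\<dots> \<le> 2 * d * K" using assms by (intro mult_le_mono2) auto
  finally have le: "2 * d * q + 2 * d \<le> l 1" using l1 by linarith
  have iff: "(j - 1) div (2 * d) = q \<longleftrightarrow> j \<in> (\<lambda>r. 2 * d * q + r + 1) ` {..<2 * d}" if "j \<ge> 1" for j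
  proof
    assume "(j - 1) div (2 * d) = q"
    then have "j = 2 * d * q + (j - 1) mod (2 * d) + 1"
      using mult_div_mod_eq[of "2 * d" "j - 1"] that by simp
    moreover have "(j - 1) mod (2 * d) < 2 * d" using d by simp
    ultimately show "j \<in> (\<lambda>r. 2 * d * q + r + 1) ` {..<2 * d}" by blast
  next
    assume "j \<in> (\<lambda>r. 2 * d * q + r + 1) ` {..<2 * d}"
    then obtain r where "j = 2 * d * q + r + 1" "r < 2 * d" by blast
    then show "(j - 1) div (2 * d) = q" by simp
  qed
  have "(\<Sum>j\<in>{1..l 1}. coef q j * h 1 j) = (\<Sum>j\<in>(\<lambda>r. 2 * d * q + r + 1) ` {..<2 * d}. coef q j * h 1 j)"
    using le iff by (intro sum.mono_neutral_right) (auto simp: coef_def)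
  also have "\<dots> = (\<Sum>r<2 * d. coef q (2 * d * q + r + 1) * h 1 (2 * d * q + r + 1))"
    by (subst sum.reindex) (auto simp: inj_on_def)
  also have "\<dots> = (\<Sum>r<2 * d. - \<Lambda> * h 1 (2 * d * q + r + 1))"
    by (intro sum.cong) (auto simp: coef_def)
  also have "\<dots> = - \<Lambda> * (\<Sum>r<d + d. h 1 (2 * d * q + r + 1))"
    by (simp add: sum_distrib_left mult_2)
  also have "(\<Sum>r<d + d. h 1 (2 * d * q + r + 1)) =
      (\<Sum>r<d. h 1 (2 * d * q + r + 1)) + (\<Sum>r<d. h 1 (2 * d * q + (d + r) + 1))"
    by (simp only: lessThan_atLeast0 sum.nat_group sum.atLeastLessThan_concat[of 0 d "d + d", symmetric]
        le0 le_add1 sum.atLeastLessThan_shift_0[of _ d "d + d"] diff_add_inverse2 o_def)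
  also have "\<dots> = (\<Sum>r<d. \<bar>x (Suc r) - pt q (Suc r)\<bar>)"
    unfolding sum.distrib[symmetric] using h_1[OF assms] by (intro sum.cong) auto
  also have "\<dots> = (\<Sum>j\<in>{1..d}. \<bar>x j - pt q j\<bar>)"
    by (simp add: sum.atLeast1_atMost_eq)
  finally show ?thesis .
qed

text \<open>Together the first three values give
  \<open>h 2 1 + h 2 2 - h 2 (K + 1) = max (val 0) (val 1) - u\<close>.\<close>

lemma h_2:
  shows "h 2 1 = max (val 0 - val 1) 0" "h 2 2 = max (val 1 - u) 0" "h 2 (K + 1) = max (u - val 1) 0"
    and "3 \<le> t \<Longrightarrow> t \<le> K \<Longrightarrow> h 2 t = w (t - 1)"
proof -
  have l2: "K + 1 \<le> l 2" using width[of 2] K D by auto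
  note h2 = h_Suc[of _ 1, simplified Suc_1]
  show "h 2 1 = max (val 0 - val 1) 0"
    using h2[of 1] l2 K sum_coef[of 0] sum_coef[of 1]
    by (simp add: W_def \<beta>_def val_def left_diff_distrib sum_subtractf algebra_simps)
  show "h 2 2 = max (val 1 - u) 0"
    using h2[of 2] l2 K sum_coef[of 1] by (simp add: W_def \<beta>_def val_def algebra_simps)
  show "h 2 (K + 1) = max (u - val 1) 0"
    using h2[of "K + 1"] l2 K sum_coef[of 1] by (simp add: W_def \<beta>_def val_def sum_negf algebra_simps)
  show "h 2 t = w (t - 1)" if "3 \<le> t" "t \<le> K"
    using h2[of t] l2 that sum_coef[of "t - 1"] K
    by (auto simp add: W_def \<beta>_def val_def w_def algebra_simps)
qed

lemma h_layer_step:
  assumes "2 \<le> k" "k + 1 < D"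
  shows "h (k + 1) 1 = max (h k 1 + h k 2 - (if 3 \<le> l k then h k 3 else 0) - (if k = 2 then h k (K + 1) else 0)) 0"
    and "2 \<le> t \<Longrightarrow> t \<le> l (k + 1) \<Longrightarrow> h (k + 1) t =
      (if k = 2 \<and> t \<ge> K \<or> l k < t + 1 then 0 else max (h k (t + 1)) 0)"
proof -
  have lk: "2 \<le> l k" "1 \<le> l (k + 1)" using width[of k] width[of "k + 1"] assms by auto
  have l2: "k = 2 \<Longrightarrow> K + 1 \<le> l k" using width[of 2] K D by auto
  show "h (k + 1) 1 = max (h k 1 + h k 2 - (if 3 \<le> l k then h k 3 else 0) - (if k = 2 then h k (K + 1) else 0)) 0"
    using h_Suc[of 1 k] lk assms l2 sum_kron[of 1 "h k" "l k"] sum_kron[of 2 "h k" "l k"]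
      sum_kron[of 3 "h k" "l k"] sum_kron[of "K + 1" "h k" "l k"]
    by (auto simp: W_def \<beta>_def distrib_right left_diff_distrib sum.distrib sum_subtractf)
  show "h (k + 1) t = (if k = 2 \<and> t \<ge> K \<or> l k < t + 1 then 0 else max (h k (t + 1)) 0)"
    if "2 \<le> t" "t \<le> l (k + 1)"
  proof (cases "k = 2 \<and> t \<ge> K")
    case True
    then show ?thesis using h_Suc[of t k] that assms by (simp add: W_def \<beta>_def)
  next
    case False
    then show ?thesis
      using h_Suc[of t k] that assms sum_kron[of "t + 1" "h k" "l k"] by (auto simp: W_def \<beta>_def)
  qed
qed

text \<open>The sum of neurons 1 and 2 is kept between all values absorbed so far and a common bound
  \<open>y\<close>, later \<open>E x\<close>, instead of being identified as a maximum; the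
  approximation uses no more than that.\<close>

lemma h_invariant:
  assumes "3 \<le> k" "k < D"
    and up: "\<And>j. j < K \<Longrightarrow> val j \<le> y" "u \<le> y"
  shows "(\<forall>t\<in>{2..l k}. h k t = w (t + k - 3)) \<and> (\<forall>j<k. w j \<le> h k 1 + h k 2) \<and> h k 1 + h k 2 \<le> y - u"
  using assms(1,2)
proof (induction k rule: dec_induct)
  case base
  have wy: "w j \<le> y - u" for j using up(1)[of j] up(2) by (auto simp: w_def)
  have l2: "K + 1 \<le> l 2" "3 \<le> l 2" using width[of 2] K D by auto
  have 1: "h 3 t = w t" if "t \<in> {2..l 3}" for t
  proof (cases "t < K")
    case True
    then have "h 3 t = max (h 2 (t + 1)) 0" using h_layer_step(2)[of 2 t] base that l2 by simp
    also have "h 2 (t + 1) = w t" using h_2(4)[of "t + 1"] True that by simp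
    finally show ?thesis by (simp add: w_def)
  next
    case False
    then show ?thesis using h_layer_step(2)[of 2 t] base that by (simp add: w_def)
  qed
  have l3: "2 \<le> l 3" using width[of 3] base by auto
  have "h 3 1 = max (max (val 0) (val 1) - u - w 2) 0"
    using h_layer_step(1)[of 2] base h_2(1-3) h_2(4)[of 3] l2 K by (simp add: max_def)
  moreover have "h 3 2 = w 2" using 1 l3 by simp
  ultimately have m: "h 3 1 + h 3 2 = max (max (val 0) (val 1) - u) (w 2)" by simp
  have "w j \<le> h 3 1 + h 3 2" if "j < 3" for j
  proof -
    have "j = 0 \<or> j = 1 \<or> j = 2" using that by auto
    moreover have "0 \<le> w 2" by (simp add: w_def)
    ultimately show ?thesis unfolding m using K by (auto simp: w_def)
  qed
  moreover have "h 3 1 + h 3 2 \<le> y - u" unfolding m using up(1)[of 0] up(1)[of 1] K wy[of 2] by simp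
  ultimately show ?case using 1 by auto
next
  case (step k)
  have wy: "w j \<le> y - u" for j using up(1)[of j] up(2) by (auto simp: w_def)
  have w0: "0 \<le> w j" for j by (simp add: w_def)
  have IH: "\<And>t. t \<in> {2..l k} \<Longrightarrow> h k t = w (t + k - 3)" "\<And>j. j < k \<Longrightarrow> w j \<le> h k 1 + h k 2"
    "h k 1 + h k 2 \<le> y - u" using step by auto
  have wk: "2 \<le> l k" "2 * K + 3 \<le> l k + 2 * k" "2 \<le> l (k + 1)"
    using width[of k] width[of "k + 1"] step by auto
  \<comment> \<open>A neuron \<open>t\<close> for which layer \<open>k\<close> is too narrow would
    carry the point \<open>t + k - 2\<close>. This index is at least \<open>2 * K + 1 - k\<close> by
    the width bound and at least \<open>k\<close> by \<open>2 \<le> t\<close>, hence beyond the last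
    point \<open>K - 1\<close>.\<close>
  have small: "w (t + k - 2) = 0" if "2 \<le> t" "l k < t + 1" for t
    using that wk by (auto simp: w_def)
  have 1: "h (k + 1) t = w (t + k - 2)" if "t \<in> {2..l (k + 1)}" for t
  proof (cases "l k < t + 1")
    case True
    then show ?thesis using h_layer_step(2)[of k t] step that small[of t] by simp
  next
    case False
    then have "h (k + 1) t = max (h k (t + 1)) 0" using h_layer_step(2)[of k t] step that by simp
    also have "h k (t + 1) = w (t + k - 2)" using IH(1)[of "t + 1"] False that
      by (simp add: Suc_diff_le numeral_3_eq_3 numeral_2_eq_2)
    finally show ?thesis using w0 by simp
  qed
  have "(if 3 \<le> l k then h k 3 else 0) = w k" using IH(1)[of 3] small[of 2] by auto
  then have "h (k + 1) 1 = max (h k 1 + h k 2 - w k) 0" using h_layer_step(1)[of k] step by simp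
  moreover have "h (k + 1) 2 = w k" using 1[of 2] wk by simp
  ultimately have m: "h (k + 1) 1 + h (k + 1) 2 = max (h k 1 + h k 2) (w k)" by simp
  have "w j \<le> h (k + 1) 1 + h (k + 1) 2" if "j < Suc k" for j
    unfolding m using IH(2)[of j] that by (cases "j = k") auto
  moreover have "h (k + 1) 1 + h (k + 1) 2 \<le> y - u" unfolding m using IH(3) wy by simp
  ultimately show ?case using 1 by simp
qed

lemma clipped_dnn_params:
  assumes up: "\<And>j. j < K \<Longrightarrow> val j \<le> y" "u \<le> y" "y \<le> v" and q: "q < K"
  shows "val q \<le> clipped_dnn (ereal u) (ereal v) params D l x 1 \<and>
    clipped_dnn (ereal u) (ereal v) params D l x 1 \<le> y"
proof -
  obtain k where k: "D = Suc k" "3 \<le> k" "K \<le> k" using D K by (cases D) auto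
  have lk: "2 \<le> l k" using width[of k] k by auto
  have Dn: "D \<noteq> 1" "D \<noteq> Suc 0" "D \<noteq> 2" "D \<noteq> 3" using k by auto
  have inv: "\<And>j. j < k \<Longrightarrow> w j \<le> h k 1 + h k 2" "h k 1 + h k 2 \<le> y - u"
    using h_invariant[of k y] k up by auto
  have "clipped_dnn (ereal u) (ereal v) params D l x 1 =
      max u (min ((\<Sum>j\<in>{1..l k}. W D 1 j * h k j) + \<beta> D 1) v)"
    using clipped_dnn_encode_params[of D l u v W \<beta> x] lD k unfolding params_def by simp
  also have "(\<Sum>j\<in>{1..l k}. W D 1 j * h k j) + \<beta> D 1 = h k 1 + h k 2 + u"
    using k(2) Dn lk sum_kron[of 1 "h k" "l k"] sum_kron[of 2 "h k" "l k"]
    by (simp add: W_def \<beta>_def distrib_right sum.distrib)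
  \<comment> \<open>The value already lies between \<open>u\<close> and \<open>y \<le> v\<close>, so
    the final clipping does not change it.\<close>
  also have "max u (min (h k 1 + h k 2 + u) v) = h k 1 + h k 2 + u"
  proof -
    have "0 \<le> w 0" by (simp add: w_def)
    then show ?thesis using inv(1)[of 0] inv(2) up k by simp
  qed
  finally show ?thesis using inv(1)[of q] inv(2) q k by (simp add: w_def)
qed

end

end

section \<open>Grids of cell centers\<close>

lemma interval_grid:
  fixes a b :: real
  assumes "a < b" "1 \<le> n" "x \<in> {a..b}"
  shows "\<exists>e<n. \<bar>x - (a + (b - a) * (2 * real e + 1) / (2 * real n))\<bar> \<le> (b - a) / (2 * real n)"
proof -
  define s where "s = (x - a) * real n / (b - a)"
  have s: "0 \<le> s" "s \<le> real n" and x: "x = a + (b - a) * s / real n"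
    using assms by (auto simp: s_def field_simps)
  \<comment> \<open>The minimum puts the right end point, where \<open>s = n\<close>, into the last
    cell.\<close>
  define e where "e = min (nat \<lfloor>s\<rfloor>) (n - 1)"
  have e: "e < n" "real e \<le> s" "s \<le> real e + 1"
    using s assms(2) by (auto simp: e_def min_def le_nat_floor; linarith)+
  have "x - (a + (b - a) * (2 * real e + 1) / (2 * real n)) = (b - a) / (2 * real n) * (2 * s - 2 * real e - 1)"
    using assms unfolding x by (simp add: field_simps)
  moreover have "\<bar>2 * s - 2 * real e - 1\<bar> \<le> 1" using e by linarith
  moreover have "0 \<le> (b - a) / (2 * real n)" using assms by simp
  ultimately have "\<bar>x - (a + (b - a) * (2 * real e + 1) / (2 * real n))\<bar> \<le> (b - a) / (2 * real n)"
    by (simp only: abs_mult abs_of_nonneg mult_left_le)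
  then show ?thesis using e by blast
qed

text \<open>Used twice: for the apexes of the cones in the input cube and for the covering of the
  parameter cube.\<close>

lemma cube_grid:
  assumes "a < b" "1 \<le> n"
  obtains G where "finite G" "card G = n ^ d" "G \<subseteq> cube d a b"
    "\<And>x. x \<in> cube d a b \<Longrightarrow> \<exists>g\<in>G. \<forall>j\<in>{1..d}. \<bar>x j - g j\<bar> \<le> (b - a) / (2 * real n)"
proof -
  define g where "g e = a + (b - a) * (2 * real e + 1) / (2 * real n)" for e :: nat
  define G where "G = {1..d} \<rightarrow>\<^sub>E g ` {..<n}"
  have "inj_on g {..<n}" using assms by (auto simp: inj_on_def g_def)
  then have "card G = n ^ d" by (simp add: G_def card_PiE card_image)
  moreover have "finite G" by (simp add: G_def finite_PiE)
  moreover have "g e \<in> {a..b}" if "e < n" for e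
  proof -
    have "(b - a) * (2 * real e + 1) \<le> (b - a) * (2 * real n)" using that assms by (intro mult_left_mono) auto
    then have "(b - a) * (2 * real e + 1) / (2 * real n) \<le> b - a" using that by (simp add: divide_le_eq)
    then show ?thesis using assms by (simp add: g_def)
  qed
  then have "G \<subseteq> cube d a b" unfolding G_def cube_def by (intro PiE_mono) auto
  moreover have "\<exists>p\<in>G. \<forall>j\<in>{1..d}. \<bar>x j - p j\<bar> \<le> (b - a) / (2 * real n)" if "x \<in> cube d a b" for x
  proof -
    have "\<forall>j\<in>{1..d}. \<exists>e<n. \<bar>x j - g e\<bar> \<le> (b - a) / (2 * real n)"
      using interval_grid[OF assms] that unfolding g_def cube_def by (auto simp: PiE_def Pi_def)
    then obtain e where e: "\<And>j. j \<in> {1..d} \<Longrightarrow> e j < n \<and> \<bar>x j - g (e j)\<bar> \<le> (b - a) / (2 * real n)"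
      by metis
    then show ?thesis
      by (intro bexI[of _ "\<lambda>j\<in>{1..d}. g (e j)"]) (auto simp: G_def)
  qed
  ultimately show thesis using that by blast
qed

text \<open>The inequality \<open>2 * d \<le> 2 ^ d\<close> explains the threshold
  \<open>6 ^ d\<close>: beyond it the solution \<open>X\<close> of \<open>2 * d * X ^ d = A\<close>
  is at least 3 and at least half of \<open>A powr (1 / d)\<close>. Rounding \<open>X\<close> down
  to \<open>n \<ge> 3\<close> then gives
  \<open>A powr (1 / d) \<le> 2 * X < 2 * n + 2 \<le> 3 * n\<close>.\<close>

lemma grid_size:
  assumes "1 \<le> d" "6 ^ d < (A::real)"
  obtains n where "3 \<le> n" "2 * real d * real n ^ d \<le> A" "A powr (1 / real d) \<le> 3 * real n"
proof -
  have "2 * d \<le> 2 ^ d" using assms(1)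
  proof (induction d rule: dec_induct)
    case (step m)
    have "(2::nat) \<le> 2 ^ m" using step by (cases m) auto
    then show ?case using step by simp
  qed simp
  then have d2: "2 * real d \<le> 2 ^ d"
    by (metis of_nat_le_iff of_nat_mult of_nat_numeral of_nat_power)
  have A: "0 < A" using assms(2) by (smt (verit) zero_less_power)
  define X where "X = (A / (2 * real d)) powr (1 / real d)"
  have root: "(y ^ d) powr (1 / real d) = y" if "0 < y" for y :: real
    using that assms(1) by (simp add: powr_realpow[symmetric] powr_powr)
  have "3 ^ d * (2 * real d) \<le> 3 ^ d * 2 ^ d" using d2 by simp
  also have "\<dots> = 6 ^ d" by (simp add: power_mult_distrib[symmetric])
  also have "\<dots> < A" by fact
  finally have "3 ^ d \<le> A / (2 * real d)" using assms(1) by (simp add: field_simps)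
  then have "(3 ^ d) powr (1 / real d) \<le> X" unfolding X_def by (intro powr_mono2) auto
  then have X3: "3 \<le> X" by (simp add: root)
  have "A / 2 ^ d \<le> A / (2 * real d)" using d2 A assms(1) by (intro divide_left_mono) auto
  then have "(A / 2 ^ d) powr (1 / real d) \<le> X" using A unfolding X_def by (intro powr_mono2) auto
  then have XA: "A powr (1 / real d) / 2 \<le> X" using A by (simp add: powr_divide root)
  define n where "n = nat \<lfloor>X\<rfloor>"
  have n: "real n \<le> X" "X < real n + 1" "3 \<le> n" using X3 by (auto simp: n_def le_nat_floor)
  have "real n ^ d \<le> X ^ d" using n by (intro power_mono) auto
  also have "X ^ d = X powr real d" using X3 by (simp add: powr_realpow)
  also have "\<dots> = A / (2 * real d)" using A assms(1) by (simp add: X_def powr_powr)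
  finally have "2 * real d * real n ^ d \<le> A" using assms(1) by (simp add: field_simps)
  moreover have "A powr (1 / real d) \<le> 3 * real n" using XA n by linarith
  ultimately show thesis using n(3) that by blast
qed

text \<open>The maximum of finitely many cones below \<open>E\<close> with apexes on its graph
  approximates \<open>E\<close>; if \<open>A \<le> 6 ^ d\<close>, the constant \<open>E (center)\<close> is already close enough.\<close>

lemma dnn_approximation:
  assumes d: "1 \<le> d" and D: "1 \<le> D" and "0 < A" "a < b" "u < v" "0 \<le> \<Lambda>"
    and c: "1 \<le> c" "\<Lambda> \<le> c" "\<bar>a\<bar> \<le> c" "\<bar>b\<bar> \<le> c" "2 * \<bar>u\<bar> \<le> c" "2 * \<bar>v\<bar> \<le> c"
    and l: "l 0 = d" "l D = 1"
    and depth: "6 ^ d < A \<Longrightarrow> A / (2 * real d) + 1 \<le> real D" "6 ^ d < A \<Longrightarrow> A \<le> real (l 1)"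
    and width: "\<And>i. 6 ^ d < A \<Longrightarrow> 2 \<le> i \<Longrightarrow> i < D \<Longrightarrow> max (A / real d - 2 * real i + 3) 2 \<le> real (l i)"
    and E: "\<And>x. x \<in> cube d a b \<Longrightarrow> E x \<in> {u..v}"
    and lip: "\<And>x y. x \<in> cube d a b \<Longrightarrow> y \<in> cube d a b \<Longrightarrow> \<bar>E x - E y\<bar> \<le> \<Lambda> * (\<Sum>j\<in>{1..d}. \<bar>x j - y j\<bar>)"
  obtains \<eta> where "\<And>t. \<bar>\<eta> t\<bar> \<le> c"
    "\<And>x. x \<in> cube d a b \<Longrightarrow>
      \<bar>clipped_dnn (ereal u) (ereal v) \<eta> D l x 1 - E x\<bar> \<le> 3 * real d * \<Lambda> * (b - a) / A powr (1 / real d)"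
proof (cases "6 ^ d < A")
  case True
  obtain n where n: "3 \<le> n" "2 * real d * real n ^ d \<le> A" "A powr (1 / real d) \<le> 3 * real n"
    using grid_size[OF d True] by blast
  obtain G where G: "finite G" "card G = n ^ d" "G \<subseteq> cube d a b"
    "\<And>x. x \<in> cube d a b \<Longrightarrow> \<exists>g\<in>G. \<forall>j\<in>{1..d}. \<bar>x j - g j\<bar> \<le> (b - a) / (2 * real n)"
    using cube_grid[OF \<open>a < b\<close>, of n d] n(1) by auto
  define K where "K = n ^ d"
  have K3: "3 \<le> K" using n(1) d self_le_power[of n d] unfolding K_def by linarith
  have KA: "2 * real d * real K \<le> A" using n(2) by (simp add: K_def)
  obtain pt where pt: "bij_betw pt {0..<K} G"
    using ex_bij_betw_nat_finite[OF G(1)] G(2) unfolding K_def by auto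
  have ptc: "pt k \<in> cube d a b" if "k < K" for k using pt G(3) that by (auto simp: bij_betw_def)
  have AK: "real K \<le> A / (2 * real d)" "2 * real K \<le> A / real d" using KA d by (simp_all add: field_simps)
  interpret max_net d D K l pt "\<lambda>k. E (pt k)" \<Lambda> u
  proof
    have "real (K + 1) \<le> real D" using depth(1)[OF True] AK by simp
    then show "K + 1 \<le> D" by linarith
    have "real (2 * d * K) \<le> real (l 1)" using depth(2)[OF True] KA by simp
    then show "2 * d * K \<le> l 1" by linarith
    fix i assume i: "2 \<le> i" "i < D"
    have "max (A / real d - 2 * real i + 3) 2 \<le> real (l i)" by (rule width[OF True i])
    then have "2 \<le> real (l i)" "real (2 * K + 3) \<le> real (l i + 2 * i)" using AK by auto
    then show "2 \<le> l i \<and> 2 * K + 3 \<le> l i + 2 * i" by linarith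
  qed (use d K3 l in auto)
  \<comment> \<open>The reason for the factors 2 in \<open>2 * \<bar>u\<bar>\<close> and
    \<open>2 * \<bar>v\<bar>\<close>: the biases \<open>E (pt k) - u\<close> must not exceed
    \<open>c\<close>.\<close>
  have vu: "v - u \<le> c" using c by linarith
  show thesis
  proof (rule that)
    show "\<bar>params t\<bar> \<le> c" for t
    proof (rule params_bound)
      show "\<bar>pt k j\<bar> \<le> c" if "k < K" "j \<in> {1..d}" for k j
      proof -
        have "pt k j \<in> {a..b}" using ptc[OF that(1)] that(2) by (auto simp: cube_def PiE_def Pi_def)
        then show ?thesis using c by auto
      qed
      show "\<bar>E (pt k) - u\<bar> \<le> c" if "k < K" for k using E[OF ptc[OF that]] vu by auto
      show "\<bar>E (pt 0) - E (pt 1)\<bar> \<le> c" using E[OF ptc[of 0]] E[OF ptc[of 1]] K3 vu by auto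
    qed (use c \<open>0 \<le> \<Lambda>\<close> in auto)
    fix x assume x: "x \<in> cube d a b"
    obtain q where q: "q < K" "\<forall>j\<in>{1..d}. \<bar>x j - pt q j\<bar> \<le> (b - a) / (2 * real n)"
      using G(4)[OF x] pt by (auto simp: bij_betw_def)
    have up: "val x k \<le> E x" if "k < K" for k
      using lip[OF ptc[OF that] x] by (auto simp: val_def abs_minus_commute)
    have "(\<Sum>j\<in>{1..d}. \<bar>x j - pt q j\<bar>) \<le> (\<Sum>j\<in>{1..d}. (b - a) / (2 * real n))"
      using q(2) by (intro sum_mono) auto
    then have "\<Lambda> * (\<Sum>j\<in>{1..d}. \<bar>x j - pt q j\<bar>) \<le> \<Lambda> * (real d * ((b - a) / (2 * real n)))"
      using \<open>0 \<le> \<Lambda>\<close> by (intro mult_left_mono) auto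
    \<comment> \<open>The Lipschitz bound enters once for \<open>E x - E (pt q)\<close> and once as
      the slope of the cone.\<close>
    moreover have "E x - val x q \<le> 2 * (\<Lambda> * (\<Sum>j\<in>{1..d}. \<bar>x j - pt q j\<bar>))"
      using lip[OF x ptc[OF q(1)]] unfolding val_def by linarith
    ultimately have "E x - val x q \<le> 2 * (\<Lambda> * (real d * ((b - a) / (2 * real n))))" by linarith
    also have "\<dots> = real d * \<Lambda> * (b - a) / real n" by simp
    finally have "E x - val x q \<le> real d * \<Lambda> * (b - a) / real n" .
    also have "\<dots> = 3 * real d * \<Lambda> * (b - a) / (3 * real n)" by simp
    also have "\<dots> \<le> 3 * real d * \<Lambda> * (b - a) / A powr (1 / real d)"
      using n assms(3,4,6) by (intro divide_left_mono) auto
    finally show "\<bar>clipped_dnn (ereal u) (ereal v) params D l x 1 - E x\<bar>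
        \<le> 3 * real d * \<Lambda> * (b - a) / A powr (1 / real d)"
      using clipped_dnn_params[of x "E x" v q] up E[OF x] q(1) by auto
  qed
next
  case False
  define z where "z = (\<lambda>j\<in>{1..d}. (a + b) / 2)"
  have z: "z \<in> cube d a b" using \<open>a < b\<close> by (auto simp: z_def cube_def)
  \<comment> \<open>The 1-norm distance to the center is at most
    \<open>d * (b - a) / 2 = 3 * d * (b - a) / 6\<close>, so a root of at most 6 yields the same
    constant 3 as the other case.\<close>
  have "A powr (1 / real d) \<le> (6 ^ d) powr (1 / real d)" using False assms(3) by (intro powr_mono2) auto
  also have "\<dots> = 6" using d by (simp add: powr_realpow[symmetric] powr_powr)
  finally have A6: "A powr (1 / real d) \<le> 6" .
  show thesis
  proof (rule that)
    show "\<bar>encode_params l (\<lambda>_ _ _. 0) (\<lambda>k _. if k = D then E z else 0) t\<bar> \<le> c" for t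
      using E[OF z] c by (intro encode_params_bound) auto
    fix x assume x: "x \<in> cube d a b"
    have "\<bar>x j - z j\<bar> \<le> (b - a) / 2" if "j \<in> {1..d}" for j
    proof -
      have "x j \<in> {a..b}" using x that by (auto simp: cube_def PiE_def Pi_def)
      then show ?thesis using that by (auto simp: z_def abs_if field_simps)
    qed
    then have "(\<Sum>j\<in>{1..d}. \<bar>z j - x j\<bar>) \<le> (\<Sum>j\<in>{1..d}. (b - a) / 2)"
      by (intro sum_mono) (auto simp: abs_minus_commute)
    then have "\<Lambda> * (\<Sum>j\<in>{1..d}. \<bar>z j - x j\<bar>) \<le> \<Lambda> * (real d * ((b - a) / 2))"
      using \<open>0 \<le> \<Lambda>\<close> by (intro mult_left_mono) auto
    then have "\<bar>E z - E x\<bar> \<le> 3 * real d * \<Lambda> * (b - a) / 6" using lip[OF z x] by (simp add: algebra_simps)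
    also have "\<dots> \<le> 3 * real d * \<Lambda> * (b - a) / A powr (1 / real d)"
      using A6 assms(3,4,6) by (intro divide_left_mono) auto
    finally show "\<bar>clipped_dnn (ereal u) (ereal v) (encode_params l (\<lambda>_ _ _. 0) (\<lambda>k _. if k = D then E z else 0)) D l x 1 - E x\<bar>
        \<le> 3 * real d * \<Lambda> * (b - a) / A powr (1 / real d)"
      unfolding clipped_dnn_encode_params[of D l, OF D l(2)] using E[OF z] by simp
  qed
qed

section \<open>Moment bounds\<close>

text \<open>For nonnegative \<open>f\<close> and \<open>C\<close> this bounds the Lp norm, with any
  \<open>p > 0\<close> allowed. Since the nonnegative integral is monotone for arbitrary functions,
  the bound passes to minorants that are not known to be measurable.\<close>

definition Lp_bounded :: "'a measure \<Rightarrow> real \<Rightarrow> ('a \<Rightarrow> real) \<Rightarrow> real \<Rightarrow> bool" where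
  "Lp_bounded M p f C \<longleftrightarrow> (\<integral>\<^sup>+x. ennreal (f x powr p) \<partial>M) \<le> ennreal (C powr p)"

lemma Lp_bounded_mono:
  assumes "Lp_bounded M p g C" "AE x in M. 0 \<le> f x \<and> f x \<le> g x" "0 < p"
  shows "Lp_bounded M p f C"
proof -
  have "AE x in M. ennreal (f x powr p) \<le> ennreal (g x powr p)"
    using assms(2) by eventually_elim (use assms(3) in \<open>auto intro!: ennreal_leI powr_mono2\<close>)
  then have "(\<integral>\<^sup>+x. ennreal (f x powr p) \<partial>M) \<le> (\<integral>\<^sup>+x. ennreal (g x powr p) \<partial>M)"
    by (rule nn_integral_mono_AE)
  then show ?thesis using assms(1) unfolding Lp_bounded_def by (rule order_trans)
qed

lemma Lp_bounded_cmult: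
  assumes "Lp_bounded M p f C" "0 \<le> C" "0 \<le> k" "\<And>x. 0 \<le> f x" and [measurable]: "f \<in> borel_measurable M"
  shows "Lp_bounded M p (\<lambda>x. k * f x) (k * C)"
proof -
  have "(\<integral>\<^sup>+x. ennreal ((k * f x) powr p) \<partial>M) = (\<integral>\<^sup>+x. ennreal (k powr p) * ennreal (f x powr p) \<partial>M)"
    using assms(3,4) by (simp add: powr_mult ennreal_mult)
  also have "\<dots> = ennreal (k powr p) * (\<integral>\<^sup>+x. ennreal (f x powr p) \<partial>M)"
    by (rule nn_integral_cmult) measurable
  also have "\<dots> \<le> ennreal (k powr p) * ennreal (C powr p)"
    using assms(1) unfolding Lp_bounded_def by (intro mult_left_mono) auto
  finally show ?thesis using assms(2,3) by (simp add: Lp_bounded_def powr_mult ennreal_mult)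
qed

lemma (in prob_space) Lp_bounded_const: "Lp_bounded M p (\<lambda>_. C) C"
  by (simp add: Lp_bounded_def emeasure_space_1)

text \<open>If an argument is 0, only \<open>s powr p \<le> s\<close> for \<open>0 < s < 1\<close>
  is left; for positive arguments this is the convexity of the power.\<close>

lemma powr_convex_nonneg:
  fixes x y t p :: real
  assumes "1 \<le> p" "0 \<le> x" "0 \<le> y" "0 < t" "t < 1"
  shows "(t * x + (1 - t) * y) powr p \<le> t * x powr p + (1 - t) * y powr p"
proof -
  have le: "s powr p \<le> s" if "0 < s" "s < 1" for s :: real
    using powr_mono'[of 1 p s] that assms(1) by simp
  consider "x = 0" | "y = 0" | "0 < x" "0 < y" using assms by linarith
  then show ?thesis
  proof cases
    case 1
    then show ?thesis using assms le[of "1 - t"] by (simp add: powr_mult mult_right_mono)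
  next
    case 2
    then show ?thesis using assms le[of t] by (simp add: powr_mult mult_right_mono)
  next
    case 3
    have "convex_on {0<..} (\<lambda>x. x powr p)" by (rule powr_convex[OF assms(1)])
    from convex_onD[OF this, of "1 - t" x y] show ?thesis using assms 3 by simp
  qed
qed

text \<open>Minkowski's inequality, obtained from the convexity of \<open>t powr p\<close> with weights
  \<open>C1 / (C1 + C2)\<close> and \<open>C2 / (C1 + C2)\<close>.\<close>

lemma Lp_bounded_add:
  assumes "Lp_bounded M p f C1" "Lp_bounded M p g C2" "1 \<le> p" "0 < C1" "0 < C2"
    and "\<And>x. 0 \<le> f x" "\<And>x. 0 \<le> g x"
    and [measurable]: "f \<in> borel_measurable M" "g \<in> borel_measurable M"
  shows "Lp_bounded M p (\<lambda>x. f x + g x) (C1 + C2)"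
proof -
  define C where "C = C1 + C2"
  define t where "t = C1 / C"
  have C: "0 < C" "0 < t" "t < 1" "1 - t = C2 / C" using assms by (auto simp: C_def t_def field_simps)
  have le: "(f x + g x) powr p \<le> C powr p * (t / C1 powr p) * f x powr p + C powr p * ((1 - t) / C2 powr p) * g x powr p" for x
  proof -
    have "t * (f x / C1) = f x / C" "(1 - t) * (g x / C2) = g x / C"
      using assms(4,5) unfolding C(4) by (simp_all add: t_def)
    then have "f x + g x = C * (t * (f x / C1) + (1 - t) * (g x / C2))"
      using C(1) by (simp add: field_simps)
    then have "(f x + g x) powr p = C powr p * (t * (f x / C1) + (1 - t) * (g x / C2)) powr p"
      using C assms by (simp add: powr_mult)
    also have "\<dots> \<le> C powr p * (t * (f x / C1) powr p + (1 - t) * (g x / C2) powr p)"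
      using C assms by (intro mult_left_mono powr_convex_nonneg) auto
    also have "\<dots> = C powr p * (t / C1 powr p) * f x powr p + C powr p * ((1 - t) / C2 powr p) * g x powr p"
      using assms by (simp add: powr_divide algebra_simps)
    finally show ?thesis .
  qed
  define \<alpha> \<gamma> where "\<alpha> = C powr p * (t / C1 powr p)" and "\<gamma> = C powr p * ((1 - t) / C2 powr p)"
  note le = le[folded \<alpha>_def \<gamma>_def]
  have nn: "0 \<le> \<alpha>" "0 \<le> \<gamma>" using C assms(4,5) by (auto simp: \<alpha>_def \<gamma>_def)
  have "(\<integral>\<^sup>+x. ennreal ((f x + g x) powr p) \<partial>M) \<le>
      (\<integral>\<^sup>+x. ennreal \<alpha> * ennreal (f x powr p) + ennreal \<gamma> * ennreal (g x powr p) \<partial>M)"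
    using le nn by (intro nn_integral_mono) (simp add: ennreal_mult[symmetric] ennreal_plus[symmetric] del: ennreal_plus)
  also have "\<dots> = ennreal \<alpha> * (\<integral>\<^sup>+x. ennreal (f x powr p) \<partial>M) + ennreal \<gamma> * (\<integral>\<^sup>+x. ennreal (g x powr p) \<partial>M)"
    by (simp add: nn_integral_add nn_integral_cmult)
  also have "\<dots> \<le> ennreal \<alpha> * ennreal (C1 powr p) + ennreal \<gamma> * ennreal (C2 powr p)"
    using assms(1,2) unfolding Lp_bounded_def by (intro add_mono mult_left_mono) auto
  also have "\<dots> = ennreal (\<alpha> * C1 powr p + \<gamma> * C2 powr p)"
    using nn by (simp add: ennreal_mult ennreal_plus)
  also have "\<alpha> * C1 powr p + \<gamma> * C2 powr p = C powr p"
    using assms(4,5) by (simp add: \<alpha>_def \<gamma>_def field_simps)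
  finally show ?thesis unfolding Lp_bounded_def C_def .
qed

lemma ennreal_le_affine:
  assumes "v \<le> a * x + b" "0 \<le> a" "0 \<le> x" "0 \<le> b"
  shows "ennreal v \<le> ennreal a * ennreal x + ennreal b"
proof -
  have "ennreal v \<le> ennreal (a * x + b)" using assms(1) by (rule ennreal_leI)
  then show ?thesis using assms by (simp add: ennreal_plus ennreal_mult)
qed

text \<open>A concave power lies below its tangent at \<open>t = 1\<close>; here as Young's
  inequality with second factor 1.\<close>

lemma powr_le_weighted:
  fixes t y :: real
  assumes "0 \<le> t" "0 < y" "y \<le> 1"
  shows "t powr y \<le> y * t + (1 - y)"
proof (cases "t = 0")
  case False
  then show ?thesis using Youngs_inequality_0[of y "1 - y" t 1] assms by simp
qed (use assms in simp)

text \<open>The tangent bound \<open>powr_le_weighted\<close> at \<open>t = (f x / C) powr q\<close>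
  with \<open>y = p / q\<close> is integrated; as the total mass is 1, its two parts add up to
  \<open>C powr p\<close>.\<close>

lemma (in prob_space) Lp_bounded_exponent:
  assumes "Lp_bounded M q f C" "0 < p" "p \<le> q" "0 < C" "\<And>x. 0 \<le> f x"
    and [measurable]: "f \<in> borel_measurable M"
  shows "Lp_bounded M p f C"
proof -
  let ?y = "p / q"
  have q: "0 < q" "0 < ?y" "?y \<le> 1" using assms by auto
  have le: "f x powr p \<le> C powr p * (?y / C powr q) * f x powr q + C powr p * (1 - ?y)" for x
  proof -
    have "((f x / C) powr q) powr ?y \<le> ?y * (f x / C) powr q + (1 - ?y)"
      by (rule powr_le_weighted) (use q in auto)
    then have "C powr p * (f x / C) powr p \<le> C powr p * (?y * (f x / C) powr q + (1 - ?y))"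
      using q by (intro mult_left_mono) (auto simp: powr_powr)
    moreover have "C powr p * (f x / C) powr p = f x powr p" using assms(4,5) by (simp add: powr_divide)
    ultimately show ?thesis using assms(4,5) by (simp add: powr_divide algebra_simps)
  qed
  define \<alpha> \<gamma> where "\<alpha> = C powr p * (?y / C powr q)" and "\<gamma> = C powr p * (1 - ?y)"
  note le = le[folded \<alpha>_def \<gamma>_def]
  have nn: "0 \<le> \<alpha>" "0 \<le> \<gamma>" using q assms(2) by (auto simp: \<alpha>_def \<gamma>_def)
  have "(\<integral>\<^sup>+x. ennreal (f x powr p) \<partial>M) \<le> (\<integral>\<^sup>+x. ennreal \<alpha> * ennreal (f x powr q) + ennreal \<gamma> \<partial>M)"
    by (intro nn_integral_mono ennreal_le_affine le nn) auto
  also have "\<dots> = ennreal \<alpha> * (\<integral>\<^sup>+x. ennreal (f x powr q) \<partial>M) + ennreal \<gamma>"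
    by (simp add: nn_integral_add nn_integral_cmult emeasure_space_1)
  also have "\<dots> \<le> ennreal \<alpha> * ennreal (C powr q) + ennreal \<gamma>"
    using assms(1) unfolding Lp_bounded_def by (intro add_mono mult_left_mono) auto
  also have "\<dots> = ennreal (\<alpha> * C powr q + \<gamma>)"
    using nn by (simp add: ennreal_mult ennreal_plus)
  also have "\<alpha> * C powr q + \<gamma> = C powr p"
    using assms(4) by (simp add: \<alpha>_def \<gamma>_def field_simps)
  finally show ?thesis unfolding Lp_bounded_def .
qed

text \<open>The Bochner integral is 0 if \<open>f powr p\<close> is not integrable.\<close>

lemma Lp_bounded_integral:
  assumes "Lp_bounded M p f C" "0 < p" "0 \<le> C"
  shows "(\<integral>x. f x powr p \<partial>M) powr (1 / p) \<le> C"
proof -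
  have "(\<integral>x. f x powr p \<partial>M) \<le> C powr p"
  proof (cases "integrable M (\<lambda>x. f x powr p)")
    case True
    then have "ennreal (\<integral>x. f x powr p \<partial>M) = (\<integral>\<^sup>+x. ennreal (f x powr p) \<partial>M)"
      by (intro nn_integral_eq_integral[symmetric]) auto
    then have "ennreal (\<integral>x. f x powr p \<partial>M) \<le> ennreal (C powr p)" using assms(1) by (simp add: Lp_bounded_def)
    then show ?thesis by simp
  qed (simp add: not_integrable_integral_eq)
  moreover have "0 \<le> (\<integral>x. f x powr p \<partial>M)" by (rule Bochner_Integration.integral_nonneg) simp
  ultimately have "(\<integral>x. f x powr p \<partial>M) powr (1 / p) \<le> (C powr p) powr (1 / p)"
    using assms(2) by (intro powr_mono2) auto
  then show ?thesis using assms(2,3) by (simp add: powr_powr)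
qed

section \<open>Moments from exponential tails\<close>

lemma powr_le_exp:
  fixes x q \<kappa> :: real
  assumes "0 \<le> x" "0 < q" "0 < \<kappa>"
  shows "x powr q \<le> (q / (exp 1 * \<kappa>)) powr q * exp (\<kappa> * x)"
proof (cases "x = 0")
  case False
  then have x: "0 < x" using assms by simp
  \<comment> \<open>Equality holds at \<open>x = q / \<kappa>\<close>, where
    \<open>x powr q * exp (- \<kappa> * x)\<close> is maximal; the factor in the claim is this
    maximum.\<close>
  have "ln (\<kappa> * x / q) \<le> \<kappa> * x / q - 1" using x assms by (intro ln_le_minus_one) auto
  then have "ln x \<le> ln (q / \<kappa>) - 1 + \<kappa> * x / q" using x assms by (simp add: ln_mult ln_div)
  then have "q * ln x \<le> q * (ln (q / \<kappa>) - 1 + \<kappa> * x / q)" using assms by (intro mult_left_mono) auto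
  also have "\<dots> = q * ln (q / (exp 1 * \<kappa>)) + \<kappa> * x"
    using assms by (simp add: ln_mult ln_div algebra_simps)
  finally show ?thesis using x assms by (simp add: powr_def exp_add[symmetric])
qed (use assms in simp)

text \<open>Layer cake formula: \<open>G (V x) - G 0\<close> is the integral of \<open>g\<close> up
  to \<open>V x\<close>, and Fubini's theorem turns its mean into the integral of \<open>g s\<close>
  times a tail probability. With the antiderivatives \<open>G\<close> and \<open>H\<close> the
  fundamental theorem evaluates both integrals.\<close>

lemma (in prob_space) exponential_tail_integral:
  fixes g G H :: "real \<Rightarrow> real"
  assumes [measurable]: "V \<in> borel_measurable M" "g \<in> borel_measurable borel" and V0: "\<And>x. 0 \<le> V x"
    and tail: "\<And>s. 0 \<le> s \<Longrightarrow> prob {x \<in> space M. s \<le> V x} \<le> exp (- s)"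
    and g: "\<And>s. 0 \<le> s \<Longrightarrow> 0 \<le> g s" "\<And>s. 0 \<le> s \<Longrightarrow> DERIV G s :> g s"
    and H: "\<And>s. 0 \<le> s \<Longrightarrow> DERIV H s :> g s * exp (- s)" "(H \<longlongrightarrow> T) at_top"
  shows "(\<integral>\<^sup>+x. ennreal (G (V x) - G 0) \<partial>M) \<le> ennreal (T - H 0)"
proof -
  interpret L: pair_sigma_finite M lborel ..
  have "(\<integral>\<^sup>+x. ennreal (G (V x) - G 0) \<partial>M) = (\<integral>\<^sup>+x. (\<integral>\<^sup>+s. ennreal (g s) * indicator {0..V x} s \<partial>lborel) \<partial>M)"
    using g V0 by (intro nn_integral_cong nn_integral_FTC_Icc[symmetric]) auto
  also have "\<dots> = (\<integral>\<^sup>+x. (\<integral>\<^sup>+s. ennreal (g s) * (if 0 \<le> s \<and> s \<le> V x then 1 else 0) \<partial>lborel) \<partial>M)"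
    by (intro nn_integral_cong) (auto simp: indicator_def)
  also have "\<dots> = (\<integral>\<^sup>+s. (\<integral>\<^sup>+x. ennreal (g s) * (if 0 \<le> s \<and> s \<le> V x then 1 else 0) \<partial>M) \<partial>lborel)"
    by (rule L.Fubini'[symmetric]) measurable
  also have "\<dots> \<le> (\<integral>\<^sup>+s. ennreal (g s * exp (- s)) * indicator {0..} s \<partial>lborel)"
  proof (intro nn_integral_mono)
    fix s :: real
    show "(\<integral>\<^sup>+x. ennreal (g s) * (if 0 \<le> s \<and> s \<le> V x then 1 else 0) \<partial>M) \<le> ennreal (g s * exp (- s)) * indicator {0..} s"
    proof (cases "0 \<le> s")
      case True
      have "(\<integral>\<^sup>+x. ennreal (g s) * (if 0 \<le> s \<and> s \<le> V x then 1 else 0) \<partial>M)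
          = (\<integral>\<^sup>+x. ennreal (g s) * indicator {x \<in> space M. s \<le> V x} x \<partial>M)"
        using True by (intro nn_integral_cong) (auto simp: indicator_def)
      also have "\<dots> = ennreal (g s) * emeasure M {x \<in> space M. s \<le> V x}"
        by (rule nn_integral_cmult_indicator) measurable
      also have "\<dots> \<le> ennreal (g s) * ennreal (exp (- s))"
        using tail[OF True] by (intro mult_left_mono) (auto simp: emeasure_eq_measure ennreal_leI)
      finally show ?thesis using True g(1)[OF True] by (simp add: ennreal_mult)
    qed simp
  qed
  also have "\<dots> = ennreal (T - H 0)"
    using g H by (intro nn_integral_FTC_atLeast) auto
  finally show ?thesis .
qed

text \<open>For \<open>y \<le> 1\<close> it suffices that the mean of \<open>V\<close> is at most 1.
  For \<open>y > 1\<close> the mean of \<open>exp (V / 2)\<close> is at most 2, and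
  \<open>V powr y\<close> is at most \<open>(2 * y / exp 1) powr y\<close> times this exponential;
  since \<open>2 \<le> exp y\<close>, the product is at most \<open>(2 * y) powr y\<close>.\<close>

lemma (in prob_space) exponential_tail_moment:
  assumes [measurable]: "V \<in> borel_measurable M" and V0: "\<And>x. 0 \<le> V x"
    and tail: "\<And>s. 0 \<le> s \<Longrightarrow> prob {x \<in> space M. s \<le> V x} \<le> exp (- s)"
    and p: "1 \<le> p" "0 < y" "2 * y \<le> p"
  shows "(\<integral>\<^sup>+x. ennreal (V x powr y) \<partial>M) \<le> ennreal (p powr p)"
proof (cases "y \<le> 1")
  case True
  have "(\<integral>\<^sup>+x. ennreal (V x - 0) \<partial>M) \<le> ennreal (0 - (- exp (- 0)))"
    by (rule exponential_tail_integral[OF _ _ V0 tail, where g = "\<lambda>_. 1"])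
       (auto intro!: derivative_eq_intros, real_asymp)
  then have EV: "(\<integral>\<^sup>+x. ennreal (V x) \<partial>M) \<le> 1" by simp
  have "(\<integral>\<^sup>+x. ennreal (V x powr y) \<partial>M) \<le> (\<integral>\<^sup>+x. ennreal y * ennreal (V x) + ennreal (1 - y) \<partial>M)"
    using powr_le_weighted[OF V0 p(2) True] V0 p True
    by (intro nn_integral_mono) (simp add: ennreal_mult[symmetric] ennreal_plus[symmetric] del: ennreal_plus)
  also have "\<dots> = ennreal y * (\<integral>\<^sup>+x. ennreal (V x) \<partial>M) + ennreal (1 - y)"
    by (simp add: nn_integral_add nn_integral_cmult emeasure_space_1)
  also have "\<dots> \<le> ennreal y * 1 + ennreal (1 - y)" using EV by (intro add_mono mult_left_mono) auto
  also have "\<dots> = ennreal 1" using p True by (simp add: ennreal_plus[symmetric] del: ennreal_plus)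
  also have "\<dots> \<le> ennreal (p powr p)" using p by (intro ennreal_leI ge_one_powr_ge_zero) auto
  finally show ?thesis .
next
  case False
  have "(\<integral>\<^sup>+x. ennreal (exp (V x / 2) - exp (0 / 2)) \<partial>M) \<le> ennreal (0 - (- exp (- 0 / 2)))"
    by (rule exponential_tail_integral[OF _ _ V0 tail, where g = "\<lambda>s. exp (s / 2) / 2"])
       (auto intro!: derivative_eq_intros simp: exp_add[symmetric], real_asymp)
  then have EV: "(\<integral>\<^sup>+x. ennreal (exp (V x / 2) - 1) \<partial>M) \<le> 1" by simp
  let ?a = "(2 * y / exp 1) powr y"
  have "V x powr y \<le> ?a * (exp (V x / 2) - 1) + ?a" for x
    using powr_le_exp[OF V0[of x] p(2), of "1 / 2"] by (simp add: algebra_simps)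
  then have "(\<integral>\<^sup>+x. ennreal (V x powr y) \<partial>M) \<le> (\<integral>\<^sup>+x. ennreal ?a * ennreal (exp (V x / 2) - 1) + ennreal ?a \<partial>M)"
    using V0 by (intro nn_integral_mono ennreal_le_affine) auto
  also have "\<dots> = ennreal ?a * (\<integral>\<^sup>+x. ennreal (exp (V x / 2) - 1) \<partial>M) + ennreal ?a"
    by (simp add: nn_integral_add nn_integral_cmult emeasure_space_1)
  also have "\<dots> \<le> ennreal ?a * 1 + ennreal ?a" using EV by (intro add_mono mult_left_mono) auto
  also have "\<dots> = ennreal (?a * 2)" by (simp add: ennreal_plus[symmetric] del: ennreal_plus)
  also have "\<dots> \<le> ennreal (p powr p)"
  proof (rule ennreal_leI)
    have "?a * 2 \<le> ?a * exp 1 powr 1" using exp_ge_add_one_self[of 1] by (intro mult_left_mono) auto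
    also have "\<dots> \<le> ?a * exp 1 powr y" using False by (intro mult_left_mono powr_mono) auto
    also have "\<dots> = (2 * y) powr y" using False by (simp add: powr_mult[symmetric])
    also have "\<dots> \<le> p powr y" using p by (intro powr_mono2) auto
    also have "\<dots> \<le> p powr p" using p by (intro powr_mono) auto
    finally show "?a * 2 \<le> p powr p" .
  qed
  finally show ?thesis .
qed

section \<open>Moments of averages of independent bounded variables\<close>

lemma (in prob_space) indep_exp_moment:
  fixes f :: "nat \<Rightarrow> 'a \<Rightarrow> real"
  assumes indep: "indep_vars (\<lambda>_. borel) f {1..m}" and m: "1 \<le> m"
    and range: "\<And>j. j \<in> {1..m} \<Longrightarrow> AE x in M. f j x \<in> {a..b}"
    and mean: "\<And>j. j \<in> {1..m} \<Longrightarrow> expectation (f j) = \<mu>" and "0 < \<kappa>"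
  shows "(\<integral>\<^sup>+x. ennreal (exp (\<kappa> * (1 / real m * (\<Sum>j\<in>{1..m}. f j x) - \<mu>))) \<partial>M)
    \<le> ennreal (exp (\<kappa>\<^sup>2 * (b - a)\<^sup>2 / (8 * real m)))"
proof -
  let ?l = "\<kappa> / real m"
  have "exp (\<kappa> * (1 / real m * (\<Sum>j\<in>{1..m}. f j x) - \<mu>)) = (\<Prod>j\<in>{1..m}. exp (?l * (f j x - \<mu>)))" for x
    using m by (simp add: exp_sum[symmetric] sum_distrib_left[symmetric] sum_subtractf sum_divide_distrib[symmetric] right_diff_distrib)
  then have "(\<integral>\<^sup>+x. ennreal (exp (\<kappa> * (1 / real m * (\<Sum>j\<in>{1..m}. f j x) - \<mu>))) \<partial>M)
      = (\<integral>\<^sup>+x. (\<Prod>j\<in>{1..m}. ennreal (exp (?l * (f j x - \<mu>)))) \<partial>M)"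
    by (simp add: prod_ennreal)
  also have "\<dots> = (\<Prod>j\<in>{1..m}. \<integral>\<^sup>+x. ennreal (exp (?l * (f j x - \<mu>))) \<partial>M)"
    by (intro indep_vars_nn_integral indep_vars_compose2[OF indep]) auto
  also have "\<dots> \<le> (\<Prod>j\<in>{1..m}. ennreal (exp (?l\<^sup>2 * (b - a)\<^sup>2 / 8)))"
  proof (intro prod_mono_ennreal)
    fix j assume j: "j \<in> {1..m}"
    interpret R: interval_bounded_random_variable M "f j" a b
      using indep range[OF j] j by unfold_locales (auto simp: indep_vars_def)
    show "(\<integral>\<^sup>+x. ennreal (exp (?l * (f j x - \<mu>))) \<partial>M) \<le> ennreal (exp (?l\<^sup>2 * (b - a)\<^sup>2 / 8))"
      using R.Hoeffdings_lemma_nn_integral[of ?l] mean[OF j] m \<open>0 < \<kappa>\<close> by simp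
  qed
  also have "\<dots> = ennreal (exp (?l\<^sup>2 * (b - a)\<^sup>2 / 8) ^ m)" by (simp add: ennreal_power)
  also have "exp (?l\<^sup>2 * (b - a)\<^sup>2 / 8) ^ m = exp (\<kappa>\<^sup>2 * (b - a)\<^sup>2 / (8 * real m))"
    using m by (simp add: exp_of_nat_mult[symmetric] power2_eq_square field_simps)
  finally show ?thesis .
qed

text \<open>For the chosen \<open>\<kappa>\<close> both exponential moments are at most
  \<open>exp (q / 2)\<close>, while \<open>powr_le_exp\<close> contributes
  \<open>(exp (- 1) / 2) powr q\<close>. Its part \<open>(1 / 2) powr q\<close> pays for
  \<open>exp (q / 2)\<close>, as \<open>1 / 2 \<le> ln 2\<close>; its part \<open>exp (- q)\<close>
  is kept to pay for a union over up to \<open>exp q / 2\<close> events.\<close>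

lemma (in prob_space) Hoeffding_moment:
  fixes f :: "nat \<Rightarrow> 'a \<Rightarrow> real"
  assumes indep: "indep_vars (\<lambda>_. borel) f {1..m}" and m: "1 \<le> m" and b: "0 < b" and q: "0 < q"
    and range: "\<And>j. j \<in> {1..m} \<Longrightarrow> AE x in M. f j x \<in> {0..b}"
    and mean: "\<And>j. j \<in> {1..m} \<Longrightarrow> expectation (f j) = \<mu>"
  shows "(\<integral>\<^sup>+x. ennreal (\<bar>1 / real m * (\<Sum>j\<in>{1..m}. f j x) - \<mu>\<bar> powr q) \<partial>M)
    \<le> ennreal (2 * exp (- q) * (b * sqrt q / sqrt (real m)) powr q)"
proof -
  define Z where "Z x = 1 / real m * (\<Sum>j\<in>{1..m}. f j x) - \<mu>" for x
  have [measurable]: "f j \<in> borel_measurable M" if "j \<in> {1..m}" for j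
    using indep that by (auto simp: indep_vars_def)
  have [measurable]: "Z \<in> borel_measurable M" unfolding Z_def by measurable
  \<comment> \<open>The minimizer of
    \<open>\<kappa>\<^sup>2 * b\<^sup>2 / (8 * m) - q * ln \<kappa>\<close>, the part of the
    exponent of the resulting bound that depends on \<open>\<kappa>\<close>.\<close>
  define \<kappa> where "\<kappa> = 2 * sqrt q * sqrt (real m) / b"
  have \<kappa>: "0 < \<kappa>" using m b q by (simp add: \<kappa>_def)
  have l2: "\<kappa>\<^sup>2 * b\<^sup>2 / (8 * real m) = q / 2"
    using m b q by (simp add: \<kappa>_def power_divide power_mult_distrib)
  have up: "(\<integral>\<^sup>+x. ennreal (exp (\<kappa> * Z x)) \<partial>M) \<le> ennreal (exp (q / 2))"
    using indep_exp_moment[OF indep m range mean \<kappa>] unfolding Z_def diff_zero l2 by simp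
  have "indep_vars (\<lambda>_. borel) (\<lambda>j x. - f j x) {1..m}" by (intro indep_vars_compose2[OF indep]) auto
  moreover have "AE x in M. - f j x \<in> {- b..0}" if "j \<in> {1..m}" for j using range[OF that] by eventually_elim auto
  ultimately have "(\<integral>\<^sup>+x. ennreal (exp (\<kappa> * (1 / real m * (\<Sum>j\<in>{1..m}. - f j x) - (- \<mu>)))) \<partial>M)
      \<le> ennreal (exp (\<kappa>\<^sup>2 * (0 - - b)\<^sup>2 / (8 * real m)))"
    by (rule indep_exp_moment[OF _ m]) (use \<kappa> mean in auto)
  moreover have "1 / real m * (\<Sum>j\<in>{1..m}. - f j x) - (- \<mu>) = - Z x" for x
    by (simp add: Z_def sum_negf)
  moreover have "\<kappa>\<^sup>2 * (0 - - b)\<^sup>2 / (8 * real m) = q / 2" using l2 by simp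
  ultimately have down: "(\<integral>\<^sup>+x. ennreal (exp (\<kappa> * - Z x)) \<partial>M) \<le> ennreal (exp (q / 2))"
    by (simp only:)
  let ?a = "(q / (exp 1 * \<kappa>)) powr q"
  have "(\<integral>\<^sup>+x. ennreal (\<bar>Z x\<bar> powr q) \<partial>M) \<le> (\<integral>\<^sup>+x. ennreal ?a * (ennreal (exp (\<kappa> * Z x)) + ennreal (exp (\<kappa> * - Z x))) \<partial>M)"
  proof (intro nn_integral_mono)
    fix x
    have "\<bar>Z x\<bar> powr q \<le> ?a * exp (\<kappa> * \<bar>Z x\<bar>)" by (rule powr_le_exp) (use q \<kappa> in auto)
    also have "\<dots> \<le> ?a * (exp (\<kappa> * Z x) + exp (\<kappa> * - Z x))"
      by (intro mult_left_mono) (auto simp: abs_if)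
    finally show "ennreal (\<bar>Z x\<bar> powr q) \<le> ennreal ?a * (ennreal (exp (\<kappa> * Z x)) + ennreal (exp (\<kappa> * - Z x)))"
      by (simp add: ennreal_mult[symmetric] ennreal_plus[symmetric] del: ennreal_plus)
  qed
  also have "\<dots> = ennreal ?a * ((\<integral>\<^sup>+x. ennreal (exp (\<kappa> * Z x)) \<partial>M) + (\<integral>\<^sup>+x. ennreal (exp (\<kappa> * - Z x)) \<partial>M))"
    by (simp add: nn_integral_add nn_integral_cmult)
  also have "\<dots> \<le> ennreal ?a * (ennreal (exp (q / 2)) + ennreal (exp (q / 2)))"
    using up down by (intro mult_left_mono add_mono) auto
  also have "\<dots> = ennreal (?a * (2 * exp (q / 2)))"
    by (simp add: ennreal_mult[symmetric] ennreal_plus[symmetric] del: ennreal_plus)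
  also have "\<dots> \<le> ennreal (2 * exp (- q) * (b * sqrt q / sqrt (real m)) powr q)"
  proof (rule ennreal_leI)
    have "q / (exp 1 * \<kappa>) = (b * sqrt q / sqrt (real m)) * (exp (- 1) / 2)"
      using q m b by (simp add: \<kappa>_def exp_minus field_simps real_sqrt_mult[symmetric])
    then have "?a = (b * sqrt q / sqrt (real m)) powr q * (exp (- 1) / 2) powr q"
      using q m b by (simp only: powr_mult)
    also have "(exp (- 1) / 2 :: real) powr q = exp (- q) * (1 / 2) powr q"
      using powr_mult[of "exp (-1)" "1/2" q] by (simp add: powr_def)
    finally have eq: "?a * (2 * exp (q / 2)) =
        2 * exp (- q) * (b * sqrt q / sqrt (real m)) powr q * ((1 / 2) powr q * exp (q / 2))" by simp
    have "(1 / 2) powr q * exp (q / 2) = exp (q * (1 / 2 - ln 2))"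
      by (simp add: powr_def ln_div exp_add[symmetric] algebra_simps)
    also have "\<dots> \<le> 1" using q ln2_ge_two_thirds by (simp add: mult_nonneg_nonpos)
    finally have "(1 / 2) powr q * exp (q / 2) \<le> 1" .
    then show "?a * (2 * exp (q / 2)) \<le> 2 * exp (- q) * (b * sqrt q / sqrt (real m)) powr q"
      unfolding eq by (intro mult_left_le) auto
  qed
  finally show ?thesis by (simp add: Z_def)
qed

text \<open>The \<open>q\<close>-th power of a maximum is at most the sum of the \<open>q\<close>-th
  powers. The factor \<open>2 * exp (- q)\<close> of every summand cancels the number of summands,
  so the size of \<open>T\<close> leaves no trace in the bound.\<close>

lemma (in prob_space) Hoeffding_Max_moment:
  fixes f :: "'i \<Rightarrow> nat \<Rightarrow> 'a \<Rightarrow> real"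
  assumes T: "finite T" "T \<noteq> {}" "2 * real (card T) \<le> exp q"
    and indep: "\<And>t. t \<in> T \<Longrightarrow> indep_vars (\<lambda>_. borel) (f t) {1..m}"
    and m: "1 \<le> m" and b: "0 < b" and q: "0 < q"
    and range: "\<And>t j. t \<in> T \<Longrightarrow> j \<in> {1..m} \<Longrightarrow> AE x in M. f t j x \<in> {0..b}"
    and mean: "\<And>t j. t \<in> T \<Longrightarrow> j \<in> {1..m} \<Longrightarrow> expectation (f t j) = \<mu> t"
  shows "Lp_bounded M q (\<lambda>x. MAX t\<in>T. \<bar>1 / real m * (\<Sum>j\<in>{1..m}. f t j x) - \<mu> t\<bar>) (b * sqrt q / sqrt (real m))"
proof -
  let ?Z = "\<lambda>t x. \<bar>1 / real m * (\<Sum>j\<in>{1..m}. f t j x) - \<mu> t\<bar>"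
  let ?B = "(b * sqrt q / sqrt (real m)) powr q"
  have [measurable]: "f t j \<in> borel_measurable M" if "t \<in> T" "j \<in> {1..m}" for t j
    using indep that by (auto simp: indep_vars_def)
  have "(\<integral>\<^sup>+x. ennreal ((MAX t\<in>T. ?Z t x) powr q) \<partial>M) \<le> (\<integral>\<^sup>+x. (\<Sum>t\<in>T. ennreal (?Z t x powr q)) \<partial>M)"
  proof (intro nn_integral_mono)
    fix x
    obtain t where "t \<in> T" "(MAX t\<in>T. ?Z t x) = ?Z t x"
      using Max_in[of "(\<lambda>t. ?Z t x) ` T"] T by fastforce
    then show "ennreal ((MAX t\<in>T. ?Z t x) powr q) \<le> (\<Sum>t\<in>T. ennreal (?Z t x powr q))"
      using member_le_sum[of t T "\<lambda>t. ennreal (?Z t x powr q)"] T by simp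
  qed
  also have "\<dots> = (\<Sum>t\<in>T. \<integral>\<^sup>+x. ennreal (?Z t x powr q) \<partial>M)"
    by (rule nn_integral_sum) measurable
  also have "\<dots> \<le> (\<Sum>t\<in>T. ennreal (2 * exp (- q) * ?B))"
    by (intro sum_mono Hoeffding_moment indep m b q range mean)
  also have "\<dots> = ennreal ((2 * real (card T)) * (exp (- q) * ?B))"
    by (simp add: ennreal_mult ennreal_of_nat_eq_real_of_nat[symmetric] ac_simps)
  also have "\<dots> \<le> ennreal (exp q * (exp (- q) * ?B))"
    using T by (intro ennreal_leI mult_right_mono) auto
  also have "exp q * (exp (- q) * ?B) = ?B" by (simp add: exp_minus)
  finally show ?thesis unfolding Lp_bounded_def .
qed

section \<open>Random search in a cube\<close>

lemma cube_sets: "cube m a b \<in> sets (PiM {1..m} (\<lambda>_. lborel))"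
  unfolding cube_def by (intro sets_PiM_I_finite) auto

lemma emeasure_PiM_lborel:
  "(\<And>i. i \<in> {1..m} \<Longrightarrow> A i \<in> sets borel) \<Longrightarrow>
    emeasure (PiM {1..m::nat} (\<lambda>_. lborel :: real measure)) (Pi\<^sub>E {1..m} A) = (\<Prod>i\<in>{1..m}. emeasure lborel (A i))"
proof -
  assume *: "\<And>i. i \<in> {1..m} \<Longrightarrow> A i \<in> sets borel"
  interpret product_sigma_finite "\<lambda>_::nat. lborel :: real measure" ..
  show ?thesis by (rule emeasure_PiM) (use * in auto)
qed

text \<open>Even if \<open>\<eta>\<close> is a corner of the cube, each of the first
  \<open>D\<close> coordinates has an interval of length \<open>2 * c * s\<close> that lies both in
  the ball and in \<open>{- c..c}\<close>, a fraction \<open>s\<close> of the side. The other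
  coordinates are free because a network reads only the first \<open>D\<close> of the
  \<open>m\<close> parameters.\<close>

lemma uniform_cube_ball:
  assumes "0 < c" "D \<le> m" "\<And>i. i \<in> {1..D} \<Longrightarrow> \<bar>\<eta> i\<bar> \<le> c" "0 \<le> s" "s \<le> 1"
  shows "ennreal (s ^ D) \<le> emeasure (uniform_cube m c) {x \<in> space (vec_space m). \<forall>i\<in>{1..D}. \<bar>x i - \<eta> i\<bar> < 2 * c * s}"
proof -
  let ?L = "PiM {1..m} (\<lambda>_. lborel :: real measure)"
  let ?B = "{x \<in> space (vec_space m). \<forall>i\<in>{1..D}. \<bar>x i - \<eta> i\<bar> < 2 * c * s}"
  have sp: "space (vec_space m) = space ?L" "sets (vec_space m) = sets ?L"
    by (auto simp: vec_space_def space_PiM intro!: sets_PiM_cong)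
  have B: "?B \<in> sets ?L"
  proof -
    have "?B = (\<Inter>i\<in>{1..D}. {x \<in> space ?L. \<bar>x i - \<eta> i\<bar> < 2 * c * s}) \<inter> space ?L" by (auto simp: sp)
    moreover have "{x \<in> space ?L. \<bar>x i - \<eta> i\<bar> < 2 * c * s} \<in> sets ?L" if "i \<in> {1..D}" for i
    proof -
      have "i \<in> {1..m}" using that assms(2) by auto
      then show ?thesis by measurable
    qed
    ultimately show ?thesis by auto
  qed
  have cube: "emeasure ?L (cube m (- c) c) = ennreal ((2 * c) ^ m)"
    unfolding cube_def using assms(1) by (subst emeasure_PiM_lborel) (auto simp: ennreal_power)
  \<comment> \<open>The interval ends at \<open>\<eta> i\<close>, or is pushed to the right if it
    would leave the cube.\<close>
  define lo where "lo i = max (- c) (\<eta> i - 2 * c * s)" for i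
  define A where "A i = (if i \<le> D then {lo i<..<lo i + 2 * c * s} else {- c..c})" for i
  have cs: "0 \<le> 2 * c * s" "2 * c * s \<le> 2 * c" using assms by auto
  have "A i \<subseteq> {- c..c}" if "i \<in> {1..m}" for i
    using cs assms(3)[of i] that by (fastforce simp: A_def lo_def max_def abs_le_iff split: if_splits)
  then have "Pi\<^sub>E {1..m} A \<subseteq> cube m (- c) c" unfolding cube_def by (intro PiE_mono) auto
  moreover have "Pi\<^sub>E {1..m} A \<subseteq> ?B"
  proof
    fix x assume x: "x \<in> Pi\<^sub>E {1..m} A"
    have "\<bar>x i - \<eta> i\<bar> < 2 * c * s" if i: "i \<in> {1..D}" for i
    proof -
      have "x i \<in> A i" using x i assms(2) by (auto simp: PiE_def Pi_def)
      then have "lo i < x i" "x i < lo i + 2 * c * s" using i by (auto simp: A_def)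
      then show ?thesis using assms(3)[OF i] cs by (auto simp: lo_def max_def abs_less_iff split: if_splits)
    qed
    then show "x \<in> ?B" using x by (auto simp: vec_space_def space_PiM PiE_def Pi_def)
  qed
  ultimately have "emeasure ?L (Pi\<^sub>E {1..m} A) \<le> emeasure ?L (cube m (- c) c \<inter> ?B)"
    using B cube_sets by (intro emeasure_mono) auto
  moreover have "emeasure ?L (Pi\<^sub>E {1..m} A) = ennreal ((2 * c) ^ m * s ^ D)"
  proof -
    have "emeasure ?L (Pi\<^sub>E {1..m} A) = (\<Prod>i\<in>{1..m}. emeasure lborel (A i))"
      by (rule emeasure_PiM_lborel) (auto simp: A_def)
    also have "\<dots> = (\<Prod>i\<in>{1..m}. ennreal (2 * c) * ennreal (if i \<le> D then s else 1))"
      using assms(1,4) by (intro prod.cong) (auto simp: A_def ennreal_mult)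
    also have "\<dots> = ennreal ((2 * c) ^ m) * (\<Prod>i\<in>{1..m}. ennreal (if i \<le> D then s else 1))"
      using assms(1) by (simp add: prod.distrib ennreal_power)
    also have "(\<Prod>i\<in>{1..m}. ennreal (if i \<le> D then s else 1)) = (\<Prod>i\<in>{1..D}. ennreal s)"
      using assms(2) by (intro prod.mono_neutral_cong_right) auto
    finally show ?thesis using assms by (simp add: ennreal_power ennreal_mult)
  qed
  ultimately have "ennreal ((2 * c) ^ m * s ^ D) / ennreal ((2 * c) ^ m) \<le> emeasure (uniform_cube m c) ?B"
    unfolding uniform_cube_def emeasure_uniform_measure[OF cube_sets B] cube by (intro divide_right_mono_ennreal) auto
  moreover have "ennreal ((2 * c) ^ m * s ^ D) / ennreal ((2 * c) ^ m) = ennreal (s ^ D)"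
    using assms by (subst divide_ennreal) auto
  ultimately show ?thesis by simp
qed

lemma AE_uniform_cube:
  assumes "0 < c"
  shows "AE x in uniform_cube m c. x \<in> cube m (- c) c"
proof -
  let ?L = "PiM {1..m} (\<lambda>_. lborel :: real measure)"
  have "emeasure ?L (cube m (- c) c) = ennreal ((2 * c) ^ m)"
    unfolding cube_def using assms by (subst emeasure_PiM_lborel) (auto simp: ennreal_power)
  then show ?thesis unfolding uniform_cube_def
    by (intro AE_uniform_measureI) (use assms cube_sets in auto)
qed

text \<open>One start misses the ball of radius \<open>2 * c * \<sigma>\<close> with probability at
  most \<open>1 - \<sigma> ^ D\<close>, and all \<open>K\<close> independent starts with at most
  \<open>exp (- K * \<sigma> ^ D)\<close>. This is the tail of \<open>V\<close>, and
  \<open>T\<close> is a multiple of \<open>V powr (1 / D)\<close>; \<open>D \<ge> 2\<close> provides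
  the condition \<open>2 * y \<le> p\<close> for \<open>y = p / D\<close>.\<close>

lemma (in prob_space) random_search_moment:
  fixes \<Theta> :: "nat \<Rightarrow> 'a \<Rightarrow> nat \<Rightarrow> real"
  assumes indep: "indep_vars (\<lambda>_. vec_space m) \<Theta> {1..K}" and K: "1 \<le> K"
    and distr: "\<And>k. k \<in> {1..K} \<Longrightarrow> distr M (vec_space m) (\<Theta> k) = uniform_cube m c"
    and c: "0 < c" and D: "2 \<le> D" "D \<le> m" and \<eta>: "\<And>i. i \<in> {1..D} \<Longrightarrow> \<bar>\<eta> i\<bar> \<le> c" and p: "1 \<le> p"
  shows "(\<lambda>x. MIN k\<in>{1..K}. MAX i\<in>{1..D}. \<bar>\<Theta> k x i - \<eta> i\<bar>) \<in> borel_measurable M"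
    and "Lp_bounded M p (\<lambda>x. MIN k\<in>{1..K}. MAX i\<in>{1..D}. \<bar>\<Theta> k x i - \<eta> i\<bar>) (2 * c * p / real K powr (1 / real D))"
proof -
  define T where "T x = (MIN k\<in>{1..K}. MAX i\<in>{1..D}. \<bar>\<Theta> k x i - \<eta> i\<bar>)" for x
  have [measurable]: "\<Theta> k \<in> measurable M (vec_space m)" if "k \<in> {1..K}" for k
    using indep that by (auto simp: indep_vars_def)
  have comp: "(\<lambda>x. \<Theta> k x i) \<in> borel_measurable M" if "k \<in> {1..K}" "i \<in> {1..D}" for k i
  proof -
    have "i \<in> {1..m}" using that D by auto
    then have "(\<lambda>x. x i) \<in> borel_measurable (vec_space m)" unfolding vec_space_def by measurable
    then show ?thesis using that(1) by measurable
  qed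
  have T[measurable]: "T \<in> borel_measurable M"
    unfolding T_def using comp by (intro borel_measurable_Min borel_measurable_Max) auto
  then show "(\<lambda>x. MIN k\<in>{1..K}. MAX i\<in>{1..D}. \<bar>\<Theta> k x i - \<eta> i\<bar>) \<in> borel_measurable M"
    by (simp add: T_def[abs_def])
  have T0: "0 \<le> T x" for x
    unfolding T_def using K D by (subst Min_ge_iff) (auto simp: Max_ge_iff)
  define V where "V x = real K * (T x / (2 * c)) powr real D" for x
  have [measurable]: "V \<in> borel_measurable M" unfolding V_def by measurable
  have V0: "0 \<le> V x" for x by (simp add: V_def)
  have tail: "prob {x \<in> space M. s \<le> V x} \<le> exp (- s)" if s: "0 \<le> s" for s
  proof -
    \<comment> \<open>The cap keeps the radius at most \<open>2 * c\<close>. For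
      \<open>s > K\<close> it gives \<open>r = 1\<close>, and the probability bound
      \<open>(1 - r) ^ K\<close> is 0.\<close>
    define r where "r = min 1 (s / real K)"
    define \<sigma> where "\<sigma> = r powr (1 / real D)"
    have r: "0 \<le> r" "r \<le> 1" "r \<le> s / real K" using s by (auto simp: r_def)
    have \<sigma>: "0 \<le> \<sigma>" "\<sigma> \<le> 1" "\<sigma> ^ D = r"
    proof -
      show "0 \<le> \<sigma>" by (simp add: \<sigma>_def)
      show "\<sigma> \<le> 1" using r powr_mono2[of "1 / real D" r 1] by (simp add: \<sigma>_def)
      show "\<sigma> ^ D = r"
      proof (cases "r = 0")
        case False
        then show ?thesis using r D by (simp add: \<sigma>_def powr_realpow[symmetric] powr_powr)
      qed (use D in \<open>simp add: \<sigma>_def\<close>)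
    qed
    define B where "B = {x \<in> space (vec_space m). \<forall>i\<in>{1..D}. \<bar>x i - \<eta> i\<bar> < 2 * c * \<sigma>}"
    have B: "B \<in> sets (vec_space m)"
    proof -
      have "(\<lambda>x. x i) \<in> borel_measurable (vec_space m)" if "i \<in> {1..D}" for i
        using that D unfolding vec_space_def by (intro measurable_component_singleton) auto
      then show ?thesis unfolding B_def by measurable
    qed
    have PB: "prob (\<Theta> k -` (space (vec_space m) - B) \<inter> space M) \<le> 1 - r" if k: "k \<in> {1..K}" for k
    proof -
      have "ennreal r \<le> emeasure (distr M (vec_space m) (\<Theta> k)) B"
        using uniform_cube_ball[OF c D(2) \<eta> \<sigma>(1,2)] \<sigma>(3) unfolding distr[OF k] B_def by simp
      also have "\<dots> = ennreal (prob (\<Theta> k -` B \<inter> space M))"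
        using B k by (simp add: emeasure_distr emeasure_eq_measure)
      finally have "r \<le> prob (\<Theta> k -` B \<inter> space M)" by simp
      moreover have "\<Theta> k -` (space (vec_space m) - B) \<inter> space M = space M - (\<Theta> k -` B \<inter> space M)"
        using measurable_space[of "\<Theta> k" M "vec_space m"] k by auto
      moreover have "\<Theta> k -` B \<inter> space M \<in> events" using B k by measurable
      ultimately show ?thesis by (simp add: prob_compl)
    qed
    have sub: "{x \<in> space M. s \<le> V x} \<subseteq> (\<Inter>k\<in>{1..K}. \<Theta> k -` (space (vec_space m) - B) \<inter> space M)"
    proof (intro subsetI INT_I)
      fix x k assume "x \<in> {x \<in> space M. s \<le> V x}" and k: "k \<in> {1..K}"
      then have x: "x \<in> space M" "s \<le> V x" by auto
      have "\<Theta> k x \<notin> B"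
      proof
        assume "\<Theta> k x \<in> B"
        then have "(MAX i\<in>{1..D}. \<bar>\<Theta> k x i - \<eta> i\<bar>) < 2 * c * \<sigma>" using D by (subst Max_less_iff) (auto simp: B_def)
        moreover have "T x \<le> (MAX i\<in>{1..D}. \<bar>\<Theta> k x i - \<eta> i\<bar>)" unfolding T_def using k by (intro Min_le) auto
        ultimately have "T x / (2 * c) < \<sigma>" using c by (simp add: divide_less_eq mult.commute)
        then have "(T x / (2 * c)) powr real D < \<sigma> powr real D" using T0[of x] c D by (intro powr_less_mono2) auto
        also have "\<dots> = r" using \<sigma> D by (simp add: powr_realpow' flip: \<sigma>(3))
        finally have "V x < real K * r" using K by (simp add: V_def)
        also have "\<dots> \<le> s" using r K by (simp add: field_simps)
        finally show False using x by simp
      qed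
      moreover have "\<Theta> k x \<in> space (vec_space m)"
        using measurable_space[of "\<Theta> k" M "vec_space m"] k x by auto
      ultimately show "x \<in> \<Theta> k -` (space (vec_space m) - B) \<inter> space M" using x by simp
    qed
    have "prob {x \<in> space M. s \<le> V x} \<le> prob (\<Inter>k\<in>{1..K}. \<Theta> k -` (space (vec_space m) - B) \<inter> space M)"
      using sub B K by (intro finite_measure_mono sets.finite_INT) (auto intro!: measurable_sets)
    also have "\<dots> = (\<Prod>k\<in>{1..K}. prob (\<Theta> k -` (space (vec_space m) - B) \<inter> space M))"
      by (rule indep_varsD_finite[OF indep]) (use K B in auto)
    also have "\<dots> \<le> (\<Prod>k\<in>{1..K}. 1 - r)" using PB by (intro prod_mono) auto
    also have "\<dots> = (1 - r) ^ K" by simp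
    also have "\<dots> \<le> exp (- s)"
    proof (cases "s \<le> real K")
      case True
      then have "r = s / real K" using K by (simp add: r_def min_def divide_le_eq)
      moreover have "(1 - r) ^ K \<le> exp (- r) ^ K" using r exp_minus_ge[of r] by (intro power_mono) auto
      ultimately show ?thesis using K by (simp add: exp_of_nat_mult[symmetric])
    next
      case False
      then have "r = 1" using K by (simp add: r_def min_def divide_le_eq)
      then show ?thesis using K by (simp add: power_0_left)
    qed
    finally show ?thesis .
  qed
  have TV: "T x powr p = ((2 * c) / real K powr (1 / real D)) powr p * V x powr (p / real D)" for x
  proof -
    have "V x powr (p / real D) = real K powr (p / real D) * (T x / (2 * c)) powr p"
      using D K c T0[of x] by (simp add: V_def powr_mult powr_powr)
    then show ?thesis using c K D T0[of x] by (simp add: powr_divide powr_powr field_simps)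
  qed
  have "(\<integral>\<^sup>+x. ennreal (T x powr p) \<partial>M) =
      ennreal (((2 * c) / real K powr (1 / real D)) powr p) * (\<integral>\<^sup>+x. ennreal (V x powr (p / real D)) \<partial>M)"
    unfolding TV by (simp add: ennreal_mult nn_integral_cmult)
  also have "\<dots> \<le> ennreal (((2 * c) / real K powr (1 / real D)) powr p) * ennreal (p powr p)"
  proof (intro mult_left_mono exponential_tail_moment V0 tail p)
    show "0 < p / real D" "2 * (p / real D) \<le> p" using p D by (auto simp: field_simps)
  qed auto
  also have "\<dots> = ennreal ((2 * c * p / real K powr (1 / real D)) powr p)"
    using c p by (simp add: ennreal_mult[symmetric] powr_mult powr_divide)
  finally show "Lp_bounded M p (\<lambda>x. MIN k\<in>{1..K}. MAX i\<in>{1..D}. \<bar>\<Theta> k x i - \<eta> i\<bar>) (2 * c * p / real K powr (1 / real D))"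
    unfolding Lp_bounded_def T_def .
qed

section \<open>Risk and generalization\<close>

text \<open>Factoring the difference of squares makes the square loss Lipschitz in the prediction;
  so distances of networks carry over to the empirical and the true risk.\<close>

lemma abs_square_diff_le:
  fixes s t y u v :: real
  assumes "s \<in> {u..v}" "t \<in> {u..v}" "y \<in> {u..v}"
  shows "\<bar>(s - y)\<^sup>2 - (t - y)\<^sup>2\<bar> \<le> 2 * (v - u) * \<bar>s - t\<bar>"
proof -
  have "(s - y)\<^sup>2 - (t - y)\<^sup>2 = (s + t - 2 * y) * (s - t)" by (simp add: power2_eq_square algebra_simps)
  moreover have "\<bar>s + t - 2 * y\<bar> \<le> 2 * (v - u)" using assms by auto
  ultimately show ?thesis by (simp add: abs_mult mult_right_mono)
qed

lemma square_diff_bound: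
  fixes s t u v :: real
  assumes "s \<in> {u..v}" "t \<in> {u..v}"
  shows "(s - t)\<^sup>2 \<in> {0..(v - u)\<^sup>2}"
proof -
  have "\<bar>s - t\<bar> \<le> \<bar>v - u\<bar>" using assms by auto
  then show ?thesis using abs_le_square_iff by auto
qed

locale clipped_regression = prob_space P for P :: "'w measure" +
  fixes d D m :: nat and l :: "nat \<Rightarrow> nat" and X :: "nat \<Rightarrow> 'w \<Rightarrow> nat \<Rightarrow> real"
    and Y :: "nat \<Rightarrow> 'w \<Rightarrow> real" and E :: "(nat \<Rightarrow> real) \<Rightarrow> real" and a b u v :: real
  assumes m: "1 \<le> m" and uv: "u < v" and l0: "l 0 = d" and lD: "l D = 1"
    and X_cube: "\<And>j \<omega>. 1 \<le> j \<Longrightarrow> \<omega> \<in> space P \<Longrightarrow> X j \<omega> \<in> cube d a b"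
    and Y_range: "\<And>j \<omega>. 1 \<le> j \<Longrightarrow> \<omega> \<in> space P \<Longrightarrow> Y j \<omega> \<in> {u..v}"
    and XY_iid: "iid P (vec_space d \<Otimes>\<^sub>M borel) (\<lambda>j \<omega>. (X j \<omega>, Y j \<omega>)) {1..m}"
    and E_range: "\<And>x. x \<in> cube d a b \<Longrightarrow> E x \<in> {u..v}"
    and E_cond: "AE \<omega> in P. E (X 1 \<omega>) = real_cond_exp P (sigma_gen P (vec_space d) (X 1)) (Y 1) \<omega>"
begin

definition net :: "(nat \<Rightarrow> real) \<Rightarrow> (nat \<Rightarrow> real) \<Rightarrow> real" where
  "net \<theta> x = clipped_dnn (ereal u) (ereal v) \<theta> D l x 1"

definition loss :: "(nat \<Rightarrow> real) \<Rightarrow> nat \<Rightarrow> 'w \<Rightarrow> real" where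
  "loss \<theta> j \<omega> = (net \<theta> (X j \<omega>) - Y j \<omega>)\<^sup>2"

definition emp_risk :: "(nat \<Rightarrow> real) \<Rightarrow> 'w \<Rightarrow> real" where
  "emp_risk \<theta> \<omega> = 1 / real m * (\<Sum>j\<in>{1..m}. loss \<theta> j \<omega>)"

definition risk :: "(nat \<Rightarrow> real) \<Rightarrow> real" where
  "risk \<theta> = expectation (loss \<theta> 1)"

text \<open>Almost surely equal to \<open>E (X 1 \<omega>)\<close>, and used in its place because it
  is measurable by construction.\<close>

abbreviation condY :: "'w \<Rightarrow> real" where
  "condY \<equiv> real_cond_exp P (sigma_gen P (vec_space d) (X 1)) (Y 1)"

definition noise :: real where
  "noise = expectation (\<lambda>\<omega>. (condY \<omega> - Y 1 \<omega>)\<^sup>2)"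

lemma net_range: "net \<theta> x \<in> {u..v}"
  using uv unfolding net_def clipped_dnn_real[of l D, OF lD] by auto

lemma net_measurable [measurable]: "net \<theta> \<in> borel_measurable (vec_space d)"
  using clipped_dnn_measurable[of l D u v \<theta>, OF lD] unfolding l0 net_def[abs_def] .

lemma XY_measurable:
  "j \<in> {1..m} \<Longrightarrow> (\<lambda>\<omega>. (X j \<omega>, Y j \<omega>)) \<in> measurable P (vec_space d \<Otimes>\<^sub>M borel)"
  using XY_iid by (auto simp: iid_def indep_vars_def)

lemma X_measurable [measurable]: "j \<in> {1..m} \<Longrightarrow> X j \<in> measurable P (vec_space d)"
  using measurable_fst'[OF XY_measurable[of j]] by simp

lemma Y_measurable [measurable]: "j \<in> {1..m} \<Longrightarrow> Y j \<in> borel_measurable P"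
  using measurable_snd'[OF XY_measurable[of j]] by simp

lemma loss_measurable [measurable]: "j \<in> {1..m} \<Longrightarrow> loss \<theta> j \<in> borel_measurable P"
  unfolding loss_def[abs_def] by measurable

lemma loss_range: "1 \<le> j \<Longrightarrow> \<omega> \<in> space P \<Longrightarrow> loss \<theta> j \<omega> \<in> {0..(v - u)\<^sup>2}"
  unfolding loss_def by (intro square_diff_bound net_range Y_range)

lemma loss_integrable: "j \<in> {1..m} \<Longrightarrow> integrable P (loss \<theta> j)"
  by (rule integrable_const_bound[of _ "(v - u)\<^sup>2"]) (use loss_range[of j _ \<theta>] in \<open>auto intro!: AE_I2\<close>)

lemma loss_fun_measurable:
  "(\<lambda>(x, y). (net \<theta> x - y)\<^sup>2) \<in> borel_measurable (vec_space d \<Otimes>\<^sub>M borel)"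
  by measurable

lemma loss_indep: "indep_vars (\<lambda>_. borel) (loss \<theta>) {1..m}"
proof -
  have "indep_vars (\<lambda>_. borel) (\<lambda>j \<omega>. (\<lambda>(x, y). (net \<theta> x - y)\<^sup>2) (X j \<omega>, Y j \<omega>)) {1..m}"
    by (rule indep_vars_compose2[where M' = "\<lambda>_. vec_space d \<Otimes>\<^sub>M borel"])
       (use XY_iid loss_fun_measurable in \<open>auto simp: iid_def\<close>)
  then show ?thesis by (simp add: loss_def[abs_def])
qed

lemma loss_mean:
  assumes j: "j \<in> {1..m}"
  shows "expectation (loss \<theta> j) = risk \<theta>"
proof -
  have *: "expectation (loss \<theta> j) = (\<integral>z. (\<lambda>(x, y). (net \<theta> x - y)\<^sup>2) z \<partial>distr P (vec_space d \<Otimes>\<^sub>M borel) (\<lambda>\<omega>. (X j \<omega>, Y j \<omega>)))"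
    if "j \<in> {1..m}" for j
    by (subst integral_distr[OF XY_measurable[OF that] loss_fun_measurable]) (simp add: loss_def[abs_def])
  have 1: "1 \<in> {1..m}" using m by simp
  have "\<forall>i\<in>{1..m}. \<forall>j\<in>{1..m}. distr P (vec_space d \<Otimes>\<^sub>M borel) (\<lambda>\<omega>. (X i \<omega>, Y i \<omega>))
      = distr P (vec_space d \<Otimes>\<^sub>M borel) (\<lambda>\<omega>. (X j \<omega>, Y j \<omega>))"
    using XY_iid unfolding iid_def by blast
  from this[THEN bspec, OF j, THEN bspec, OF 1] show ?thesis
    unfolding risk_def *[OF j] *[OF 1] by simp
qed

lemma emp_risk_diff:
  assumes "\<omega> \<in> space P" and "\<And>x. x \<in> cube d a b \<Longrightarrow> \<bar>net \<theta> x - net \<eta> x\<bar> \<le> \<delta>"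
  shows "\<bar>emp_risk \<theta> \<omega> - emp_risk \<eta> \<omega>\<bar> \<le> 2 * (v - u) * \<delta>"
proof -
  have "\<bar>loss \<theta> j \<omega> - loss \<eta> j \<omega>\<bar> \<le> 2 * (v - u) * \<delta>" if "j \<in> {1..m}" for j
  proof -
    have "\<bar>loss \<theta> j \<omega> - loss \<eta> j \<omega>\<bar> \<le> 2 * (v - u) * \<bar>net \<theta> (X j \<omega>) - net \<eta> (X j \<omega>)\<bar>"
      unfolding loss_def by (intro abs_square_diff_le net_range Y_range) (use that assms in auto)
    also have "\<dots> \<le> 2 * (v - u) * \<delta>"
      using uv that assms X_cube by (intro mult_left_mono) auto
    finally show ?thesis .
  qed
  then have "(\<Sum>j\<in>{1..m}. \<bar>loss \<theta> j \<omega> - loss \<eta> j \<omega>\<bar>) \<le> (\<Sum>j\<in>{1..m}. 2 * (v - u) * \<delta>)"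
    by (rule sum_mono)
  moreover have "\<bar>\<Sum>j\<in>{1..m}. loss \<theta> j \<omega> - loss \<eta> j \<omega>\<bar> \<le> (\<Sum>j\<in>{1..m}. \<bar>loss \<theta> j \<omega> - loss \<eta> j \<omega>\<bar>)"
    by (rule sum_abs)
  ultimately have "\<bar>\<Sum>j\<in>{1..m}. loss \<theta> j \<omega> - loss \<eta> j \<omega>\<bar> \<le> real m * (2 * (v - u) * \<delta>)"
    by (simp only: sum_constant card_atLeastAtMost diff_Suc_1)
  moreover have "emp_risk \<theta> \<omega> - emp_risk \<eta> \<omega> = (\<Sum>j\<in>{1..m}. loss \<theta> j \<omega> - loss \<eta> j \<omega>) / real m"
    by (simp add: emp_risk_def sum_subtractf diff_divide_distrib)
  ultimately show ?thesis using m by (simp add: divide_le_eq mult.commute)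
qed

lemma risk_diff:
  assumes "\<And>x. x \<in> cube d a b \<Longrightarrow> \<bar>net \<theta> x - net \<eta> x\<bar> \<le> \<delta>"
  shows "\<bar>risk \<theta> - risk \<eta>\<bar> \<le> 2 * (v - u) * \<delta>"
proof -
  have 1: "1 \<in> {1..m}" using m by simp
  have "\<bar>loss \<theta> 1 \<omega> - loss \<eta> 1 \<omega>\<bar> \<le> 2 * (v - u) * \<delta>" if "\<omega> \<in> space P" for \<omega>
  proof -
    have "\<bar>loss \<theta> 1 \<omega> - loss \<eta> 1 \<omega>\<bar> \<le> 2 * (v - u) * \<bar>net \<theta> (X 1 \<omega>) - net \<eta> (X 1 \<omega>)\<bar>"
      unfolding loss_def by (intro abs_square_diff_le net_range Y_range) (use that in auto)
    also have "\<dots> \<le> 2 * (v - u) * \<delta>"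
      using uv that assms X_cube by (intro mult_left_mono) auto
    finally show ?thesis .
  qed
  then have "expectation (\<lambda>\<omega>. \<bar>loss \<theta> 1 \<omega> - loss \<eta> 1 \<omega>\<bar>) \<le> expectation (\<lambda>_. 2 * (v - u) * \<delta>)"
    using loss_integrable[OF 1] by (intro integral_mono) auto
  moreover have "\<bar>risk \<theta> - risk \<eta>\<bar> \<le> expectation (\<lambda>\<omega>. \<bar>loss \<theta> 1 \<omega> - loss \<eta> 1 \<omega>\<bar>)"
    unfolding risk_def using loss_integrable[OF 1] integral_abs_bound[of P "\<lambda>\<omega>. loss \<theta> 1 \<omega> - loss \<eta> 1 \<omega>"] by simp
  ultimately show ?thesis by (simp add: prob_space)
qed

section \<open>Excess risk over the noise\<close>

lemma sigma_gen_subalgebra: "subalgebra P (sigma_gen P (vec_space d) (X 1))"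
proof -
  have "X 1 \<in> measurable P (vec_space d)" using m by (intro X_measurable) auto
  then show ?thesis
    unfolding subalgebra_def sigma_gen_def by (auto simp: sets_vimage_algebra2 measurable_def)
qed

lemma sigma_gen_measurable:
  "g \<in> borel_measurable (vec_space d) \<Longrightarrow> (\<lambda>\<omega>. g (X 1 \<omega>)) \<in> borel_measurable (sigma_gen P (vec_space d) (X 1))"
proof -
  assume g: "g \<in> borel_measurable (vec_space d)"
  have "X 1 \<in> measurable P (vec_space d)" using m by (intro X_measurable) auto
  then have "X 1 \<in> measurable (sigma_gen P (vec_space d) (X 1)) (vec_space d)"
    unfolding sigma_gen_def by (intro measurable_vimage_algebra1) (auto dest: measurable_space)
  then show ?thesis using g by measurable
qed

lemma condY_range: "AE \<omega> in P. condY \<omega> \<in> {u..v} \<and> condY \<omega> = E (X 1 \<omega>)"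
  using E_cond AE_space by eventually_elim (use X_cube E_range in \<open>metis order_refl\<close>)

lemma condY_measurable [measurable]: "condY \<in> borel_measurable P"
  by (rule borel_measurable_cond_exp2)

text \<open>Pythagoras: \<open>net \<theta> (X 1 \<omega>) - condY \<omega>\<close> is measurable
  with respect to the sigma-algebra of \<open>X 1\<close>, to which the residual
  \<open>condY - Y 1\<close> is orthogonal.\<close>

lemma risk_decomposition:
  "risk \<theta> = expectation (\<lambda>\<omega>. (net \<theta> (X 1 \<omega>) - condY \<omega>)\<^sup>2) + noise"
proof -
  interpret finite_measure_subalgebra P "sigma_gen P (vec_space d) (X 1)"
    by standard (rule sigma_gen_subalgebra)
  have [measurable]: "X 1 \<in> measurable P (vec_space d)" "Y 1 \<in> borel_measurable P"
    using m by (auto intro!: X_measurable Y_measurable)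
  let ?f = "\<lambda>\<omega>. net \<theta> (X 1 \<omega>) - condY \<omega>"
  have fF: "?f \<in> borel_measurable (sigma_gen P (vec_space d) (X 1))"
    by (intro borel_measurable_diff sigma_gen_measurable net_measurable borel_measurable_cond_exp)
  have bd: "AE \<omega> in P. \<bar>?f \<omega>\<bar> \<le> v - u \<and> \<bar>Y 1 \<omega>\<bar> \<le> \<bar>u\<bar> + \<bar>v\<bar> \<and> \<bar>condY \<omega>\<bar> \<le> \<bar>u\<bar> + \<bar>v\<bar> \<and> \<bar>condY \<omega> - Y 1 \<omega>\<bar> \<le> v - u"
    using condY_range AE_space
  proof eventually_elim
    case (elim \<omega>)
    then show ?case using net_range[of \<theta> "X 1 \<omega>"] Y_range[of 1 \<omega>] by auto
  qed
  have i1: "integrable P (\<lambda>\<omega>. ?f \<omega> * Y 1 \<omega>)"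
  proof (rule integrable_const_bound)
    show "AE \<omega> in P. norm (?f \<omega> * Y 1 \<omega>) \<le> (v - u) * (\<bar>u\<bar> + \<bar>v\<bar>)"
      using bd by eventually_elim (auto simp: abs_mult intro!: mult_mono)
  qed measurable
  \<comment> \<open>The orthogonality: in the mean of the product with \<open>?f\<close>,
    \<open>Y 1\<close> may be replaced by \<open>condY\<close>.\<close>
  note c = real_cond_exp_intg[OF i1 fF \<open>Y 1 \<in> borel_measurable P\<close>]
  have i2: "integrable P (\<lambda>\<omega>. (?f \<omega>)\<^sup>2)"
  proof (rule integrable_const_bound)
    show "AE \<omega> in P. norm ((?f \<omega>)\<^sup>2) \<le> (v - u)\<^sup>2"
      using bd by eventually_elim (auto simp: abs_le_square_iff[symmetric])
  qed measurable
  have i3: "integrable P (\<lambda>\<omega>. (condY \<omega> - Y 1 \<omega>)\<^sup>2)"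
  proof (rule integrable_const_bound)
    show "AE \<omega> in P. norm ((condY \<omega> - Y 1 \<omega>)\<^sup>2) \<le> (v - u)\<^sup>2"
      using bd by eventually_elim (auto simp: abs_le_square_iff[symmetric])
  qed measurable
  have split: "loss \<theta> 1 \<omega> = (?f \<omega>)\<^sup>2 + (condY \<omega> - Y 1 \<omega>)\<^sup>2 + 2 * (?f \<omega> * condY \<omega> - ?f \<omega> * Y 1 \<omega>)" for \<omega>
    by (simp add: loss_def power2_eq_square algebra_simps)
  have "risk \<theta> = expectation (\<lambda>\<omega>. (?f \<omega>)\<^sup>2 + (condY \<omega> - Y 1 \<omega>)\<^sup>2 + 2 * (?f \<omega> * condY \<omega> - ?f \<omega> * Y 1 \<omega>))"
    unfolding risk_def by (rule Bochner_Integration.integral_cong[OF refl split])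
  also have "\<dots> = expectation (\<lambda>\<omega>. (?f \<omega>)\<^sup>2) + noise
      + 2 * (expectation (\<lambda>\<omega>. ?f \<omega> * condY \<omega>) - expectation (\<lambda>\<omega>. ?f \<omega> * Y 1 \<omega>))"
    using i1 i2 i3 c(1) unfolding noise_def by (subst Bochner_Integration.integral_add; simp)+
  finally show ?thesis using c(2) by simp
qed

text \<open>If the integrand on the left is not measurable, the integral is 0.\<close>

lemma L2_error_le_excess_risk:
  "(LINT x : cube d a b | distr P (vec_space d) (X 1). \<bar>net \<theta> x - E x\<bar>\<^sup>2) \<le> risk \<theta> - noise"
proof -
  have X1[measurable]: "X 1 \<in> measurable P (vec_space d)" using m by (intro X_measurable) auto
  let ?g = "\<lambda>x. indicator (cube d a b) x *\<^sub>R \<bar>net \<theta> x - E x\<bar>\<^sup>2"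
  have "(\<integral>x. ?g x \<partial>distr P (vec_space d) (X 1)) \<le> expectation (\<lambda>\<omega>. (net \<theta> (X 1 \<omega>) - condY \<omega>)\<^sup>2)"
  proof (cases "?g \<in> borel_measurable (vec_space d)")
    case True
    have "(\<integral>x. ?g x \<partial>distr P (vec_space d) (X 1)) = expectation (\<lambda>\<omega>. ?g (X 1 \<omega>))"
      by (rule integral_distr[OF X1 True])
    also have "\<dots> = expectation (\<lambda>\<omega>. (net \<theta> (X 1 \<omega>) - condY \<omega>)\<^sup>2)"
    proof (rule integral_cong_AE)
      show "(\<lambda>\<omega>. ?g (X 1 \<omega>)) \<in> borel_measurable P" by (rule measurable_compose[OF X1 True])
      show "AE \<omega> in P. ?g (X 1 \<omega>) = (net \<theta> (X 1 \<omega>) - condY \<omega>)\<^sup>2"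
        using condY_range AE_space by eventually_elim (use X_cube in auto)
    qed measurable
    finally show ?thesis by simp
  next
    case False
    then have "\<not> integrable (distr P (vec_space d) (X 1)) ?g" using borel_measurable_integrable by fastforce
    then show ?thesis by (simp add: not_integrable_integral_eq)
  qed
  then show ?thesis unfolding set_lebesgue_integral_def risk_decomposition by simp
qed

lemma excess_risk_le:
  assumes "\<And>x. x \<in> cube d a b \<Longrightarrow> \<bar>net \<eta> x - E x\<bar> \<le> \<epsilon>"
  shows "risk \<eta> - noise \<le> \<epsilon>\<^sup>2"
proof -
  have [measurable]: "X 1 \<in> measurable P (vec_space d)" using m by (intro X_measurable) auto
  have bd: "AE \<omega> in P. (net \<eta> (X 1 \<omega>) - condY \<omega>)\<^sup>2 \<le> \<epsilon>\<^sup>2"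
    using condY_range AE_space
  proof eventually_elim
    case (elim \<omega>)
    then show ?case using assms[OF X_cube[of 1 \<omega>]] by (auto simp: abs_le_square_iff[symmetric])
  qed
  have "expectation (\<lambda>\<omega>. (net \<eta> (X 1 \<omega>) - condY \<omega>)\<^sup>2) \<le> expectation (\<lambda>_. \<epsilon>\<^sup>2)"
  proof (rule integral_mono_AE)
    show "integrable P (\<lambda>\<omega>. (net \<eta> (X 1 \<omega>) - condY \<omega>)\<^sup>2)"
    proof (rule integrable_const_bound)
      show "AE \<omega> in P. norm ((net \<eta> (X 1 \<omega>) - condY \<omega>)\<^sup>2) \<le> \<epsilon>\<^sup>2"
        using bd by eventually_elim simp
    qed measurable
  qed (use bd in auto)
  then show ?thesis unfolding risk_decomposition by (simp add: prob_space)
qed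

end

section \<open>Covering the parameter cube\<close>

lemma param_offset_bounds:
  assumes "1 \<le> D" and l: "\<And>i. i \<le> D \<Longrightarrow> 1 \<le> l i" and w: "\<And>i. i \<le> D \<Longrightarrow> real (l i) + 1 \<le> w"
  shows "2 \<le> param_offset l (Suc D)" "real (param_offset l (Suc D)) \<le> real D * w * (w - 1)"
proof -
  have "l 1 * (l 0 + 1) \<le> (\<Sum>i\<in>{1..D}. l i * (l (i - 1) + 1))"
    using assms(1) member_le_sum[of 1 "{1..D}" "\<lambda>i. l i * (l (i - 1) + 1)"] by simp
  moreover have "1 * (1 + 1) \<le> l 1 * (l 0 + 1)"
    using l[of 1] l[of 0] assms(1) by (intro mult_mono) auto
  ultimately show "2 \<le> param_offset l (Suc D)"
    by (simp add: param_offset_def atLeastLessThanSuc_atLeastAtMost)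
  have "real (l i * (l (i - 1) + 1)) \<le> w * (w - 1)" if "i \<in> {1..D}" for i
  proof -
    have "real (l i) * (real (l (i - 1)) + 1) \<le> (w - 1) * w"
      using w[of i] w[of "i - 1"] that by (intro mult_mono) auto
    then show ?thesis by (simp only: of_nat_mult of_nat_add of_nat_1 mult.commute[of w])
  qed
  then have "(\<Sum>i\<in>{1..D}. real (l i * (l (i - 1) + 1))) \<le> (\<Sum>i\<in>{1..D}. w * (w - 1))" by (rule sum_mono)
  then show "real (param_offset l (Suc D)) \<le> real D * w * (w - 1)"
    by (simp add: param_offset_def atLeastLessThanSuc_atLeastAtMost mult.assoc)
qed

text \<open>The size of the parameter grid is dominated by the exponent at which the
  moments of the generalization error are taken.\<close>

lemma covering_exponent:
  fixes w B g :: real and D m n r :: nat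
  assumes "1 \<le> D" "2 \<le> w" "1 \<le> B" "1 \<le> m" "1 \<le> g" "ln (3 * real m * B) \<le> g" "ln B \<le> g"
    and n: "1 \<le> n" "real n \<le> real D * w * (w - 1)"
    and r: "1 \<le> r" "real r \<le> B * (real D * w ^ D * B ^ D) * sqrt (real m) + 1"
  shows "2 * real (r ^ n) \<le> exp ((real D * w\<^sup>2 * g)\<^sup>2)"
proof -
  let ?Q = "real D * w ^ D * B ^ D"
  have D1: "1 \<le> real D" using assms(1) by simp
  have pw: "1 \<le> w ^ D" "1 \<le> B ^ D" using assms by (auto intro: one_le_power)
  have "w ^ 1 \<le> w ^ D" using assms(1,2) by (intro power_increasing) auto
  then have "2 * 1 \<le> w ^ D * B ^ D" using assms pw by (intro mult_mono) auto
  note mult_mono[OF D1 this]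
  then have Q2: "2 \<le> ?Q" by (simp add: mult.assoc)
  have sm: "1 \<le> sqrt (real m)" "sqrt (real m) \<le> real m"
    using assms(4) by (auto intro: real_sqrt_ge_one simp: real_le_lsqrt power2_eq_square)
  have BQ: "1 * 2 \<le> B * ?Q" using assms Q2 by (intro mult_mono) auto
  \<comment> \<open>Rounding up costs 1 in \<open>r\<close>, so 2 in \<open>2 * r\<close>; a third
    copy of the product, which is at least 2, absorbs it.\<close>
  have "1 * 2 * 1 \<le> B * ?Q * sqrt (real m)" by (rule mult_mono[OF BQ sm(1)]) (use BQ in auto)
  then have "2 * real r \<le> 3 * (B * ?Q * sqrt (real m))" using r by linarith
  also have "\<dots> \<le> 3 * (B * ?Q * real m)" using sm Q2 assms by (intro mult_left_mono) auto
  also have "\<dots> = (3 * real m * B) * (real D * w ^ D * B ^ D)" by simp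
  finally have "ln (2 * real r) \<le> ln ((3 * real m * B) * (real D * w ^ D * B ^ D))"
    using r by (intro ln_mono) auto
  also have "\<dots> = ln (3 * real m * B) + (ln (real D) + real D * ln w + real D * ln B)"
    using assms D1 by (simp add: ln_mult ln_realpow)
  also have "\<dots> \<le> g + (real D + real D * w + real D * g)"
    using assms D1 ln_le_minus_one[of "real D"] ln_le_minus_one[of w]
    by (intro add_mono mult_left_mono) auto
  also have "\<dots> \<le> real D * g * (w + 3)"
  proof -
    have "1 * g \<le> real D * g" "real D * 1 \<le> real D * g" "real D * w * 1 \<le> real D * w * g"
      using D1 assms by (auto intro: mult_left_mono mult_right_mono)
    then show ?thesis by (simp add: algebra_simps)
  qed
  finally have lr: "ln (2 * real r) \<le> real D * g * (w + 3)" .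
  have "2 * real (r ^ n) \<le> (2 * real r) ^ n"
    using r n(1) self_le_power[of "2::real" n] by (simp add: power_mult_distrib)
  also have "\<dots> = exp (real n * ln (2 * real r))" using r by (simp add: exp_of_nat_mult)
  also have "\<dots> \<le> exp ((real D * w\<^sup>2 * g)\<^sup>2)"
  proof -
    have "real n * ln (2 * real r) \<le> (real D * w * (w - 1)) * (real D * g * (w + 3))"
      using n r lr assms by (intro mult_mono) auto
    also have "\<dots> = (real D)\<^sup>2 * w * g * ((w - 1) * (w + 3))" by (simp add: power2_eq_square algebra_simps)
    also have "\<dots> \<le> (real D)\<^sup>2 * w * g * (w * w\<^sup>2 * g)"
    proof (intro mult_left_mono)
      \<comment> \<open>The factor \<open>w - 1\<close> from the parameter count is essential for
        \<open>w = 2\<close> and \<open>g = 1\<close>: \<open>w * (w + 3) = 10\<close> would exceed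
        \<open>w ^ 3 = 8\<close>.\<close>
      have "(w - 1) * (w + 3) \<le> w * w + w * 2" by (simp add: algebra_simps)
      also have "\<dots> \<le> w * w + w * w" using assms by (intro add_mono mult_left_mono) auto
      also have "\<dots> = 2 * w\<^sup>2" by (simp add: power2_eq_square)
      also have "\<dots> \<le> w * w\<^sup>2" using assms by (intro mult_right_mono) auto
      also have "\<dots> = w * w\<^sup>2 * 1" by simp
      also have "\<dots> \<le> w * w\<^sup>2 * g" using assms by (intro mult_left_mono) auto
      finally show "(w - 1) * (w + 3) \<le> w * w\<^sup>2 * g" .
    qed (use assms in auto)
    also have "\<dots> = (real D * w\<^sup>2 * g)\<^sup>2" by (simp add: power2_eq_square)
    finally show ?thesis by simp
  qed
  finally show ?thesis .
qed

context clipped_regression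
begin

lemma net_lipschitz:
  assumes "1 \<le> D" "\<And>i. i \<le> D \<Longrightarrow> real (l i) + 1 \<le> w" "1 \<le> c" "\<bar>a\<bar> \<le> c" "\<bar>b\<bar> \<le> c"
    and "\<And>i. i \<in> {1..param_offset l (Suc D)} \<Longrightarrow> \<bar>\<theta> i\<bar> \<le> c \<and> \<bar>\<eta> i\<bar> \<le> c \<and> \<bar>\<theta> i - \<eta> i\<bar> \<le> \<delta>"
    and "0 \<le> \<delta>" "x \<in> cube d a b"
  shows "\<bar>net \<theta> x - net \<eta> x\<bar> \<le> real D * w ^ D * c ^ D * \<delta>"
  unfolding net_def
proof (rule clipped_dnn_lipschitz)
  show "\<bar>x j\<bar> \<le> c" if "j \<in> {1..l 0}" for j
  proof -
    have "x j \<in> {a..b}" using that assms(8) l0 by (auto simp: cube_def PiE_def Pi_def)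
    then show ?thesis using assms(4,5) by auto
  qed
qed (use assms lD in auto)

text \<open>Up to the noise, the chain is \<open>risk \<theta> \<le> emp_risk \<theta> \<omega> + g
  \<le> emp_risk \<zeta> \<omega> + g \<le> risk \<zeta> + 2 * g\<close>, followed by
  \<open>risk \<zeta> \<le> risk \<eta> + 2 * (v - u) * \<delta>\<close>.\<close>

lemma L2_error_le:
  assumes \<omega>: "\<omega> \<in> space P" and min: "emp_risk \<theta> \<omega> \<le> emp_risk \<zeta> \<omega>"
    and gen: "\<bar>emp_risk \<theta> \<omega> - risk \<theta>\<bar> \<le> g" "\<bar>emp_risk \<zeta> \<omega> - risk \<zeta>\<bar> \<le> g"
    and opt: "\<And>x. x \<in> cube d a b \<Longrightarrow> \<bar>net \<zeta> x - net \<eta> x\<bar> \<le> \<delta>"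
    and approx: "\<And>x. x \<in> cube d a b \<Longrightarrow> \<bar>net \<eta> x - E x\<bar> \<le> \<epsilon>"
  shows "(LINT x : cube d a b | distr P (vec_space d) (X 1). \<bar>net \<theta> x - E x\<bar>\<^sup>2) \<le> \<epsilon>\<^sup>2 + 2 * (v - u) * \<delta> + 2 * g"
  using L2_error_le_excess_risk[of \<theta>] excess_risk_le[OF approx] risk_diff[OF opt] min gen by linarith

text \<open>Moving a parameter to a near grid point changes the empirical and the true risk by at
  most \<open>2 * (v - u) / sqrt m\<close> each, which is the deterministic remainder.
  \<open>S\<close> is the maximal deviation on the finite grid and therefore measurable.\<close>

lemma generalization_bound:
  assumes D: "1 \<le> D" and l: "\<And>i. i \<le> D \<Longrightarrow> 1 \<le> l i" and w: "\<And>i. i \<le> D \<Longrightarrow> real (l i) + 1 \<le> w"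
    and B: "1 \<le> B" "\<bar>a\<bar> \<le> B" "\<bar>b\<bar> \<le> B" and g: "1 \<le> g" "ln (3 * real m * B) \<le> g" "ln B \<le> g"
  obtains S where "S \<in> borel_measurable P" "\<And>\<omega>. 0 \<le> S \<omega>"
    "Lp_bounded P ((real D * w\<^sup>2 * g)\<^sup>2) S ((v - u)\<^sup>2 * (real D * w\<^sup>2 * g) / sqrt (real m))"
    "\<And>\<omega> \<theta>. \<omega> \<in> space P \<Longrightarrow> (\<And>i. i \<in> {1..param_offset l (Suc D)} \<Longrightarrow> \<bar>\<theta> i\<bar> \<le> B) \<Longrightarrow>
      \<bar>emp_risk \<theta> \<omega> - risk \<theta>\<bar> \<le> S \<omega> + 4 * (v - u) / sqrt (real m)"
proof -
  define n where "n = param_offset l (Suc D)"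
  define q where "q = (real D * w\<^sup>2 * g)\<^sup>2"
  define Q where "Q = real D * w ^ D * B ^ D"
  \<comment> \<open>So fine that the Lipschitz constant \<open>Q\<close> times the grid radius
    \<open>B / r\<close> is at most \<open>1 / sqrt m\<close>.\<close>
  define r where "r = nat \<lceil>B * Q * sqrt (real m)\<rceil>"
  have w2: "2 \<le> w" using l[of 0] w[of 0] by simp
  have n: "2 \<le> n" "real n \<le> real D * w * (w - 1)" unfolding n_def using param_offset_bounds[OF D l w] by auto
  have Q: "0 < Q" using D w2 B by (simp add: Q_def)
  have pos: "0 < B * Q * sqrt (real m)" using Q B m by simp
  then have r: "1 \<le> r" "B * Q * sqrt (real m) \<le> real r" "real r \<le> B * Q * sqrt (real m) + 1"
    unfolding r_def by linarith+
  obtain G where G: "finite G" "card G = r ^ n" "G \<subseteq> cube n (- B) B"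
    "\<And>x. x \<in> cube n (- B) B \<Longrightarrow> \<exists>g\<in>G. \<forall>j\<in>{1..n}. \<bar>x j - g j\<bar> \<le> (B - - B) / (2 * real r)"
    using cube_grid[of "- B" B r n] B r(1) by auto
  have G0: "G \<noteq> {}" using G(1,2) r(1) by auto
  have cov: "2 * real (card G) \<le> exp q"
    unfolding G(2) q_def using D w2 B m g n r by (intro covering_exponent) (auto simp: Q_def)
  have Dwg: "0 < real D * w\<^sup>2 * g" using D w2 g by simp
  define S where "S \<omega> = (MAX t\<in>G. \<bar>1 / real m * (\<Sum>j\<in>{1..m}. loss t j \<omega>) - risk t\<bar>)" for \<omega>
  show thesis
  proof (rule that[of S])
    show "S \<in> borel_measurable P"
      unfolding S_def using G(1) by (intro borel_measurable_Max) measurable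
    show "0 \<le> S \<omega>" for \<omega> unfolding S_def using G(1) G0 by (auto simp: Max_ge_iff)
    have "Lp_bounded P q S ((v - u)\<^sup>2 * sqrt q / sqrt (real m))"
      unfolding S_def
    proof (rule Hoeffding_Max_moment[OF G(1) G0 cov loss_indep m])
      show "AE \<omega> in P. loss t j \<omega> \<in> {0..(v - u)\<^sup>2}" if "j \<in> {1..m}" for t j
        using that loss_range[of j _ t] by (intro AE_I2) auto
    qed (use uv D Dwg loss_mean in \<open>auto simp: q_def\<close>)
    then show "Lp_bounded P ((real D * w\<^sup>2 * g)\<^sup>2) S ((v - u)\<^sup>2 * (real D * w\<^sup>2 * g) / sqrt (real m))"
      using Dwg by (simp add: q_def)
    fix \<omega> \<theta> assume \<omega>: "\<omega> \<in> space P" and \<theta>: "\<And>i. i \<in> {1..param_offset l (Suc D)} \<Longrightarrow> \<bar>\<theta> i\<bar> \<le> B"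
    \<comment> \<open>Only the first \<open>n\<close> coordinates enter the networks, and elements
      of a cube are extensional.\<close>
    have "restrict \<theta> {1..n} \<in> cube n (- B) B" using \<theta> by (auto simp: cube_def n_def abs_le_iff minus_le_iff)
    then obtain t where t: "t \<in> G" "\<And>j. j \<in> {1..n} \<Longrightarrow> \<bar>\<theta> j - t j\<bar> \<le> B / real r" using G(4) by fastforce
    have tB: "\<bar>t j\<bar> \<le> B" if "j \<in> {1..n}" for j
      using t(1) G(3) that by (force simp: cube_def PiE_def Pi_def abs_le_iff)
    have "\<bar>net \<theta> x - net t x\<bar> \<le> 1 / sqrt (real m)" if "x \<in> cube d a b" for x
    proof -
      have "\<bar>net \<theta> x - net t x\<bar> \<le> Q * (B / real r)"
        unfolding Q_def using D w B \<theta> t tB that by (intro net_lipschitz) (auto simp: n_def)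
      also have "\<dots> \<le> 1 / sqrt (real m)" using r m by (simp add: field_simps)
      finally show ?thesis .
    qed
    then have "\<bar>emp_risk \<theta> \<omega> - emp_risk t \<omega>\<bar> \<le> 2 * (v - u) * (1 / sqrt (real m))"
      "\<bar>risk \<theta> - risk t\<bar> \<le> 2 * (v - u) * (1 / sqrt (real m))"
      by (intro emp_risk_diff \<omega> risk_diff; simp)+
    moreover have "\<bar>emp_risk t \<omega> - risk t\<bar> \<le> S \<omega>"
      unfolding S_def emp_risk_def using G(1) t(1) by (intro Max_ge) auto
    moreover have "4 * (v - u) / sqrt (real m) = 2 * (v - u) * (1 / sqrt (real m)) + 2 * (v - u) * (1 / sqrt (real m))"
      by simp
    ultimately show "\<bar>emp_risk \<theta> \<omega> - risk \<theta>\<bar> \<le> S \<omega> + 4 * (v - u) / sqrt (real m)" by linarith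
  qed
qed

end

text \<open>By \<open>c \<le> B\<close> it remains to show
  \<open>18 * ln 3 + 36 * ln B \<le> 23 * B\<close>. The worst case is \<open>B = 36 / 23\<close>,
  and the tangent of \<open>ln\<close> there leaves
  \<open>3 * (36 / 23)\<^sup>2 \<le> exp 2\<close>. With 22 in place of 23 this condition
  fails.\<close>

lemma ln_three_mul_le:
  fixes B c M :: real
  assumes "1 \<le> c" "c \<le> B" "1 \<le> M"
  shows "18 * ln (3 * M * B * c) \<le> 23 * B * ln (exp 1 * M)"
proof -
  \<comment> \<open>The margin is small, about 7.35 against 7.39; \<open>145 / 128\<close> is the
    quadratic Taylor polynomial of \<open>exp\<close> at \<open>1 / 8\<close>.\<close>
  have "(3888 / 529 :: real) \<le> (145 / 128) ^ 16" by (simp add: power_divide)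
  also have "\<dots> \<le> exp (1 / 8) ^ 16"
    using exp_lower_Taylor_quadratic[of "1 / 8"] by (intro power_mono) (auto simp: power2_eq_square)
  also have "\<dots> = exp 2" by (simp add: exp_of_nat_mult[symmetric])
  finally have "ln (3888 / 529) \<le> (2::real)" by (subst ln_exp[symmetric], subst ln_le_cancel_iff) auto
  define t :: real where "t = 36 / 23"
  have "ln (3888 / 529) = ln (3 * t\<^sup>2)" by (simp add: t_def power2_eq_square)
  also have "\<dots> = ln 3 + 2 * ln t" by (subst ln_mult_pos) (auto simp: t_def ln_realpow)
  finally have "ln 3 + 2 * ln t \<le> 2" using \<open>ln (3888 / 529) \<le> 2\<close> by simp
  moreover have "ln (B / t) \<le> B / t - 1" using assms by (intro ln_le_minus_one) (auto simp: t_def)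
  moreover have "ln (B / t) = ln B - ln t" using assms by (subst ln_div) (auto simp: t_def)
  moreover have "B / t = 23 * B / 36" by (simp add: t_def)
  ultimately have 1: "18 * ln 3 + 36 * ln B \<le> 23 * B" by simp
  have "ln c \<le> ln B" "0 \<le> ln M" using assms by auto
  moreover have "18 * ln M \<le> 23 * B * ln M" using assms \<open>0 \<le> ln M\<close> by (intro mult_right_mono) auto
  moreover have "ln (3 * M * B * c) = ln 3 + ln M + ln B + ln c" "23 * B * ln (exp 1 * M) = 23 * B + 23 * B * ln M"
    using assms by (simp_all add: ln_mult algebra_simps)
  ultimately show ?thesis using 1 by linarith
qed

section \<open>Combination of the error terms\<close>

theorem theorem6p5:
  fixes d dd LL M K N :: nat
    and A L a b u v c B :: real
    and l :: "nat \<Rightarrow> nat" and NN :: "nat set"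
    and P :: "'w measure"
    and X :: "nat \<Rightarrow> 'w \<Rightarrow> nat \<Rightarrow> real" and Y :: "nat \<Rightarrow> 'w \<Rightarrow> real"
    and \<E> :: "(nat \<Rightarrow> real) \<Rightarrow> real"
    and \<Theta> :: "nat \<Rightarrow> nat \<Rightarrow> 'w \<Rightarrow> nat \<Rightarrow> real" and kk :: "'w \<Rightarrow> nat \<times> nat"
    and \<R> :: "(nat \<Rightarrow> real) \<Rightarrow> 'w \<Rightarrow> real"
  assumes "d \<ge> 1" "dd \<ge> 1" "LL \<ge> 1" "M \<ge> 1" "K \<ge> 1" "N \<ge> 1"
    and "A > 0" and "a < b" and "u < v"
    and "c \<ge> Max {1, L, \<bar>a\<bar>, \<bar>b\<bar>, 2 * \<bar>u\<bar>, 2 * \<bar>v\<bar>}" and "B \<ge> c"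
    and "\<forall>i\<le>LL. l i \<ge> 1"
    and "NN \<subseteq> {0..N}" and "0 \<in> NN"
    and "real LL \<ge> A * indicator {6 ^ d<..} A / (2 * real d) + 1"
    and "l 0 = d" and "real (l 1) \<ge> A * indicator {6 ^ d<..} A" and "l LL = 1"
    and "dd \<ge> (\<Sum>i\<in>{1..LL}. l i * (l (i - 1) + 1))"
    and "\<forall>i. 2 \<le> i \<and> i < LL \<longrightarrow>
           real (l i) \<ge> indicator {6 ^ d<..} A * max (A / real d - 2 * real i + 3) 2"
    and "prob_space P"
    and "\<forall>j\<ge>1. \<forall>\<omega>\<in>space P. X j \<omega> \<in> cube d a b"
    and "\<forall>j\<ge>1. \<forall>\<omega>\<in>space P. Y j \<omega> \<in> {u..v}"
    and "iid P (vec_space d \<Otimes>\<^sub>M borel) (\<lambda>j \<omega>. (X j \<omega>, Y j \<omega>)) {1..M}"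
    and "\<forall>x\<in>cube d a b. \<E> x \<in> {u..v}"
    and "AE \<omega> in P. \<E> (X 1 \<omega>) = real_cond_exp P (sigma_gen P (vec_space d) (X 1)) (Y 1) \<omega>"
    and "\<forall>x\<in>cube d a b. \<forall>y\<in>cube d a b. \<bar>\<E> x - \<E> y\<bar> \<le> L * pnorm {1..d} 1 (\<lambda>i. x i - y i)"
    and "\<forall>k n. \<Theta> k n \<in> measurable P (vec_space dd)"
    and "kk \<in> measurable P (count_space UNIV)"
    and "(\<Union>k\<in>{1..}. \<Theta> k 0 ` space P) \<subseteq> cube dd (- B) B"
    and "iid P (vec_space dd) (\<lambda>k. \<Theta> k 0) {1..K}"
    and "distr P (vec_space dd) (\<Theta> 1 0) = uniform_cube dd c"
    and "\<forall>\<theta>\<in>space (vec_space dd). \<forall>\<omega>\<in>space P.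
           \<R> \<theta> \<omega> = 1 / real M * (\<Sum>j\<in>{1..M}. \<bar>clipped_dnn u v \<theta> LL l (X j \<omega>) 1 - Y j \<omega>\<bar>\<^sup>2)"
    and "\<forall>\<omega>\<in>space P.
           is_arg_min (\<lambda>(k, n). \<R> (\<Theta> k n \<omega>) \<omega>)
             (\<lambda>(k, n). k \<in> {1..K} \<and> n \<in> NN \<and> maxnorm {1..dd} (\<Theta> k n \<omega>) \<le> B) (kk \<omega>)"
  shows "\<forall>p>0.
      (\<integral>\<omega>. (LINT x : cube d a b | distr P (vec_space d) (X 1).
               \<bar>clipped_dnn u v (\<Theta> (fst (kk \<omega>)) (snd (kk \<omega>)) \<omega>) LL l x 1 - \<E> x\<bar>\<^sup>2) powr p \<partial>P)
        powr (1 / p)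
      \<le> 9 * (real d)\<^sup>2 * L\<^sup>2 * (b - a)\<^sup>2 / A powr (2 / real d)
        + 4 * (v - u) * real LL * (maxnorm {0..LL} (\<lambda>i. real (l i)) + 1) ^ LL * c ^ (LL + 1) * max 1 p
            / real K powr (1 / (real LL * (maxnorm {0..LL} (\<lambda>i. real (l i)) + 1)\<^sup>2))
        + 18 * max 1 ((v - u)\<^sup>2) * real LL * (maxnorm {0..LL} (\<lambda>i. real (l i)) + 1)\<^sup>2
            * max p (ln (3 * real M * B * c)) / sqrt (real M)
    \<and> 9 * (real d)\<^sup>2 * L\<^sup>2 * (b - a)\<^sup>2 / A powr (2 / real d)
        + 4 * (v - u) * real LL * (maxnorm {0..LL} (\<lambda>i. real (l i)) + 1) ^ LL * c ^ (LL + 1) * max 1 p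
            / real K powr (1 / (real LL * (maxnorm {0..LL} (\<lambda>i. real (l i)) + 1)\<^sup>2))
        + 18 * max 1 ((v - u)\<^sup>2) * real LL * (maxnorm {0..LL} (\<lambda>i. real (l i)) + 1)\<^sup>2
            * max p (ln (3 * real M * B * c)) / sqrt (real M)
      \<le> 36 * (real d)\<^sup>2 * c ^ 4 / A powr (2 / real d)
        + 4 * real LL * (maxnorm {0..LL} (\<lambda>i. real (l i)) + 1) ^ LL * c ^ (LL + 2) * max 1 p
            / real K powr (1 / (real LL * (maxnorm {0..LL} (\<lambda>i. real (l i)) + 1)\<^sup>2))
        + 23 * B ^ 3 * real LL * (maxnorm {0..LL} (\<lambda>i. real (l i)) + 1)\<^sup>2
            * max p (ln (exp 1 * real M)) / sqrt (real M)"
proof (intro allI impI)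
  fix p :: real assume p: "0 < p"
  note A0 = assms(7) and ab = assms(8) and uv = assms(9)
  define w where "w = maxnorm {0..LL} (\<lambda>i. real (l i)) + 1"
  define g where "g = max p (ln (3 * real M * B * c))"
  define n where "n = param_offset l (Suc LL)"
  \<comment> \<open>Minkowski's inequality needs an exponent of at least 1; a smaller
    \<open>p\<close> is reached from \<open>p'\<close> by monotonicity of the norms.\<close>
  define p' where "p' = max 1 p"
  interpret prob_space P by fact
  have c_max: "y \<le> c" if "y \<in> {1, L, \<bar>a\<bar>, \<bar>b\<bar>, 2 * \<bar>u\<bar>, 2 * \<bar>v\<bar>}" for y
    by (rule order_trans[OF Max_ge assms(10)]) (simp, rule that)
  have c: "1 \<le> c" "L \<le> c" "\<bar>a\<bar> \<le> c" "\<bar>b\<bar> \<le> c" "2 * \<bar>u\<bar> \<le> c" "2 * \<bar>v\<bar> \<le> c"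
    by (rule c_max; simp)+
  have B: "1 \<le> B" "\<bar>a\<bar> \<le> B" "\<bar>b\<bar> \<le> B" using c assms(11) by auto
  have vu: "v - u \<le> c" "0 < v - u" using c uv by auto
  have M: "1 \<le> real M" "1 \<le> sqrt (real M)" and K: "1 \<le> real K" and LL: "1 \<le> real LL"
    using assms(3-5) by auto
  have l1: "1 \<le> l i" if "i \<le> LL" for i using assms(12) that by simp
  have w: "real (l i) + 1 \<le> w" if "i \<le> LL" for i
    using that by (auto simp: w_def maxnorm_def intro!: Max_ge)
  have w2: "2 \<le> w" using w[of 0] l1[of 0] by simp
  have n: "2 \<le> n" "real n \<le> real LL * w * (w - 1)" "n \<le> dd"
    using param_offset_bounds[of LL l w] assms(3,19) l1 w
    by (auto simp: n_def param_offset_def atLeastLessThanSuc_atLeastAtMost)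
  have pnorm1: "pnorm {1..d} 1 z = (\<Sum>j\<in>{1..d}. \<bar>z j\<bar>)" for z
    by (simp add: pnorm_def sum_nonneg)
  have lip: "\<bar>\<E> x - \<E> y\<bar> \<le> L * (\<Sum>j\<in>{1..d}. \<bar>x j - y j\<bar>)" if "x \<in> cube d a b" "y \<in> cube d a b" for x y
    using assms(27)[THEN bspec, OF that(1), THEN bspec, OF that(2)] unfolding pnorm1 .
  \<comment> \<open>Two opposite corners of the cube are distinct, so a negative \<open>L\<close>
    would contradict the Lipschitz condition.\<close>
  have L0: "0 \<le> L"
  proof -
    have "0 \<le> L * (\<Sum>j\<in>{1..d}. \<bar>(\<lambda>j\<in>{1..d}. a) j - (\<lambda>j\<in>{1..d}. b) j\<bar>)"
      by (rule order_trans[OF abs_ge_zero lip]) (use ab in \<open>auto simp: cube_def\<close>)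
    also have "\<dots> = L * (real d * (b - a))" using ab by simp
    finally have "0 \<le> L * (real d * (b - a))" .
    moreover have "0 < real d * (b - a)" using ab assms(1) by simp
    ultimately show ?thesis by (simp only: zero_le_mult_iff) linarith
  qed

  have g: "1 \<le> g" "ln (3 * real M * B) \<le> g" "ln B \<le> g" "p \<le> g"
  proof -
    have MB: "1 * 1 \<le> real M * B" using M B by (intro mult_mono) auto
    have "3 * (real M * B) * 1 \<le> 3 * (real M * B) * c" using MB c by (intro mult_left_mono) auto
    then have 1: "ln (3 * real M * B) \<le> ln (3 * real M * B * c)" using MB by (intro ln_mono) (auto simp: mult.assoc)
    have "1 * B \<le> 3 * real M * B" using M B by (intro mult_right_mono) auto
    then have 2: "ln B \<le> ln (3 * real M * B)" using B by (intro ln_mono) auto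
    have "exp 1 \<le> 3 * real M * B" using exp_le MB by linarith
    then have "ln (exp 1) \<le> ln (3 * real M * B)" by (intro ln_mono) auto
    then show "1 \<le> g" "ln (3 * real M * B) \<le> g" "ln B \<le> g" "p \<le> g" using 1 2 by (auto simp: g_def)
  qed

  interpret R: clipped_regression P d LL M l X Y \<E> a b u v
  proof unfold_locales
    show "X j \<omega> \<in> cube d a b" "Y j \<omega> \<in> {u..v}" if "1 \<le> j" "\<omega> \<in> space P" for j \<omega>
      using assms(22,23) that by blast+
    show "\<E> x \<in> {u..v}" if "x \<in> cube d a b" for x using assms(25) that by blast
  qed fact+

  define \<epsilon> where "\<epsilon> = 3 * real d * L * (b - a) / A powr (1 / real d)"
  obtain \<eta> where \<eta>: "\<And>t. \<bar>\<eta> t\<bar> \<le> c" "\<And>x. x \<in> cube d a b \<Longrightarrow> \<bar>R.net \<eta> x - \<E> x\<bar> \<le> \<epsilon>"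
  proof (rule dnn_approximation[OF assms(1,3) A0 ab uv L0 c assms(16,18), where E = \<E>])
    assume big: "6 ^ d < A"
    show "A / (2 * real d) + 1 \<le> real LL" "A \<le> real (l 1)" using big assms(15,17) by auto
    show "max (A / real d - 2 * real i + 3) 2 \<le> real (l i)" if "2 \<le> i" "i < LL" for i
      using big assms(20) that by auto
  next
    fix \<zeta> assume "\<And>t. \<bar>\<zeta> t\<bar> \<le> c"
      "\<And>x. x \<in> cube d a b \<Longrightarrow> \<bar>clipped_dnn (ereal u) (ereal v) \<zeta> LL l x 1 - \<E> x\<bar>
        \<le> 3 * real d * L * (b - a) / A powr (1 / real d)"
    then show thesis by (intro that) (auto simp: R.net_def \<epsilon>_def)
  qed (use assms(25) lip in auto)

  obtain S where S: "S \<in> borel_measurable P" "\<And>\<omega>. 0 \<le> S \<omega>"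
    "Lp_bounded P ((real LL * w\<^sup>2 * g)\<^sup>2) S ((v - u)\<^sup>2 * (real LL * w\<^sup>2 * g) / sqrt (real M))"
    "\<And>\<omega> \<theta>. \<omega> \<in> space P \<Longrightarrow> (\<And>i. i \<in> {1..n} \<Longrightarrow> \<bar>\<theta> i\<bar> \<le> B) \<Longrightarrow>
      \<bar>R.emp_risk \<theta> \<omega> - R.risk \<theta>\<bar> \<le> S \<omega> + 4 * (v - u) / sqrt (real M)"
    unfolding n_def using R.generalization_bound[OF assms(3) l1 w B g(1-3)] by blast

  define T where "T \<omega> = (MIN k\<in>{1..K}. MAX i\<in>{1..n}. \<bar>\<Theta> k 0 \<omega> i - \<eta> i\<bar>)" for \<omega>
  have distr: "distr P (vec_space dd) (\<Theta> k 0) = uniform_cube dd c" if "k \<in> {1..K}" for k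
  proof -
    have "1 \<in> {1..K}" using assms(5) by simp
    then show ?thesis using assms(31,32) that unfolding iid_def by metis
  qed
  have T: "T \<in> borel_measurable P" "Lp_bounded P p' T (2 * c * p' / real K powr (1 / real n))"
    unfolding T_def
    by (rule random_search_moment; use assms(5,31) distr c n \<eta>(1) in \<open>auto simp: iid_def p'_def\<close>)+
  have T0: "0 \<le> T \<omega>" for \<omega>
    unfolding T_def using assms(5) n by (subst Min_ge_iff) (auto simp: Max_ge_iff)
  \<comment> \<open>The starting points lie in the smaller cube only almost surely; staying there
    gives the Lipschitz constant with \<open>c ^ LL\<close> instead of
    \<open>B ^ LL\<close>.\<close>
  have AE_cube: "AE \<omega> in P. \<forall>k\<in>{1..K}. \<Theta> k 0 \<omega> \<in> cube dd (- c) c"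
  proof (intro AE_finite_allI)
    fix k assume k: "k \<in> {1..K}"
    show "AE \<omega> in P. \<Theta> k 0 \<omega> \<in> cube dd (- c) c"
    proof (rule AE_distrD[of "\<Theta> k 0" P "vec_space dd"])
      show "\<Theta> k 0 \<in> measurable P (vec_space dd)" using assms(28) by blast
      show "AE x in distr P (vec_space dd) (\<Theta> k 0). x \<in> cube dd (- c) c"
        unfolding distr[OF k] by (rule AE_uniform_cube) (use c in auto)
    qed
  qed simp

  define Q where "Q = real LL * w ^ LL * c ^ LL"
  have Q: "0 < Q" using LL w2 c by (simp add: Q_def)
  define F where "F \<omega> = (LINT x : cube d a b | distr P (vec_space d) (X 1).
    \<bar>R.net (\<Theta> (fst (kk \<omega>)) (snd (kk \<omega>)) \<omega>) x - \<E> x\<bar>\<^sup>2)" for \<omega>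
  define H where "H \<omega> = (\<epsilon>\<^sup>2 + 8 * (v - u) / sqrt (real M)) + (2 * (v - u) * Q * T \<omega> + 2 * S \<omega>)" for \<omega>
  have F0: "0 \<le> F \<omega>" for \<omega>
    unfolding F_def set_lebesgue_integral_def by (intro Bochner_Integration.integral_nonneg) simp
  have R_emp: "\<R> \<theta> \<omega> = R.emp_risk \<theta> \<omega>" if "\<theta> \<in> space (vec_space dd)" "\<omega> \<in> space P" for \<theta> \<omega>
    using assms(33) that by (simp add: R.emp_risk_def R.loss_def R.net_def)
  have \<Theta>_space: "\<Theta> k i \<omega> \<in> space (vec_space dd)" if "\<omega> \<in> space P" for k i \<omega>
    using assms(28) that by (auto intro: measurable_space)
  have max_le: "maxnorm {1..dd} \<theta> \<le> B \<longleftrightarrow> (\<forall>i\<in>{1..dd}. \<bar>\<theta> i\<bar> \<le> B)" for \<theta>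
    using assms(2) by (auto simp: maxnorm_def)
  have \<Theta>0_B: "maxnorm {1..dd} (\<Theta> k 0 \<omega>) \<le> B" if "k \<in> {1..K}" "\<omega> \<in> space P" for k \<omega>
  proof -
    have "\<Theta> k 0 \<omega> \<in> cube dd (- B) B" using assms(30) that by auto
    then show ?thesis unfolding max_le by (force simp: cube_def PiE_def Pi_def abs_le_iff)
  qed
  have "AE \<omega> in P. 0 \<le> F \<omega> \<and> F \<omega> \<le> H \<omega>"
    using AE_cube AE_space
  proof eventually_elim
    case (elim \<omega>)
    let ?\<theta> = "\<Theta> (fst (kk \<omega>)) (snd (kk \<omega>)) \<omega>"
    have min: "is_arg_min (\<lambda>(k, n). \<R> (\<Theta> k n \<omega>) \<omega>)
        (\<lambda>(k, n). k \<in> {1..K} \<and> n \<in> NN \<and> maxnorm {1..dd} (\<Theta> k n \<omega>) \<le> B) (kk \<omega>)"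
      using assms(34) elim(2) by blast
    have "T \<omega> \<in> (\<lambda>k. MAX i\<in>{1..n}. \<bar>\<Theta> k 0 \<omega> i - \<eta> i\<bar>) ` {1..K}"
      unfolding T_def by (rule Min_in) (use assms(5) in auto)
    then obtain k where k: "k \<in> {1..K}" "T \<omega> = (MAX i\<in>{1..n}. \<bar>\<Theta> k 0 \<omega> i - \<eta> i\<bar>)"
      by blast
    \<comment> \<open>The pair \<open>(k, 0)\<close> competes in the minimization because
      \<open>0 \<in> NN\<close> and the starting points satisfy the norm bound
      \<open>B\<close>.\<close>
    have "\<not> \<R> (\<Theta> k 0 \<omega>) \<omega> < \<R> ?\<theta> \<omega>"
    proof
      assume "\<R> (\<Theta> k 0 \<omega>) \<omega> < \<R> ?\<theta> \<omega>"
      then show False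
        using min k(1) assms(14) \<Theta>0_B[OF k(1) elim(2)] unfolding is_arg_min_def
        by (auto simp: case_prod_beta)
    qed
    then have emp: "R.emp_risk ?\<theta> \<omega> \<le> R.emp_risk (\<Theta> k 0 \<omega>) \<omega>"
      using R_emp[OF \<Theta>_space elim(2)] elim(2) by simp
    have gen: "\<bar>R.emp_risk \<theta> \<omega> - R.risk \<theta>\<bar> \<le> S \<omega> + 4 * (v - u) / sqrt (real M)"
      if "maxnorm {1..dd} \<theta> \<le> B" for \<theta>
    proof (rule S(4)[OF elim(2)])
      show "\<bar>\<theta> i\<bar> \<le> B" if "i \<in> {1..n}" for i
        using \<open>maxnorm {1..dd} \<theta> \<le> B\<close>[unfolded max_le] that n(3) by (meson atLeastAtMost_iff order_trans)
    qed
    have \<theta>_B: "maxnorm {1..dd} ?\<theta> \<le> B" using min by (auto simp: is_arg_min_def case_prod_beta)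
    have opt: "\<bar>R.net (\<Theta> k 0 \<omega>) x - R.net \<eta> x\<bar> \<le> Q * T \<omega>" if "x \<in> cube d a b" for x
      unfolding Q_def
    proof (rule R.net_lipschitz[OF assms(3) w c(1,3,4) _ T0 that])
      fix i assume i: "i \<in> {1..param_offset l (Suc LL)}"
      then have i': "i \<in> {1..n}" "i \<in> {1..dd}" using n(3) by (auto simp: n_def)
      have "\<Theta> k 0 \<omega> i \<in> {- c..c}" using elim(1) k(1) i'(2) by (auto simp: cube_def PiE_def Pi_def)
      moreover have "\<bar>\<Theta> k 0 \<omega> i - \<eta> i\<bar> \<le> T \<omega>" unfolding k(2) using i' by (intro Max_ge) auto
      ultimately show "\<bar>\<Theta> k 0 \<omega> i\<bar> \<le> c \<and> \<bar>\<eta> i\<bar> \<le> c \<and> \<bar>\<Theta> k 0 \<omega> i - \<eta> i\<bar> \<le> T \<omega>" using \<eta>(1) by auto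
    qed
    have "F \<omega> \<le> \<epsilon>\<^sup>2 + 2 * (v - u) * (Q * T \<omega>) + 2 * (S \<omega> + 4 * (v - u) / sqrt (real M))"
      unfolding F_def by (rule R.L2_error_le[OF elim(2) emp gen[OF \<theta>_B] gen[OF \<Theta>0_B[OF k(1) elim(2)]] opt \<eta>(2)])
    also have "\<dots> = H \<omega>" by (simp add: H_def)
    finally show ?case using F0 by simp
  qed

  define \<tau> where "\<tau> = 2 * (v - u) * Q * (2 * c * p' / real K powr (1 / real n))"
  define \<sigma> where "\<sigma> = 2 * ((v - u)\<^sup>2 * (real LL * w\<^sup>2 * g) / sqrt (real M))"
  have p': "1 \<le> p'" "p \<le> p'" by (auto simp: p'_def)
  have W: "4 \<le> real LL * w\<^sup>2"
  proof -
    have "2 * 2 \<le> w * w" using w2 by (intro mult_mono) auto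
    then have "1 * 4 \<le> real LL * (w * w)" using LL by (intro mult_mono) auto
    then show ?thesis by (simp add: power2_eq_square)
  qed
  have Wg: "g \<le> real LL * w\<^sup>2 * g" using W g mult_right_mono[of 1 "real LL * w\<^sup>2" g] by simp
  have G1: "1 \<le> real LL * w\<^sup>2 * g" using Wg g(1) by linarith
  then have G0: "0 < real LL * w\<^sup>2 * g" by linarith
  \<comment> \<open>The moment of \<open>S\<close> is known at this large order and is lowered to
    \<open>p'\<close>.\<close>
  have q: "p' \<le> (real LL * w\<^sup>2 * g)\<^sup>2"
  proof -
    have "p' \<le> g" using g by (simp add: p'_def)
    also have "g * 1 \<le> (real LL * w\<^sup>2 * g) * (real LL * w\<^sup>2 * g)" by (rule mult_mono[OF Wg G1]) (use G0 in auto)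
    finally show ?thesis by (simp add: power2_eq_square)
  qed
  have pos: "0 < (v - u)\<^sup>2 * (real LL * w\<^sup>2 * g) / sqrt (real M)" "0 < 2 * c * p' / real K powr (1 / real n)"
    by (intro divide_pos_pos mult_pos_pos G0; use vu M c p' K in simp)+
  have "Lp_bounded P p' S ((v - u)\<^sup>2 * (real LL * w\<^sup>2 * g) / sqrt (real M))"
    by (rule Lp_bounded_exponent[OF S(3) _ q pos(1) S(2,1)]) (use p' in auto)
  then have S': "Lp_bounded P p' (\<lambda>\<omega>. 2 * S \<omega>) \<sigma>"
    unfolding \<sigma>_def by (rule Lp_bounded_cmult) (use pos S in auto)
  have T': "Lp_bounded P p' (\<lambda>\<omega>. 2 * (v - u) * Q * T \<omega>) \<tau>"
    unfolding \<tau>_def by (rule Lp_bounded_cmult[OF T(2)]) (use pos T T0 vu Q in auto)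
  have \<sigma>\<tau>: "0 < \<sigma>" "0 < \<tau>" unfolding \<sigma>_def \<tau>_def by (intro mult_pos_pos pos vu Q zero_less_numeral)+
  have e0: "0 < \<epsilon>\<^sup>2 + 8 * (v - u) / sqrt (real M)" using vu M by (intro add_nonneg_pos) auto
  have "Lp_bounded P p' (\<lambda>\<omega>. 2 * (v - u) * Q * T \<omega> + 2 * S \<omega>) (\<tau> + \<sigma>)"
    by (rule Lp_bounded_add[OF T' S' p'(1) \<sigma>\<tau>(2,1)]) (use T T0 S vu Q in auto)
  from Lp_bounded_add[OF Lp_bounded_const this p'(1) e0]
  have "Lp_bounded P p' H ((\<epsilon>\<^sup>2 + 8 * (v - u) / sqrt (real M)) + (\<tau> + \<sigma>))"
    unfolding H_def using T T0 S vu Q \<sigma>\<tau> e0 by auto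
  then have "Lp_bounded P p H ((\<epsilon>\<^sup>2 + 8 * (v - u) / sqrt (real M)) + (\<tau> + \<sigma>))"
  proof (rule Lp_bounded_exponent[OF _ p p'(2)])
    show "0 < (\<epsilon>\<^sup>2 + 8 * (v - u) / sqrt (real M)) + (\<tau> + \<sigma>)" using \<sigma>\<tau> e0 by linarith
    show "H \<in> borel_measurable P" unfolding H_def using T(1) S(1) by measurable
    show "0 \<le> H \<omega>" for \<omega>
      unfolding H_def using e0 T0 S(2) vu(2) Q by (intro add_nonneg_nonneg mult_nonneg_nonneg) auto
  qed
  then have "Lp_bounded P p F ((\<epsilon>\<^sup>2 + 8 * (v - u) / sqrt (real M)) + (\<tau> + \<sigma>))"
    by (rule Lp_bounded_mono) fact+
  then have main: "(\<integral>\<omega>. F \<omega> powr p \<partial>P) powr (1 / p) \<le> (\<epsilon>\<^sup>2 + 8 * (v - u) / sqrt (real M)) + (\<tau> + \<sigma>)"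
    by (rule Lp_bounded_integral) (use p e0 \<sigma>\<tau> in auto)

  let ?t1 = "9 * (real d)\<^sup>2 * L\<^sup>2 * (b - a)\<^sup>2 / A powr (2 / real d)"
  let ?k = "real K powr (1 / (real LL * w\<^sup>2))"
  let ?t2 = "4 * (v - u) * real LL * w ^ LL * c ^ (LL + 1) * max 1 p / ?k"
  let ?t3 = "18 * max 1 ((v - u)\<^sup>2) * real LL * w\<^sup>2 * g / sqrt (real M)"
  have t1: "\<epsilon>\<^sup>2 = ?t1"
    using A0 by (simp add: \<epsilon>_def power_divide power_mult_distrib powr_power)
  have t2: "\<tau> \<le> ?t2"
  proof -
    have "\<tau> = 4 * (v - u) * real LL * w ^ LL * c ^ (LL + 1) * max 1 p / real K powr (1 / real n)"
      by (simp add: \<tau>_def Q_def p'_def)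
    also have "\<dots> \<le> ?t2"
    proof (rule divide_left_mono)
      have "real LL * w * (w - 1) \<le> real LL * w * w" using LL w2 by (intro mult_left_mono) auto
      then have "real n \<le> real LL * w\<^sup>2" using n(2) by (simp add: power2_eq_square)
      then show "?k \<le> real K powr (1 / real n)"
        using K n(1) by (intro powr_mono divide_left_mono) auto
    qed (use vu LL w2 c K in auto)
    finally show ?thesis .
  qed
  have t3: "8 * (v - u) / sqrt (real M) + \<sigma> \<le> ?t3"
  proof -
    let ?m = "max 1 ((v - u)\<^sup>2)" and ?G = "real LL * w\<^sup>2 * g"
    have "v - u \<le> ?m"
    proof (cases "v - u \<le> 1")
      case False
      then have "v - u \<le> (v - u)\<^sup>2" using self_le_power[of "v - u" 2] by simp
      then show ?thesis by (rule max.coboundedI2)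
    qed simp
    \<comment> \<open>The 8 is twice the remainder 4 of \<open>generalization_bound\<close>; with
      the factor 2 of \<open>S\<close> the sum is 10, below the 18 of the claim.\<close>
    then have "8 * (v - u) \<le> 8 * ?m * 1" by simp
    also have "\<dots> \<le> 8 * ?m * ?G" using G1 by (intro mult_left_mono) auto
    finally have "8 * (v - u) + 2 * ((v - u)\<^sup>2 * ?G) \<le> 8 * ?m * ?G + 2 * (?m * ?G)"
      using G0 by (intro add_mono mult_left_mono mult_right_mono) auto
    also have "\<dots> = 10 * (?m * ?G)" by simp
    also have "\<dots> \<le> 18 * (?m * ?G)" using G0 by (intro mult_right_mono) auto
    also have "\<dots> = 18 * ?m * ?G" by simp
    finally have "(8 * (v - u) + 2 * ((v - u)\<^sup>2 * ?G)) / sqrt (real M) \<le> 18 * ?m * ?G / sqrt (real M)"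
      by (intro divide_right_mono) auto
    then show ?thesis by (simp add: \<sigma>_def add_divide_distrib mult.assoc)
  qed
  have first: "(\<integral>\<omega>. F \<omega> powr p \<partial>P) powr (1 / p) \<le> ?t1 + ?t2 + ?t3"
    using main t1 t2 t3 by linarith

  have s1: "?t1 \<le> 36 * (real d)\<^sup>2 * c ^ 4 / A powr (2 / real d)"
  proof (intro divide_right_mono)
    have "L\<^sup>2 \<le> c\<^sup>2" using L0 c by (intro power_mono) auto
    moreover have "(b - a)\<^sup>2 \<le> (2 * c)\<^sup>2" using ab c by (intro power_mono) auto
    ultimately have "L\<^sup>2 * (b - a)\<^sup>2 \<le> c\<^sup>2 * (2 * c)\<^sup>2" by (intro mult_mono) auto
    then have "9 * (real d)\<^sup>2 * (L\<^sup>2 * (b - a)\<^sup>2) \<le> 9 * (real d)\<^sup>2 * (c\<^sup>2 * (2 * c)\<^sup>2)" by (intro mult_left_mono) auto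
    also have "\<dots> = 36 * (real d)\<^sup>2 * c ^ 4" by (simp add: power2_eq_square power4_eq_xxxx)
    finally show "9 * (real d)\<^sup>2 * L\<^sup>2 * (b - a)\<^sup>2 \<le> 36 * (real d)\<^sup>2 * c ^ 4" by (simp add: mult.assoc)
  qed simp
  have s2: "?t2 \<le> 4 * real LL * w ^ LL * c ^ (LL + 2) * max 1 p / ?k"
  proof (intro divide_right_mono)
    have "4 * (v - u) * real LL * w ^ LL * c ^ (LL + 1) * max 1 p
        = (v - u) * (4 * real LL * w ^ LL * c ^ (LL + 1) * max 1 p)" by (simp only: mult_ac)
    also have "\<dots> \<le> c * (4 * real LL * w ^ LL * c ^ (LL + 1) * max 1 p)"
      using vu LL w2 c by (intro mult_right_mono) auto
    also have "\<dots> = 4 * real LL * w ^ LL * c ^ (LL + 2) * max 1 p" by simp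
    finally show "4 * (v - u) * real LL * w ^ LL * c ^ (LL + 1) * max 1 p \<le> 4 * real LL * w ^ LL * c ^ (LL + 2) * max 1 p" .
  qed simp
  have s3: "?t3 \<le> 23 * B ^ 3 * real LL * w\<^sup>2 * max p (ln (exp 1 * real M)) / sqrt (real M)"
  proof (intro divide_right_mono)
    have "(v - u)\<^sup>2 \<le> c\<^sup>2" "1 \<le> c\<^sup>2" "c\<^sup>2 \<le> B\<^sup>2"
      using vu c assms(11) by (auto intro: power_mono one_le_power)
    then have m: "max 1 ((v - u)\<^sup>2) \<le> B\<^sup>2" by simp
    have "18 * ln (3 * real M * B * c) \<le> 23 * B * ln (exp 1 * real M)"
      using c(1) assms(11) M(1) by (rule ln_three_mul_le)
    moreover have "23 * B * ln (exp 1 * real M) \<le> 23 * B * max p (ln (exp 1 * real M))"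
      using B by (intro mult_left_mono) auto
    moreover have "18 * p \<le> 23 * B * p" using B p by (intro mult_right_mono) auto
    moreover have "23 * B * p \<le> 23 * B * max p (ln (exp 1 * real M))" using B by (intro mult_left_mono) auto
    ultimately have g18: "18 * g \<le> 23 * B * max p (ln (exp 1 * real M))" by (auto simp: g_def max_def)
    have "max 1 ((v - u)\<^sup>2) * (18 * g) \<le> B\<^sup>2 * (23 * B * max p (ln (exp 1 * real M)))"
      by (rule mult_mono[OF m g18]) (use g in auto)
    then have "real LL * w\<^sup>2 * (max 1 ((v - u)\<^sup>2) * (18 * g))
        \<le> real LL * w\<^sup>2 * (B\<^sup>2 * (23 * B * max p (ln (exp 1 * real M))))"
      by (intro mult_left_mono) auto
    then show "18 * max 1 ((v - u)\<^sup>2) * real LL * w\<^sup>2 * g \<le> 23 * B ^ 3 * real LL * w\<^sup>2 * max p (ln (exp 1 * real M))"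
      by (simp add: mult_ac power2_eq_square power3_eq_cube)
  qed simp
  show "(\<integral>\<omega>. (LINT x : cube d a b | distr P (vec_space d) (X 1).
               \<bar>clipped_dnn u v (\<Theta> (fst (kk \<omega>)) (snd (kk \<omega>)) \<omega>) LL l x 1 - \<E> x\<bar>\<^sup>2) powr p \<partial>P)
        powr (1 / p)
      \<le> 9 * (real d)\<^sup>2 * L\<^sup>2 * (b - a)\<^sup>2 / A powr (2 / real d)
        + 4 * (v - u) * real LL * (maxnorm {0..LL} (\<lambda>i. real (l i)) + 1) ^ LL * c ^ (LL + 1) * max 1 p
            / real K powr (1 / (real LL * (maxnorm {0..LL} (\<lambda>i. real (l i)) + 1)\<^sup>2))
        + 18 * max 1 ((v - u)\<^sup>2) * real LL * (maxnorm {0..LL} (\<lambda>i. real (l i)) + 1)\<^sup>2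
            * max p (ln (3 * real M * B * c)) / sqrt (real M)
    \<and> 9 * (real d)\<^sup>2 * L\<^sup>2 * (b - a)\<^sup>2 / A powr (2 / real d)
        + 4 * (v - u) * real LL * (maxnorm {0..LL} (\<lambda>i. real (l i)) + 1) ^ LL * c ^ (LL + 1) * max 1 p
            / real K powr (1 / (real LL * (maxnorm {0..LL} (\<lambda>i. real (l i)) + 1)\<^sup>2))
        + 18 * max 1 ((v - u)\<^sup>2) * real LL * (maxnorm {0..LL} (\<lambda>i. real (l i)) + 1)\<^sup>2
            * max p (ln (3 * real M * B * c)) / sqrt (real M)
      \<le> 36 * (real d)\<^sup>2 * c ^ 4 / A powr (2 / real d)
        + 4 * real LL * (maxnorm {0..LL} (\<lambda>i. real (l i)) + 1) ^ LL * c ^ (LL + 2) * max 1 p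
            / real K powr (1 / (real LL * (maxnorm {0..LL} (\<lambda>i. real (l i)) + 1)\<^sup>2))
        + 23 * B ^ 3 * real LL * (maxnorm {0..LL} (\<lambda>i. real (l i)) + 1)\<^sup>2
            * max p (ln (exp 1 * real M)) / sqrt (real M)"
    using first add_mono[OF add_mono[OF s1 s2] s3]
    unfolding F_def R.net_def w_def[symmetric] g_def[symmetric] by (rule conjI)
qed

end
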